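(* Let $\mathcal{M}$ be a Type $\mathcal{B}$ affine surface which is not flat, with Christoffel symbols $\Gamma_{ij}{}^k=(x^1)^{-1}C_{ij}{}^k$, $C_{ij}{}^k=C_{ji}{}^k$ constant, in Type $\mathcal{B}$ coordinates. The following conditions are equivalent: \begin{enumerate} \item $\mathcal{M}$ is also of Type $\mathcal{A}$. \item $\rho$ is symmetric, recurrent, and of rank $1$, and $\nabla\rho$ is symmetric. \item $\dim\{\mathfrak{K}(\mathcal{M})\}=4$. \item $C_{12}{}^1=C_{22}{}^1=C_{22}{}^2=0$. \end{enumerate}
   Context: An affine surface is a smooth surface with a torsion-free connection, $\nabla_{\partial_i}\partial_j=\Gamma_{ij}{}^k\partial_k$; it is locally homogeneous if any two points are related by a germ of a $\nabla$-preserving diffeomorphism. A non-flat locally homogeneous affine surface is of Type $\mathcal{A}$ (resp. Type $\mathcal{B}$) if near each point there are local coordinates $(x^1,x^2)$ in which $\Gamma_{ij}{}^k$ are constant (resp. $\Gamma_{ij}{}^k=(x^1)^{-1}C_{ij}{}^k$ with $C_{ij}{}^k$ constant). $R(\xi_1,\xi_2)=\nabla_{\xi_1}\nabla_{\xi_2}-\nabla_{\xi_2}\nabla_{\xi_1}-\nabla_{[\xi_1,\xi_2]}$ and $\rho(\xi_1,\xi_2)=\operatorname{Tr}\{\xi_3\mapsto R(\xi_3,\xi_1)\xi_2\}$. A tensor is symmetric if invariant under all permutations of its arguments, and $T$ is recurrent if $\nabla T=\omega\otimes T$ for some $1$-form $\omega$. $\mathfrak{K}(\mathcal{M})$ is the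 Lie algebra of affine Killing vector fields ($\mathcal{L}_X\nabla=0$), understood locally (germs at a point). *)

theory Defs
  imports "HOL-Analysis.Analysis"
begin

section \<open>Calculus in coordinates\<close>

definition pd :: "2 \<Rightarrow> (real^2 \<Rightarrow> real) \<Rightarrow> real^2 \<Rightarrow> real" where
  "pd i f x = frechet_derivative f (at x) (axis i 1)"

primrec Ck_on :: "nat \<Rightarrow> (real^2) set \<Rightarrow> (real^2 \<Rightarrow> real) \<Rightarrow> bool" where
  "Ck_on 0 S f \<longleftrightarrow> continuous_on S f"
| "Ck_on (Suc k) S f \<longleftrightarrow> f differentiable_on S \<and> (\<forall>i. Ck_on k S (pd i f))"

text \<open>Smoothness; only used for open \<open>S\<close>.\<close>

definition smooth_on :: "(real^2) set \<Rightarrow> (real^2 \<Rightarrow> real) \<Rightarrow> bool" where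
  "smooth_on S f \<longleftrightarrow> (\<forall>k. Ck_on k S f)"

definition smooth_map_on :: "(real^2) set \<Rightarrow> (real^2 \<Rightarrow> real^2) \<Rightarrow> bool" where
  "smooth_map_on S X \<longleftrightarrow> (\<forall>k. smooth_on S (\<lambda>x. X x $ k))"

text \<open>\<open>\<Gamma> i j k x\<close> is the Christoffel symbol \<open>\<Gamma>\<^sub>i\<^sub>j\<^sup>k\<close> at \<open>x\<close>, the last index being the upper one:
  \<open>\<nabla>\<^bsub>\<partial>\<^sub>i\<^esub> \<partial>\<^sub>j = (\<Sum>k. \<Gamma>\<^sub>i\<^sub>j\<^sup>k \<partial>\<^sub>k)\<close>. The index type \<open>2\<close> has the two elements \<open>1\<close> and \<open>2\<close>.\<close>

type_synonym christoffel = "2 \<Rightarrow> 2 \<Rightarrow> 2 \<Rightarrow> real^2 \<Rightarrow> real"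
type_synonym vfield = "real^2 \<Rightarrow> real^2"

definition coord_field :: "2 \<Rightarrow> vfield" where
  "coord_field i = (\<lambda>x. axis i 1)"

definition nabla :: "christoffel \<Rightarrow> vfield \<Rightarrow> vfield \<Rightarrow> vfield" where
  "nabla \<Gamma> X Y x =
     (\<chi> k. \<Sum>i\<in>UNIV. X x $ i * (pd i (\<lambda>y. Y y $ k) x + (\<Sum>j\<in>UNIV. \<Gamma> i j k x * Y x $ j)))"

definition bracket :: "vfield \<Rightarrow> vfield \<Rightarrow> vfield" where
  "bracket X Y x =
     (\<chi> k. \<Sum>i\<in>UNIV. X x $ i * pd i (\<lambda>y. Y y $ k) x - Y x $ i * pd i (\<lambda>y. X y $ k) x)"

definition curvature :: "christoffel \<Rightarrow> vfield \<Rightarrow> vfield \<Rightarrow> vfield \<Rightarrow> vfield" where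
  "curvature \<Gamma> X Y Z x =
     nabla \<Gamma> X (nabla \<Gamma> Y Z) x - nabla \<Gamma> Y (nabla \<Gamma> X Z) x - nabla \<Gamma> (bracket X Y) Z x"

definition ricci :: "christoffel \<Rightarrow> 2 \<Rightarrow> 2 \<Rightarrow> real^2 \<Rightarrow> real" where
  "ricci \<Gamma> i j x =
     (\<Sum>k\<in>UNIV. curvature \<Gamma> (coord_field k) (coord_field i) (coord_field j) x $ k)"

text \<open>\<open>nabla_tensor2 \<Gamma> T k i j\<close> is \<open>(\<nabla>\<^bsub>\<partial>\<^sub>k\<^esub> T)(\<partial>\<^sub>i, \<partial>\<^sub>j)\<close>: the differentiation index comes first.\<close>

definition nabla_tensor2 ::
    "christoffel \<Rightarrow> (2 \<Rightarrow> 2 \<Rightarrow> real^2 \<Rightarrow> real) \<Rightarrow> 2 \<Rightarrow> 2 \<Rightarrow> 2 \<Rightarrow> real^2 \<Rightarrow> real" where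
  "nabla_tensor2 \<Gamma> T k i j x =
     pd k (T i j) x - (\<Sum>l\<in>UNIV. \<Gamma> k i l x * T l j x) - (\<Sum>l\<in>UNIV. \<Gamma> k j l x * T i l x)"

text \<open>\<open>affine_map_on S \<Gamma> \<Gamma>' \<tau>\<close>: the smooth map \<open>\<tau>\<close>, defined on \<open>S\<close>, intertwines the connections
  with symbols \<open>\<Gamma>\<close> and \<open>\<Gamma>'\<close>. When \<open>\<tau>\<close> is a coordinate change, this is the transformation law of
  Christoffel symbols.\<close>

definition affine_map_on ::
    "(real^2) set \<Rightarrow> christoffel \<Rightarrow> christoffel \<Rightarrow> (real^2 \<Rightarrow> real^2) \<Rightarrow> bool" where
  "affine_map_on S \<Gamma> \<Gamma>' \<tau> \<longleftrightarrow> smooth_map_on S \<tau> \<and>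
     (\<forall>x\<in>S. \<forall>i j c.
        pd i (pd j (\<lambda>y. \<tau> y $ c)) x
        + (\<Sum>a\<in>UNIV. \<Sum>b\<in>UNIV.
             pd i (\<lambda>y. \<tau> y $ a) x * pd j (\<lambda>y. \<tau> y $ b) x * \<Gamma>' a b c (\<tau> x))
        = (\<Sum>k\<in>UNIV. \<Gamma> i j k x * pd k (\<lambda>y. \<tau> y $ c) x))"


section \<open>Affine surfaces\<close>

text \<open>A surface is carried by a Hausdorff second countable type \<open>'a\<close>. A chart consists of its
  domain, its coordinate map and the Christoffel symbols of the connection in these coordinates;
  values outside the domain (respectively outside its image) are irrelevant.\<close>

type_synonym 'a chart = "'a set \<times> ('a \<Rightarrow> real^2) \<times> christoffel"

definition chart_dom :: "'a chart \<Rightarrow> 'a set" where "chart_dom c = fst c"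
definition chart_map :: "'a chart \<Rightarrow> 'a \<Rightarrow> real^2" where "chart_map c = fst (snd c)"
definition chart_sym :: "'a chart \<Rightarrow> christoffel" where "chart_sym c = snd (snd c)"

definition chart_image :: "'a chart \<Rightarrow> (real^2) set" where
  "chart_image c = chart_map c ` chart_dom c"

definition is_chart :: "'a::topological_space chart \<Rightarrow> bool" where
  "is_chart c \<longleftrightarrow>
     open (chart_dom c) \<and> open (chart_image c) \<and>
     homeomorphism (chart_dom c) (chart_image c) (chart_map c) (inv_into (chart_dom c) (chart_map c)) \<and>
     (\<forall>i j k. smooth_on (chart_image c) (chart_sym c i j k)) \<and>
     (\<forall>x\<in>chart_image c. \<forall>i j k. chart_sym c i j k x = chart_sym c j i k x)"

definition in_charts :: "'a chart \<Rightarrow> 'a chart \<Rightarrow> ('a \<Rightarrow> 'a) \<Rightarrow> real^2 \<Rightarrow> real^2" where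
  "in_charts c d f = chart_map d \<circ> f \<circ> inv_into (chart_dom c) (chart_map c)"

text \<open>\<open>f\<close>, restricted to the open set \<open>W\<close>, preserves the connection as seen in the charts
  \<open>c\<close> (source) and \<open>d\<close> (target).\<close>

definition affine_between :: "'a set \<Rightarrow> ('a \<Rightarrow> 'a) \<Rightarrow> 'a chart \<Rightarrow> 'a chart \<Rightarrow> bool" where
  "affine_between W f c d \<longleftrightarrow>
     affine_map_on (chart_map c ` {p \<in> W \<inter> chart_dom c. f p \<in> chart_dom d})
       (chart_sym c) (chart_sym d) (in_charts c d f)"

definition compatible :: "'a chart \<Rightarrow> 'a chart \<Rightarrow> bool" where
  "compatible c d \<longleftrightarrow> affine_between UNIV (\<lambda>p. p) c d \<and> affine_between UNIV (\<lambda>p. p) d c"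

text \<open>An affine surface is given by an atlas, not required to be maximal.\<close>

definition affine_surface ::
    "'a::{t2_space, second_countable_topology} chart set \<Rightarrow> bool" where
  "affine_surface M \<longleftrightarrow>
     (\<forall>c\<in>M. is_chart c) \<and> (\<Union>c\<in>M. chart_dom c) = UNIV \<and> (\<forall>c\<in>M. \<forall>d\<in>M. compatible c d)"

text \<open>All local coordinate systems of the surface, i.e. the maximal atlas.\<close>

definition local_coordinates :: "'a::topological_space chart set \<Rightarrow> 'a chart set" where
  "local_coordinates M = {c. is_chart c \<and> (\<forall>d\<in>M. compatible c d)}"

definition local_affine_diffeo ::
    "'a::topological_space chart set \<Rightarrow> 'a set \<Rightarrow> ('a \<Rightarrow> 'a) \<Rightarrow> bool" where
  "local_affine_diffeo M W f \<longleftrightarrow>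
     open W \<and> open (f ` W) \<and> homeomorphism W (f ` W) f (inv_into W f) \<and>
     (\<forall>c\<in>M. \<forall>d\<in>M. affine_between W f c d \<and> affine_between (f ` W) (inv_into W f) c d)"

definition locally_homogeneous :: "'a::topological_space chart set \<Rightarrow> bool" where
  "locally_homogeneous M \<longleftrightarrow>
     (\<forall>p q. \<exists>W f. p \<in> W \<and> f p = q \<and> local_affine_diffeo M W f)"

definition flat_surface :: "'a chart set \<Rightarrow> bool" where
  "flat_surface M \<longleftrightarrow>
     (\<forall>c\<in>M. \<forall>x\<in>chart_image c. \<forall>i j k.
        curvature (chart_sym c) (coord_field i) (coord_field j) (coord_field k) x = 0)"

definition type_A_coordinates :: "'a chart \<Rightarrow> bool" where
  "type_A_coordinates c \<longleftrightarrow>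
     (\<exists>A. \<forall>x\<in>chart_image c. \<forall>i j k. chart_sym c i j k x = A i j k)"

definition type_B_coordinates :: "'a chart \<Rightarrow> (2 \<Rightarrow> 2 \<Rightarrow> 2 \<Rightarrow> real) \<Rightarrow> bool" where
  "type_B_coordinates c C \<longleftrightarrow>
     (\<forall>x\<in>chart_image c. x $ 1 \<noteq> 0 \<and> (\<forall>i j k. chart_sym c i j k x = inverse (x $ 1) * C i j k))"

definition type_A :: "'a::topological_space chart set \<Rightarrow> bool" where
  "type_A M \<longleftrightarrow> \<not> flat_surface M \<and> locally_homogeneous M \<and>
     (\<forall>p. \<exists>c\<in>local_coordinates M. p \<in> chart_dom c \<and> type_A_coordinates c)"

definition type_B :: "'a::topological_space chart set \<Rightarrow> bool" where
  "type_B M \<longleftrightarrow> \<not> flat_surface M \<and> locally_homogeneous M \<and>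
     (\<forall>p. \<exists>c\<in>local_coordinates M. p \<in> chart_dom c \<and> (\<exists>C. type_B_coordinates c C))"


section \<open>Tensors\<close>

text \<open>Tensor fields are given by their components in every chart of the atlas.\<close>

type_synonym 'a tensor2 = "'a chart \<Rightarrow> 2 \<Rightarrow> 2 \<Rightarrow> real^2 \<Rightarrow> real"
type_synonym 'a tensor3 = "'a chart \<Rightarrow> 2 \<Rightarrow> 2 \<Rightarrow> 2 \<Rightarrow> real^2 \<Rightarrow> real"

definition Ricci :: "'a tensor2" where
  "Ricci c = ricci (chart_sym c)"

definition Nabla2 :: "'a tensor2 \<Rightarrow> 'a tensor3" where
  "Nabla2 T c = nabla_tensor2 (chart_sym c) (T c)"

definition one_form :: "'a chart set \<Rightarrow> ('a chart \<Rightarrow> 2 \<Rightarrow> real^2 \<Rightarrow> real) \<Rightarrow> bool" where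
  "one_form M \<omega> \<longleftrightarrow>
     (\<forall>c\<in>M. \<forall>i. smooth_on (chart_image c) (\<omega> c i)) \<and>
     (\<forall>c\<in>M. \<forall>d\<in>M. \<forall>x\<in>chart_map c ` (chart_dom c \<inter> chart_dom d). \<forall>i.
        \<omega> c i x = (\<Sum>a\<in>UNIV. pd i (\<lambda>y. in_charts c d (\<lambda>p. p) y $ a) x
                            * \<omega> d a (in_charts c d (\<lambda>p. p) x)))"

definition symmetric2 :: "'a chart set \<Rightarrow> 'a tensor2 \<Rightarrow> bool" where
  "symmetric2 M T \<longleftrightarrow> (\<forall>c\<in>M. \<forall>x\<in>chart_image c. \<forall>i j. T c i j x = T c j i x)"

definition symmetric3 :: "'a chart set \<Rightarrow> 'a tensor3 \<Rightarrow> bool" where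
  "symmetric3 M T \<longleftrightarrow> (\<forall>c\<in>M. \<forall>x\<in>chart_image c. \<forall>i j k.
     T c i j k x = T c i k j x \<and> T c i j k x = T c j i k x \<and> T c i j k x = T c j k i x \<and>
     T c i j k x = T c k i j x \<and> T c i j k x = T c k j i x)"

definition recurrent :: "'a chart set \<Rightarrow> 'a tensor2 \<Rightarrow> bool" where
  "recurrent M T \<longleftrightarrow> (\<exists>\<omega>. one_form M \<omega> \<and>
     (\<forall>c\<in>M. \<forall>x\<in>chart_image c. \<forall>k i j. Nabla2 T c k i j x = \<omega> c k x * T c i j x))"

definition has_rank :: "'a chart set \<Rightarrow> 'a tensor2 \<Rightarrow> nat \<Rightarrow> bool" where
  "has_rank M T r \<longleftrightarrow>
     (\<forall>c\<in>M. \<forall>x\<in>chart_image c. rank ((\<chi> i j. T c i j x) :: real^2^2) = r)"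


section \<open>Affine Killing vector fields\<close>

text \<open>\<open>\<L>\<^sub>X \<nabla> = 0\<close>, written out as \<open>[X, \<nabla>\<^sub>Y Z] = \<nabla>\<^bsub>[X,Y]\<^esub> Z + \<nabla>\<^sub>Y [X, Z]\<close>.\<close>

definition killing_on :: "christoffel \<Rightarrow> (real^2) set \<Rightarrow> vfield \<Rightarrow> bool" where
  "killing_on \<Gamma> N X \<longleftrightarrow> smooth_map_on N X \<and>
     (\<forall>Y Z. smooth_map_on N Y \<longrightarrow> smooth_map_on N Z \<longrightarrow>
        (\<forall>x\<in>N. bracket X (nabla \<Gamma> Y Z) x =
                nabla \<Gamma> (bracket X Y) Z x + nabla \<Gamma> Y (bracket X Z) x))"

definition killing_near :: "'a chart \<Rightarrow> 'a \<Rightarrow> vfield \<Rightarrow> bool" where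
  "killing_near c p X \<longleftrightarrow>
     (\<exists>N. open N \<and> chart_map c p \<in> N \<and> N \<subseteq> chart_image c \<and> killing_on (chart_sym c) N X)"

text \<open>The space of germs at \<open>p\<close> of affine Killing fields, expressed in the chart \<open>c\<close>, has a basis
  of \<open>n\<close> elements. Two fields have the same germ if they agree near \<open>chart_map c p\<close>.\<close>

definition killing_dim :: "'a chart \<Rightarrow> 'a \<Rightarrow> nat \<Rightarrow> bool" where
  "killing_dim c p n \<longleftrightarrow> (\<exists>X :: nat \<Rightarrow> vfield.
     (\<forall>m<n. killing_near c p (X m)) \<and>
     (\<forall>a :: nat \<Rightarrow> real.
        (\<forall>\<^sub>F x in nhds (chart_map c p). (\<Sum>m<n. a m *\<^sub>R X m x) = 0) \<longrightarrow> (\<forall>m<n. a m = 0)) \<and>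
     (\<forall>Y. killing_near c p Y \<longrightarrow>
        (\<exists>a :: nat \<Rightarrow> real. \<forall>\<^sub>F x in nhds (chart_map c p). Y x = (\<Sum>m<n. a m *\<^sub>R X m x))))"

definition dim_killing :: "'a chart set \<Rightarrow> nat \<Rightarrow> bool" where
  "dim_killing M n \<longleftrightarrow> (\<forall>p. \<forall>c\<in>M. p \<in> chart_dom c \<longrightarrow> killing_dim c p n)"

end

theory Submission
  imports Defs
begin

text \<open>Each of the four conditions is turned into a property of a single germ of the connection, which is
  invariant under affine diffeomorphisms and hence, by local homogeneity, holds at one point of one
  coordinate system iff it holds everywhere.

  The middle term is the pointwise normal form \<open>\<rho> = e a \<otimes> a\<close>, \<open>\<nabla>\<rho> = t a \<otimes> a \<otimes> a\<close> with \<open>a \<noteq> 0 \<noteq> e\<close>, which is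
  condition (2). In Type \<open>\<B>\<close> coordinates the kernel of \<open>a\<close> is then a parallel distribution, and homogeneity
  of \<open>\<rho>\<close> of degree \<open>-2\<close> forces it to be spanned by \<open>\<partial>\<^sub>2\<close>; this is (4). Given (4), the coordinates
  \<open>(ln \<bar>x\<^sup>1\<bar>, x\<^sup>2 - \<phi>(x\<^sup>1))\<close> have constant Christoffel symbols, with only \<open>\<Gamma>\<^sub>1\<^sub>1\<^sup>1\<close> and \<open>\<Gamma>\<^sub>1\<^sub>2\<^sup>2\<close> possibly
  non-zero, and there the Killing fields are \<open>\<partial>\<^sub>u\<close>, \<open>\<partial>\<^sub>v\<close>, \<open>v \<partial>\<^sub>v\<close>, \<open>f(u) \<partial>\<^sub>v\<close>; this gives (1) and (3).
  If (3) holds, at least two independent Killing germs vanish at a given point, and the plane of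
  their linear parts annihilates \<open>\<rho>\<close> and \<open>\<nabla>\<rho>\<close>; that leaves only the normal form, because a Killing germ
  is determined by its 1-jet. Finally, let (1) hold. In Type \<open>\<A>\<close> coordinates \<open>\<rho>\<close> is constant; if it were
  non-degenerate, all Killing fields would be constant and so would commute, but in Type \<open>\<B>\<close> coordinates
  \<open>\<partial>\<^sub>2\<close> and \<open>x\<^sup>1 \<partial>\<^sub>1 + x\<^sup>2 \<partial>\<^sub>2\<close> do not. So \<open>\<rho>\<close> has rank 1, and the symmetry of \<open>\<nabla>\<rho>\<close> yields the normal form.\<close>

section \<open>Partial derivatives and smooth functions\<close>

text \<open>Condition (1) supplies a chart with constant symbols but no relation between it and the
  given Type B chart. Coordinate changes are therefore never solved for; only invariants of pointed
  germs are compared. Non-flatness enters as \<rho> \<noteq> 0, because in dimension two the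
  curvature is determined by \<rho>. For (3), evaluation at a point maps a four-dimensional space to
  the plane, which gives the two germs vanishing there. The delicate case is an alternating \<rho>:
  it is an area form, and its stabiliser sl(2) does contain planes. It is excluded by combining the
  invariance of \<nabla>\<rho> with the Type B identity
  \<open>\<rho> 1 2 - \<rho> 2 1 = C 1 2 1 + C 2 2 2\<close>. For (1), a non-degenerate \<rho> acts
  as a flat metric in Type A coordinates, so the second derivatives of a Killing field vanish. A
  non-zero linear part would be an invertible trace-free derivation annihilating the Christoffel
  symbols. Since these have an odd number of slots, they would vanish, and \<rho> with them. The
  symmetry of \<nabla>\<rho> in these coordinates is an algebraic identity.\<close>

abbreviation pdc :: "2 \<Rightarrow> vfield \<Rightarrow> 2 \<Rightarrow> real^2 \<Rightarrow> real" where
  "pdc i X k \<equiv> pd i (\<lambda>y. X y $ k)"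

lemma has_derivative_imp_pd:
  assumes "(f has_derivative D) (at x)"
  shows "pd i f x = D (axis i 1)"
  using frechet_derivative_at[OF assms] by (simp add: pd_def)

lemma vec2_expand: "(h::real^2) = h $ 1 *\<^sub>R axis 1 1 + h $ 2 *\<^sub>R axis 2 1"
  by (simp add: vec_eq_iff forall_2 axis_def)

lemma has_derivative_pd:
  assumes "f differentiable (at x)"
  shows "(f has_derivative (\<lambda>h. pd 1 f x * h $ 1 + pd 2 f x * h $ 2)) (at x)"
proof -
  obtain D where D: "(f has_derivative D) (at x)"
    using assms by (auto simp: differentiable_def)
  interpret D: linear D using D has_derivative_linear by blast
  have "D h = pd 1 f x * h $ 1 + pd 2 f x * h $ 2" for h
    by (subst vec2_expand[of h]) (simp add: D.add D.scale has_derivative_imp_pd[OF D])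
  then show ?thesis using D by (metis (no_types, lifting) ext)
qed

lemma pd_cong:
  assumes "\<forall>\<^sub>F y in nhds x. f y = g y"
  shows "pd i f x = pd i g x"
proof -
  have ev: "\<forall>\<^sub>F y in at x. f y = g y" "\<forall>\<^sub>F y in at x. g y = f y" "f x = g x"
    using assms eventually_nhds_x_imp_x[OF assms] by (auto simp: eventually_at_filter elim: eventually_mono)
  have "(f has_derivative D) (at x) \<longleftrightarrow> (g has_derivative D) (at x)" for D
    using ev has_derivative_transform_eventually[of f D x UNIV g] has_derivative_transform_eventually[of g D x UNIV f]
    by auto
  then show ?thesis by (simp add: pd_def frechet_derivative_def)
qed

lemma pd_cong_open:
  assumes "open S" "x \<in> S" "\<And>y. y \<in> S \<Longrightarrow> f y = g y"
  shows "pd i f x = pd i g x"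
  by (rule pd_cong) (use assms eventually_nhds in blast)

lemma pd_const [simp]: "pd i (\<lambda>x. a) x = 0"
  by (subst has_derivative_imp_pd[of _ "\<lambda>h. 0"]) auto

lemma pd_coord [simp]: "pd i (\<lambda>x. x $ j) x = (if i = j then 1 else 0)"
  using has_derivative_imp_pd[OF bounded_linear.has_derivative[OF bounded_linear_vec_nth[of j] has_derivative_ident], where i = i]
  by (simp add: axis_def)

lemma pd_add:
  assumes "f differentiable (at x)" "g differentiable (at x)"
  shows "pd i (\<lambda>x. f x + g x) x = pd i f x + pd i g x"
  by (subst has_derivative_imp_pd[OF has_derivative_add[OF has_derivative_pd has_derivative_pd]])
     (use assms exhaust_2[of i] in \<open>auto simp: axis_def\<close>)

lemma pd_diff:
  assumes "f differentiable (at x)" "g differentiable (at x)"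
  shows "pd i (\<lambda>x. f x - g x) x = pd i f x - pd i g x"
  by (subst has_derivative_imp_pd[OF has_derivative_diff[OF has_derivative_pd has_derivative_pd]])
     (use assms exhaust_2[of i] in \<open>auto simp: axis_def\<close>)

lemma pd_minus:
  assumes "f differentiable (at x)"
  shows "pd i (\<lambda>x. - f x) x = - pd i f x"
  by (subst has_derivative_imp_pd[OF has_derivative_minus[OF has_derivative_pd]])
     (use assms exhaust_2[of i] in \<open>auto simp: axis_def\<close>)

lemma pd_mult:
  assumes "f differentiable (at x)" "g differentiable (at x)"
  shows "pd i (\<lambda>x. f x * g x) x = pd i f x * g x + f x * pd i g x"
  by (subst has_derivative_imp_pd[OF has_derivative_mult[OF has_derivative_pd has_derivative_pd]])
     (use assms exhaust_2[of i] in \<open>auto simp: axis_def\<close>)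

lemma pd_cmult:
  assumes "f differentiable (at x)"
  shows "pd i (\<lambda>x. a * f x) x = a * pd i f x"
  using pd_mult[OF differentiable_const assms] by simp

lemma pd_real_comp:
  assumes "f differentiable (at x)" "(h has_real_derivative h') (at (f x))"
  shows "pd i (\<lambda>x. h (f x)) x = h' * pd i f x"
proof -
  have "((\<lambda>x. h (f x)) has_derivative (\<lambda>t. h' * (pd 1 f x * t $ 1 + pd 2 f x * t $ 2))) (at x)"
    using has_derivative_compose[OF has_derivative_pd[OF assms(1)]] assms(2)
    by (auto simp: has_field_derivative_def)
  from has_derivative_imp_pd[OF this] show ?thesis
    using exhaust_2[of i] by (auto simp: axis_def)
qed

lemma differentiable_real_comp:
  fixes f :: "real^2 \<Rightarrow> real"
  assumes "f differentiable (at x)" "(h has_real_derivative h') (at (f x))"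
  shows "(\<lambda>x. h (f x)) differentiable (at x)"
  using has_derivative_compose[OF has_derivative_pd[OF assms(1)]] assms(2)
  unfolding differentiable_def has_field_derivative_def by blast

lemma has_derivative_vec2:
  fixes \<tau> :: "real^2 \<Rightarrow> real^2"
  assumes "\<And>a. (\<lambda>y. \<tau> y $ a) differentiable (at x)"
  shows "(\<tau> has_derivative (\<lambda>h. \<chi> a. pdc 1 \<tau> a x * h $ 1 + pdc 2 \<tau> a x * h $ 2)) (at x)"
proof -
  have eq: "(\<Sum>i\<in>UNIV. (\<chi> a. g a) $ i *\<^sub>R axis i (1::real)) = (\<chi> a. g a)" for g :: "2 \<Rightarrow> real"
    by (simp add: vec_eq_iff sum_2 forall_2 axis_def)
  have eq': "(\<lambda>y. \<Sum>i\<in>UNIV. \<tau> y $ i *\<^sub>R axis i 1) = \<tau>"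
    by (auto simp: fun_eq_iff vec_eq_iff sum_2 forall_2 axis_def)
  have "((\<lambda>y. \<Sum>i\<in>UNIV. \<tau> y $ i *\<^sub>R axis i (1::real)) has_derivative
        (\<lambda>h. \<Sum>i\<in>UNIV. (pdc 1 \<tau> i x * h $ 1 + pdc 2 \<tau> i x * h $ 2) *\<^sub>R axis i 1)) (at x)"
    by (intro has_derivative_sum has_derivative_scaleR_left has_derivative_pd assms)
  then show ?thesis unfolding eq'
    by (rule has_derivative_eq_rhs) (auto simp: fun_eq_iff vec_eq_iff sum_2 forall_2 axis_def)
qed

lemma differentiable_chain2:
  assumes "\<And>a. (\<lambda>y. \<tau> y $ a) differentiable (at x)" "f differentiable (at (\<tau> x))"
  shows "(\<lambda>y. f (\<tau> y :: real^2) :: real) differentiable (at (x::real^2))"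
  using has_derivative_compose[OF has_derivative_vec2[of \<tau>, OF assms(1)] has_derivative_pd[OF assms(2)]]
  unfolding differentiable_def by blast

lemma pd_chain:
  assumes "\<And>a. (\<lambda>y. \<tau> y $ a) differentiable (at x)" "f differentiable (at (\<tau> x))"
  shows "pd i (\<lambda>y. f (\<tau> y)) x = (\<Sum>a\<in>UNIV. pd a f (\<tau> x) * pdc i \<tau> a x)"
  using has_derivative_imp_pd[OF has_derivative_compose[OF has_derivative_vec2[of \<tau>, OF assms(1)] has_derivative_pd[OF assms(2)]], of i]
    exhaust_2[of i] by (auto simp: axis_def sum_2)

section \<open>Functions of class C^k and smooth functions\<close>

lemma Ck_on_cong:
  assumes "open S" "\<And>x. x \<in> S \<Longrightarrow> f x = g x"
  shows "Ck_on k S f \<longleftrightarrow> Ck_on k S g"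
  using assms(2)
proof (induction k arbitrary: f g)
  case 0
  then show ?case by (auto cong: continuous_on_cong)
next
  case (Suc k)
  have "f differentiable_on S \<longleftrightarrow> g differentiable_on S"
    unfolding differentiable_on_def differentiable_def
    using Suc.prems has_derivative_transform[of _ S f g] has_derivative_transform[of _ S g f] by metis
  moreover have "Ck_on k S (pd i f) \<longleftrightarrow> Ck_on k S (pd i g)" for i
    by (rule Suc.IH) (use pd_cong_open[OF assms(1)] Suc.prems in blast)
  ultimately show ?case by simp
qed

lemma Ck_on_Suc_imp: "Ck_on (Suc k) S f \<Longrightarrow> Ck_on k S f"
  by (induction k arbitrary: f) (auto intro: differentiable_imp_continuous_on)

lemma Ck_on_subset: "Ck_on k S f \<Longrightarrow> T \<subseteq> S \<Longrightarrow> Ck_on k T f"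
  by (induction k arbitrary: f) (auto intro: continuous_on_subset differentiable_on_subset)

lemma smooth_on_cong:
  "open S \<Longrightarrow> (\<And>x. x \<in> S \<Longrightarrow> f x = g x) \<Longrightarrow> smooth_on S f \<longleftrightarrow> smooth_on S g"
  unfolding smooth_on_def using Ck_on_cong by blast

lemma smooth_on_subset: "smooth_on S f \<Longrightarrow> T \<subseteq> S \<Longrightarrow> smooth_on T f"
  unfolding smooth_on_def using Ck_on_subset by blast

lemma smooth_on_pd: "smooth_on S f \<Longrightarrow> smooth_on S (pd i f)"
  unfolding smooth_on_def using Ck_on.simps(2) by blast

lemma smooth_on_differentiable: "smooth_on S f \<Longrightarrow> open S \<Longrightarrow> x \<in> S \<Longrightarrow> f differentiable (at x)"
  unfolding smooth_on_def
  by (metis Ck_on.simps(2) differentiable_on_eq_differentiable_at)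

lemma smooth_on_continuous: "smooth_on S f \<Longrightarrow> continuous_on S f"
  unfolding smooth_on_def using Ck_on.simps(1) by blast

lemma Ck_on_const: "Ck_on k S (\<lambda>x. a)"
proof (induction k arbitrary: a)
  case (Suc k)
  have "pd i (\<lambda>x. a) = (\<lambda>x. 0)" for i by (rule ext) simp
  with Suc show ?case by simp
qed simp

lemma smooth_on_const: "smooth_on S (\<lambda>x. a)"
  unfolding smooth_on_def using Ck_on_const by blast

lemma smooth_on_coord: "smooth_on S (\<lambda>x. x $ j)"
  unfolding smooth_on_def
proof
  fix k
  have pd: "pd i (\<lambda>x. x $ j) = (\<lambda>x. if i = j then 1 else 0)" for i by (rule ext) simp
  have "(\<lambda>x. x $ j) differentiable_on S"
    by (simp add: differentiable_on_def bounded_linear_imp_differentiable bounded_linear_vec_nth)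
  moreover from this have "continuous_on S (\<lambda>x. x $ j)" by (rule differentiable_imp_continuous_on)
  ultimately show "Ck_on k S (\<lambda>x. x $ j)"
    by (cases k) (simp_all add: pd Ck_on_const)
qed

lemma Ck_on_add:
  assumes "open S" "Ck_on k S f" "Ck_on k S g"
  shows "Ck_on k S (\<lambda>x. f x + g x)"
  using assms(2,3)
proof (induction k arbitrary: f g)
  case 0 then show ?case by (simp add: continuous_on_add continuous_on_mult)
next
  case (Suc k)
  then have d: "f differentiable (at x)" "g differentiable (at x)" if "x \<in> S" for x
    using that assms(1) by (auto simp: differentiable_on_eq_differentiable_at)
  have "Ck_on k S (pd i (\<lambda>x. f x + g x))" for i
    by (subst Ck_on_cong[OF assms(1), of _ "\<lambda>x. pd i f x + pd i g x"]) (use d Suc in \<open>auto simp: pd_add\<close>)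
  then show ?case using d assms(1)
    by (auto simp: differentiable_on_eq_differentiable_at intro!: differentiable_add)
qed

lemma Ck_on_mult:
  assumes "open S" "Ck_on k S f" "Ck_on k S g"
  shows "Ck_on k S (\<lambda>x. f x * g x)"
  using assms(2,3)
proof (induction k arbitrary: f g)
  case 0 then show ?case by (simp add: continuous_on_add continuous_on_mult)
next
  case (Suc k)
  then have d: "f differentiable (at x)" "g differentiable (at x)" if "x \<in> S" for x
    using that assms(1) by (auto simp: differentiable_on_eq_differentiable_at)
  have "Ck_on k S f" "Ck_on k S g" using Suc.prems Ck_on_Suc_imp by blast+
  then have "Ck_on k S (\<lambda>x. pd i f x * g x + f x * pd i g x)" for i
    using Suc by (intro Ck_on_add assms) auto
  then have "Ck_on k S (pd i (\<lambda>x. f x * g x))" for i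
    by (subst Ck_on_cong[OF assms(1), of _ "\<lambda>x. pd i f x * g x + f x * pd i g x"]) (use d in \<open>auto simp: pd_mult\<close>)
  then show ?case using d assms(1)
    by (auto simp: differentiable_on_eq_differentiable_at intro!: differentiable_mult)
qed

lemma smooth_on_add: "open S \<Longrightarrow> smooth_on S f \<Longrightarrow> smooth_on S g \<Longrightarrow> smooth_on S (\<lambda>x. f x + g x)"
  unfolding smooth_on_def using Ck_on_add by blast

lemma smooth_on_mult: "open S \<Longrightarrow> smooth_on S f \<Longrightarrow> smooth_on S g \<Longrightarrow> smooth_on S (\<lambda>x. f x * g x)"
  unfolding smooth_on_def using Ck_on_mult by blast

lemma smooth_on_minus: "open S \<Longrightarrow> smooth_on S f \<Longrightarrow> smooth_on S (\<lambda>x. - f x)"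
  using smooth_on_mult[OF _ smooth_on_const[of S "-1"], of f] by simp

lemma smooth_on_diff: "open S \<Longrightarrow> smooth_on S f \<Longrightarrow> smooth_on S g \<Longrightarrow> smooth_on S (\<lambda>x. f x - g x)"
  using smooth_on_add[OF _ _ smooth_on_minus, of S f g] by simp

lemma smooth_on_sum:
  assumes "open S" "finite A" "\<And>a. a \<in> A \<Longrightarrow> smooth_on S (f a)"
  shows "smooth_on S (\<lambda>x. \<Sum>a\<in>A. f a x)"
  using assms(2,3) by induction (auto intro: smooth_on_const smooth_on_add assms(1))

lemma smooth_on_chain:
  assumes "open S" "open T" "\<And>a. smooth_on S (\<lambda>x. \<tau> x $ a)" "\<tau> ` S \<subseteq> T" "smooth_on T f"
  shows "smooth_on S (\<lambda>x. f (\<tau> x))"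
  unfolding smooth_on_def
proof
  fix k
  show "Ck_on k S (\<lambda>x. f (\<tau> x))" using assms(5)
  proof (induction k arbitrary: f)
    case 0
    have "continuous_on S \<tau>"
      using assms(3) smooth_on_continuous by (subst continuous_on_vec_lambda[where f = "\<lambda>a x. \<tau> x $ a", simplified]) auto
    then show ?case using smooth_on_continuous[OF 0] assms(4)
      by (auto intro: continuous_on_compose2)
  next
    case (Suc k)
    have d: "(\<lambda>y. \<tau> y $ a) differentiable (at x)" "f differentiable (at (\<tau> x))" if "x \<in> S" for x a
      using that assms Suc.prems smooth_on_differentiable by blast+
    have "Ck_on k S (\<lambda>x. pd 1 f (\<tau> x) * pdc i \<tau> 1 x + pd 2 f (\<tau> x) * pdc i \<tau> 2 x)" for i
      using smooth_on_pd[OF assms(3)] Suc.IH[OF smooth_on_pd[OF Suc.prems]]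
      by (intro Ck_on_add Ck_on_mult assms(1)) (auto simp: smooth_on_def)
    then have "Ck_on k S (pd i (\<lambda>x. f (\<tau> x)))" for i
      by (subst Ck_on_cong[OF assms(1), of _ "\<lambda>x. pd 1 f (\<tau> x) * pdc i \<tau> 1 x + pd 2 f (\<tau> x) * pdc i \<tau> 2 x"])
        (use d in \<open>auto simp: pd_chain sum_2\<close>)
    moreover have "(\<lambda>x. f (\<tau> x)) differentiable_on S"
      using differentiable_chain2[of \<tau> _ f, OF d] assms(1)
      by (auto simp: differentiable_on_eq_differentiable_at)
    ultimately show ?case by simp
  qed
qed

lemma smooth_on_inverse:
  assumes "open S" "smooth_on S f" "\<And>x. x \<in> S \<Longrightarrow> f x \<noteq> 0"
  shows "smooth_on S (\<lambda>x. inverse (f x))"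
  unfolding smooth_on_def
proof
  fix k
  show "Ck_on k S (\<lambda>x. inverse (f x))"
  proof (induction k)
    case 0
    then show ?case using continuous_on_inverse[OF smooth_on_continuous[OF assms(2)]] assms(3) by simp
  next
    case (Suc k)
    have d: "f differentiable (at x)" if "x \<in> S" for x
      using that assms smooth_on_differentiable by blast
    have "pd i (\<lambda>x. inverse (f x)) x = (- 1) * (inverse (f x) * inverse (f x)) * pd i f x" if "x \<in> S" for i x
      using pd_real_comp[OF d[OF that] DERIV_inverse[OF assms(3)[OF that]]] by (simp add: power2_eq_square)
    moreover have "Ck_on k S (\<lambda>x. (- 1) * (inverse (f x) * inverse (f x)) * pd i f x)" for i
      using smooth_on_pd[OF assms(2)]
      by (intro Ck_on_mult assms(1) Suc.IH Ck_on_const) (auto simp: smooth_on_def)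
    ultimately have "Ck_on k S (pd i (\<lambda>x. inverse (f x)))" for i
      by (subst Ck_on_cong[OF assms(1)]) auto
    moreover have "(\<lambda>x. inverse (f x)) differentiable_on S"
      using d assms(1,3) by (auto simp: differentiable_on_eq_differentiable_at intro!: differentiable_inverse)
    ultimately show ?case by simp
  qed
qed

text \<open>The partial derivatives of the composite are \<open>h' (f x)\<close> times those of
  \<open>f\<close>, so smoothness of \<open>h' (f x)\<close> yields every order at once, without
  induction. This gives the logarithm from the inverse.\<close>

lemma smooth_on_real_comp_deriv:
  assumes "open S" "smooth_on S f"
    and "\<And>x. x \<in> S \<Longrightarrow> (h has_real_derivative h' (f x)) (at (f x))"
    and "smooth_on S (\<lambda>x. h' (f x))"
  shows "smooth_on S (\<lambda>x. h (f x))"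
  unfolding smooth_on_def
proof
  have d: "f differentiable (at x)" if "x \<in> S" for x
    using that assms smooth_on_differentiable by blast
  have e: "(\<lambda>x. h (f x)) differentiable_on S"
    using differentiable_real_comp[of f _ h, OF d assms(3)] assms(1)
    by (auto simp: differentiable_on_eq_differentiable_at)
  fix k
  show "Ck_on k S (\<lambda>x. h (f x))"
  proof (cases k)
    case 0
    then show ?thesis using e by (auto intro: differentiable_imp_continuous_on)
  next
    case (Suc k)
    have "Ck_on k S (\<lambda>x. h' (f x) * pd i f x)" for i
      using smooth_on_mult[OF assms(1,4) smooth_on_pd[OF assms(2)]] by (auto simp: smooth_on_def)
    then have "Ck_on k S (pd i (\<lambda>x. h (f x)))" for i
      by (subst Ck_on_cong[OF assms(1), of _ "\<lambda>x. h' (f x) * pd i f x"])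
         (use d pd_real_comp assms(3) in auto)
    with e show ?thesis by (simp add: Suc)
  qed
qed

lemma smooth_on_exp:
  assumes "open S" "smooth_on S f"
  shows "smooth_on S (\<lambda>x. exp (f x))"
  unfolding smooth_on_def
proof
  have d: "f differentiable (at x)" if "x \<in> S" for x
    using that assms smooth_on_differentiable by blast
  have e: "(\<lambda>x. exp (f x)) differentiable_on S"
    using differentiable_real_comp[of f _ exp, OF d DERIV_exp] assms(1)
    by (auto simp: differentiable_on_eq_differentiable_at)
  fix k
  show "Ck_on k S (\<lambda>x. exp (f x))"
  proof (induction k)
    case 0
    then show ?case using e by (auto intro: differentiable_imp_continuous_on)
  next
    case (Suc k)
    have "Ck_on k S (\<lambda>x. exp (f x) * pd i f x)" for i
      using smooth_on_pd[OF assms(2)] Suc.IH by (intro Ck_on_mult assms) (auto simp: smooth_on_def)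
    then have "Ck_on k S (pd i (\<lambda>x. exp (f x)))" for i
      by (subst Ck_on_cong[OF assms(1), of _ "\<lambda>x. exp (f x) * pd i f x"])
         (use d pd_real_comp DERIV_exp in auto)
    with e show ?case by simp
  qed
qed

lemma smooth_on_ln:
  assumes "open S" "smooth_on S f" "\<And>x. x \<in> S \<Longrightarrow> f x > 0"
  shows "smooth_on S (\<lambda>x. ln (f x))"
proof (rule smooth_on_real_comp_deriv[OF assms(1,2), where h' = inverse])
  show "(ln has_real_derivative inverse (f x)) (at (f x))" if "x \<in> S" for x
    using assms(3)[OF that] by (rule DERIV_ln)
  show "smooth_on S (\<lambda>x. inverse (f x))"
    using assms(3) by (intro smooth_on_inverse assms(1,2)) fastforce
qed

lemmas smooth_intros = smooth_on_const smooth_on_coord smooth_on_add smooth_on_mult smooth_on_minus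
  smooth_on_diff smooth_on_sum smooth_on_pd smooth_on_exp smooth_on_ln smooth_on_inverse

section \<open>Symmetry of second derivatives\<close>

lemma pd_line:
  assumes "f differentiable (at (x + s *\<^sub>R axis i 1))"
  shows "((\<lambda>s. f (x + s *\<^sub>R axis i 1)) has_real_derivative pd i f (x + s *\<^sub>R axis i 1)) (at s)"
proof -
  have "((\<lambda>s. x + s *\<^sub>R axis i 1) has_derivative (\<lambda>h. h *\<^sub>R axis i 1)) (at s)"
    by (auto intro!: derivative_eq_intros)
  from has_derivative_compose[OF this has_derivative_pd[OF assms]] show ?thesis
    unfolding has_field_derivative_def
    by (rule has_derivative_eq_rhs) (use exhaust_2[of i] in \<open>auto simp: axis_def\<close>)
qed

text \<open>The mean value theorem is applied twice: along \<open>axis i 1\<close> to the increment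
  of \<open>f\<close> in direction \<open>axis j 1\<close>, then along \<open>axis j 1\<close> to
  \<open>pd i f\<close>.\<close>

lemma second_difference_mean_value:
  assumes "0 < h"
    and S: "\<And>s t. 0 \<le> s \<Longrightarrow> s \<le> h \<Longrightarrow> 0 \<le> t \<Longrightarrow> t \<le> h \<Longrightarrow> x + s *\<^sub>R axis i 1 + t *\<^sub>R axis j 1 \<in> S"
    and f: "\<And>y. y \<in> S \<Longrightarrow> f differentiable (at y)" and g: "\<And>y. y \<in> S \<Longrightarrow> pd i f differentiable (at y)"
  shows "\<exists>s t. 0 < s \<and> s < h \<and> 0 < t \<and> t < h \<and>
     f (x + h *\<^sub>R axis i 1 + h *\<^sub>R axis j 1) - f (x + h *\<^sub>R axis i 1) - f (x + h *\<^sub>R axis j 1) + f x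
       = h * h * pd j (pd i f) (x + s *\<^sub>R axis i 1 + t *\<^sub>R axis j 1)"
proof -
  have c: "x + s *\<^sub>R axis i 1 + h *\<^sub>R axis j 1 = (x + h *\<^sub>R axis j 1) + s *\<^sub>R axis i 1" for s
    by simp
  define \<phi> where "\<phi> s = f (x + s *\<^sub>R axis i 1 + h *\<^sub>R axis j 1) - f (x + s *\<^sub>R axis i 1)" for s
  have "(\<phi> has_real_derivative pd i f (x + s *\<^sub>R axis i 1 + h *\<^sub>R axis j 1) - pd i f (x + s *\<^sub>R axis i 1)) (at s)"
    if "0 \<le> s" "s \<le> h" for s
    unfolding \<phi>_def c
    by (intro DERIV_diff pd_line f) (use S[of s h] S[of s 0] that \<open>0 < h\<close> in \<open>auto simp: c\<close>)
  from MVT2[OF \<open>0 < h\<close> this] obtain s where s: "0 < s" "s < h"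
    "\<phi> h - \<phi> 0 = (h - 0) * (pd i f (x + s *\<^sub>R axis i 1 + h *\<^sub>R axis j 1) - pd i f (x + s *\<^sub>R axis i 1))"
    by metis
  have "((\<lambda>t. pd i f (x + s *\<^sub>R axis i 1 + t *\<^sub>R axis j 1)) has_real_derivative
      pd j (pd i f) (x + s *\<^sub>R axis i 1 + t *\<^sub>R axis j 1)) (at t)" if "0 \<le> t" "t \<le> h" for t
    by (intro pd_line g S) (use s that in auto)
  from MVT2[OF \<open>0 < h\<close> this] obtain t where t: "0 < t" "t < h"
    "pd i f (x + s *\<^sub>R axis i 1 + h *\<^sub>R axis j 1) - pd i f (x + s *\<^sub>R axis i 1 + 0 *\<^sub>R axis j 1)
      = (h - 0) * pd j (pd i f) (x + s *\<^sub>R axis i 1 + t *\<^sub>R axis j 1)"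
    by metis
  have "\<phi> h - \<phi> 0 = h * h * pd j (pd i f) (x + s *\<^sub>R axis i 1 + t *\<^sub>R axis j 1)"
    using s(3) t(3) by simp
  then show ?thesis using s(1,2) t(1,2) unfolding \<phi>_def by (intro exI[of _ s] exI[of _ t]) (auto simp: algebra_simps)
qed

text \<open>The second difference over a square of side \<open>h\<close> is symmetric in the two
  directions and equals \<open>h * h\<close> times either mixed derivative at some point of the
  square. Continuity identifies the two limits.\<close>

lemma pd_commute:
  assumes "open S" "smooth_on S f" "x \<in> S"
  shows "pd i (pd j f) x = pd j (pd i f) x"
proof (rule ccontr)
  assume ne: "\<not> ?thesis"
  define e where "e = \<bar>pd i (pd j f) x - pd j (pd i f) x\<bar> / 2"
  have "e > 0" using ne by (simp add: e_def)
  have cont: "isCont (pd a (pd b f)) x" for a b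
    using smooth_on_continuous[OF smooth_on_pd[OF smooth_on_pd[OF assms(2)]]] assms(1,3)
    by (simp add: continuous_on_eq_continuous_at)
  have "\<exists>d>0. \<forall>y. dist y x < d \<longrightarrow> dist (pd a (pd b f) y) (pd a (pd b f) x) < e" for a b
    using cont[of a b] \<open>e > 0\<close> unfolding continuous_at_eps_delta by (auto simp: dist_norm)
  then obtain d where d: "\<And>a b. d a b > 0" "\<And>a b y. dist y x < d a b \<Longrightarrow> dist (pd a (pd b f) y) (pd a (pd b f) x) < e"
    by metis
  obtain r where r: "r > 0" "ball x r \<subseteq> S" using assms(1,3) open_contains_ball by blast
  \<comment> \<open>Points of the square lie within \<open>2 * h\<close> of \<open>x\<close>, so a
    third of the radii leaves strict room.\<close>
  define h where "h = min r (min (d i j) (d j i)) / 3"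
  have h: "h > 0" "3 * h \<le> r" "3 * h \<le> d i j" "3 * h \<le> d j i" using r d(1) by (auto simp: h_def)
  have near: "dist (x + s *\<^sub>R axis a 1 + t *\<^sub>R axis b 1) x < 3 * h" if "0 \<le> s" "s \<le> h" "0 \<le> t" "t \<le> h" for s t a b
  proof -
    have "dist (x + s *\<^sub>R axis a 1 + t *\<^sub>R axis b 1) x = norm (s *\<^sub>R axis a (1::real) + t *\<^sub>R axis b 1)"
      by (simp add: dist_norm algebra_simps)
    also have "\<dots> \<le> norm (s *\<^sub>R axis a (1::real)) + norm (t *\<^sub>R axis b (1::real))" by (rule norm_triangle_ineq)
    also have "\<dots> < 3 * h" using that h(1) by simp
    finally show ?thesis .
  qed
  have S: "x + s *\<^sub>R axis a 1 + t *\<^sub>R axis b 1 \<in> S" if "0 \<le> s" "s \<le> h" "0 \<le> t" "t \<le> h" for s t a b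
    using near[OF that, of a b] r(2) h(2) by (auto simp: dist_commute)
  have dif: "f differentiable (at y)" "pd a f differentiable (at y)" if "y \<in> S" for y a
    using that assms smooth_on_differentiable smooth_on_pd by blast+
  obtain s t where st: "0 < s" "s < h" "0 < t" "t < h"
    "f (x + h *\<^sub>R axis i 1 + h *\<^sub>R axis j 1) - f (x + h *\<^sub>R axis i 1) - f (x + h *\<^sub>R axis j 1) + f x
       = h * h * pd j (pd i f) (x + s *\<^sub>R axis i 1 + t *\<^sub>R axis j 1)"
    using second_difference_mean_value[of h x i j S f, OF h(1) S dif] by blast
  obtain u v where uv: "0 < u" "u < h" "0 < v" "v < h"
    "f (x + h *\<^sub>R axis j 1 + h *\<^sub>R axis i 1) - f (x + h *\<^sub>R axis j 1) - f (x + h *\<^sub>R axis i 1) + f x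
       = h * h * pd i (pd j f) (x + u *\<^sub>R axis j 1 + v *\<^sub>R axis i 1)"
    using second_difference_mean_value[of h x j i S f, OF h(1) S dif] by blast
  have "h * h * pd j (pd i f) (x + s *\<^sub>R axis i 1 + t *\<^sub>R axis j 1) = h * h * pd i (pd j f) (x + u *\<^sub>R axis j 1 + v *\<^sub>R axis i 1)"
    unfolding st(5)[symmetric] uv(5)[symmetric] by (simp add: algebra_simps)
  then have "pd j (pd i f) (x + s *\<^sub>R axis i 1 + t *\<^sub>R axis j 1) = pd i (pd j f) (x + u *\<^sub>R axis j 1 + v *\<^sub>R axis i 1)"
    using h(1) by simp
  moreover have "dist (pd j (pd i f) (x + s *\<^sub>R axis i 1 + t *\<^sub>R axis j 1)) (pd j (pd i f) x) < e"
    using near[of s t i j] st h by (intro d(2)) auto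
  moreover have "dist (pd i (pd j f) (x + u *\<^sub>R axis j 1 + v *\<^sub>R axis i 1)) (pd i (pd j f) x) < e"
    using near[of u v j i] uv h by (intro d(2)) auto
  moreover have "\<bar>pd i (pd j f) x - pd j (pd i f) x\<bar> = 2 * e" by (simp add: e_def)
  ultimately show False unfolding dist_real_def by linarith
qed

section \<open>Connections in coordinates\<close>

definition smooth_conn_on :: "(real^2) set \<Rightarrow> christoffel \<Rightarrow> bool" where
  "smooth_conn_on S \<Gamma> \<longleftrightarrow> (\<forall>i j k. smooth_on S (\<Gamma> i j k))"

lemma smooth_conn_onD: "smooth_conn_on S \<Gamma> \<Longrightarrow> smooth_on S (\<Gamma> i j k)"
  by (simp add: smooth_conn_on_def)

lemma smooth_conn_on_subset: "smooth_conn_on S \<Gamma> \<Longrightarrow> T \<subseteq> S \<Longrightarrow> smooth_conn_on T \<Gamma>"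
  using smooth_on_subset unfolding smooth_conn_on_def by blast

lemma smooth_on_nabla:
  assumes "open S" "smooth_conn_on S \<Gamma>" "smooth_map_on S X" "smooth_map_on S Y"
  shows "smooth_map_on S (nabla \<Gamma> X Y)"
  using assms unfolding smooth_conn_on_def smooth_map_on_def nabla_def
  by (auto intro!: smooth_on_sum smooth_on_mult smooth_on_add smooth_on_pd)

lemma smooth_on_bracket:
  assumes "open S" "smooth_map_on S X" "smooth_map_on S Y"
  shows "smooth_map_on S (bracket X Y)"
  using assms unfolding smooth_conn_on_def smooth_map_on_def bracket_def
  by (auto intro!: smooth_on_sum smooth_on_mult smooth_on_diff smooth_on_pd)

lemma smooth_on_coord_field: "smooth_map_on S (coord_field i)"
  by (simp add: smooth_map_on_def coord_field_def smooth_on_const)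

lemma coord_field_nth: "coord_field i y $ k = (if i = k then 1 else 0)"
  by (simp add: coord_field_def axis_def)

lemma pd_coord_field [simp]: "pd m (\<lambda>y. coord_field i y $ k) x = 0"
  by (simp add: coord_field_def)

lemma nabla_coord_field: "nabla \<Gamma> (coord_field i) (coord_field j) x $ k = \<Gamma> i j k x"
  using exhaust_2[of i] exhaust_2[of j] by (auto simp: nabla_def coord_field_nth sum_2)

definition riem :: "christoffel \<Rightarrow> 2 \<Rightarrow> 2 \<Rightarrow> 2 \<Rightarrow> 2 \<Rightarrow> real^2 \<Rightarrow> real" where
  "riem \<Gamma> m i j k x = pd m (\<Gamma> i j k) x - pd i (\<Gamma> m j k) x
     + (\<Sum>l\<in>UNIV. \<Gamma> m l k x * \<Gamma> i j l x - \<Gamma> i l k x * \<Gamma> m j l x)"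

abbreviation nabla_ricci :: "christoffel \<Rightarrow> 2 \<Rightarrow> 2 \<Rightarrow> 2 \<Rightarrow> real^2 \<Rightarrow> real" where
  "nabla_ricci \<Gamma> \<equiv> nabla_tensor2 \<Gamma> (ricci \<Gamma>)"

text \<open>In dimension two only \<open>riem \<Gamma> 1 2\<close> carries information; later
  arguments on curvature reduce to these four functions.\<close>

lemma riem_alternating:
  "riem \<Gamma> 1 1 j k x = 0" "riem \<Gamma> 2 2 j k x = 0" "riem \<Gamma> 2 1 j k x = - riem \<Gamma> 1 2 j k x"
  by (simp_all add: riem_def sum_2)

lemma curvature_coord_field:
  "curvature \<Gamma> (coord_field m) (coord_field i) (coord_field j) x $ k = riem \<Gamma> m i j k x"
proof -
  have b: "bracket (coord_field m) (coord_field i) x = 0"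
    by (simp add: bracket_def vec_eq_iff)
  have 0: "nabla \<Gamma> (bracket (coord_field m) (coord_field i)) (coord_field j) x $ k = 0"
    by (simp add: nabla_def b)
  have 1: "nabla \<Gamma> (coord_field m) (nabla \<Gamma> (coord_field i) (coord_field j)) x $ k
     = pd m (\<Gamma> i j k) x + (\<Sum>l\<in>UNIV. \<Gamma> m l k x * \<Gamma> i j l x)" for m i
    using exhaust_2[of m] by (subst nabla_def) (auto simp: nabla_coord_field coord_field_nth sum_2)
  show ?thesis unfolding curvature_def riem_def by (simp add: 0 1 sum_subtractf)
qed

lemma ricci_eq_riem: "ricci \<Gamma> i j x = (\<Sum>k\<in>UNIV. riem \<Gamma> k i j k x)"
  by (simp add: ricci_def curvature_coord_field)

lemma smooth_on_riem:
  assumes "open S" "smooth_conn_on S \<Gamma>"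
  shows "smooth_on S (riem \<Gamma> m i j k)"
  using assms unfolding smooth_conn_on_def riem_def[abs_def]
  by (auto intro!: smooth_on_sum smooth_on_mult smooth_on_diff smooth_on_add smooth_on_pd)

lemma smooth_on_ricci:
  assumes "open S" "smooth_conn_on S \<Gamma>"
  shows "smooth_on S (ricci \<Gamma> i j)"
  using assms unfolding smooth_conn_on_def ricci_eq_riem[abs_def] by (auto intro!: smooth_on_sum smooth_on_riem simp: smooth_conn_on_def)

lemma smooth_on_nabla_tensor2:
  assumes "open S" "smooth_conn_on S \<Gamma>" "\<And>i j. smooth_on S (T i j)"
  shows "smooth_on S (nabla_tensor2 \<Gamma> T k i j)"
  using assms unfolding smooth_conn_on_def nabla_tensor2_def[abs_def]
  by (auto intro!: smooth_on_sum smooth_on_mult smooth_on_diff smooth_on_add smooth_on_pd)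

lemmas pd_rules = pd_add pd_diff pd_mult differentiable_add differentiable_diff differentiable_mult

text \<open>All derivatives of the fields cancel: those of \<open>X\<close> and \<open>Y\<close>
  against the bracket term, the second derivatives of \<open>Z\<close> by symmetry of mixed
  partials.\<close>

lemma curvature_tensorial:
  assumes "open S" "x \<in> S" and \<Gamma>: "smooth_conn_on S \<Gamma>"
    and X: "smooth_map_on S X" and Y: "smooth_map_on S Y" and Z: "smooth_map_on S Z"
  shows "curvature \<Gamma> X Y Z x $ k =
    (\<Sum>m\<in>UNIV. \<Sum>i\<in>UNIV. \<Sum>j\<in>UNIV. X x $ m * Y x $ i * Z x $ j * riem \<Gamma> m i j k x)"
proof -
  note sd = smooth_on_differentiable[OF _ assms(1,2)]
  have d: "(\<lambda>y. X y $ l) differentiable (at x)" "(\<lambda>y. Y y $ l) differentiable (at x)"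
      "(\<lambda>y. Z y $ l) differentiable (at x)" "\<Gamma> i j l differentiable (at x)"
      "pdc i Z l differentiable (at x)" for i j l
    using \<Gamma> X Y Z by (auto simp: smooth_map_on_def smooth_conn_on_def intro!: sd smooth_on_pd)
  have c: "pd 2 (pdc 1 Z l) x = pd 1 (pdc 2 Z l) x" for l
    using Z by (intro pd_commute[OF assms(1) _ assms(2)]) (auto simp: smooth_map_on_def)
  have "\<forall>k. curvature \<Gamma> X Y Z x $ k =
    (\<Sum>m\<in>UNIV. \<Sum>i\<in>UNIV. \<Sum>j\<in>UNIV. X x $ m * Y x $ i * Z x $ j * riem \<Gamma> m i j k x)"
    unfolding forall_2
    by (simp add: curvature_def nabla_def bracket_def riem_def sum_2 pd_rules d c) (simp add: algebra_simps)
  then show ?thesis by blast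
qed

text \<open>The components of the Lie derivative of the connection, which is a tensor although the
  connection is not. The second derivatives of \<open>X\<close> reflect the inhomogeneous
  transformation law of Christoffel symbols.\<close>

definition lie_conn :: "christoffel \<Rightarrow> vfield \<Rightarrow> 2 \<Rightarrow> 2 \<Rightarrow> 2 \<Rightarrow> real^2 \<Rightarrow> real" where
  "lie_conn \<Gamma> X i j k x = pd i (pdc j X k) x + (\<Sum>l\<in>UNIV. X x $ l * pd l (\<Gamma> i j k) x
     - \<Gamma> i j l x * pdc l X k x + \<Gamma> l j k x * pdc i X l x + \<Gamma> i l k x * pdc j X l x)"

lemma lie_conn_tensorial:
  assumes "open S" "x \<in> S" and \<Gamma>: "smooth_conn_on S \<Gamma>"
    and X: "smooth_map_on S X" and Y: "smooth_map_on S Y" and Z: "smooth_map_on S Z"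
  shows "(bracket X (nabla \<Gamma> Y Z) x - nabla \<Gamma> (bracket X Y) Z x - nabla \<Gamma> Y (bracket X Z) x) $ k =
    (\<Sum>i\<in>UNIV. \<Sum>j\<in>UNIV. Y x $ i * Z x $ j * lie_conn \<Gamma> X i j k x)"
proof -
  note sd = smooth_on_differentiable[OF _ assms(1,2)]
  have d: "(\<lambda>y. X y $ l) differentiable (at x)" "(\<lambda>y. Y y $ l) differentiable (at x)"
      "(\<lambda>y. Z y $ l) differentiable (at x)" "\<Gamma> i j l differentiable (at x)"
      "pdc i Z l differentiable (at x)" "pdc i X l differentiable (at x)" for i j l
    using \<Gamma> X Y Z by (auto simp: smooth_map_on_def smooth_conn_on_def intro!: sd smooth_on_pd)
  have c: "pd 2 (pdc 1 Z l) x = pd 1 (pdc 2 Z l) x"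
      "pd 2 (pdc 1 X l) x = pd 1 (pdc 2 X l) x" for l
    using X Z by (auto intro!: pd_commute[OF assms(1) _ assms(2)] simp: smooth_map_on_def)
  have "\<forall>k. (bracket X (nabla \<Gamma> Y Z) x - nabla \<Gamma> (bracket X Y) Z x - nabla \<Gamma> Y (bracket X Z) x) $ k =
    (\<Sum>i\<in>UNIV. \<Sum>j\<in>UNIV. Y x $ i * Z x $ j * lie_conn \<Gamma> X i j k x)"
    unfolding forall_2
    by (simp add: lie_conn_def nabla_def bracket_def sum_2 pd_rules d c) (simp add: algebra_simps)
  then show ?thesis by blast
qed

text \<open>Tensoriality replaces the quantifier over all test fields by finitely many second-order
  equations for \<open>X\<close>; coordinate fields read off the components.\<close>

lemma killing_on_iff_lie_conn:
  assumes "open S" and \<Gamma>: "smooth_conn_on S \<Gamma>"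
  shows "killing_on \<Gamma> S X \<longleftrightarrow> smooth_map_on S X \<and> (\<forall>x\<in>S. \<forall>i j k. lie_conn \<Gamma> X i j k x = 0)"
proof (intro iffI conjI ballI allI)
  fix x i j k
  assume K: "killing_on \<Gamma> S X" and "x \<in> S"
  then have "(bracket X (nabla \<Gamma> (coord_field i) (coord_field j)) x - nabla \<Gamma> (bracket X (coord_field i)) (coord_field j) x
      - nabla \<Gamma> (coord_field i) (bracket X (coord_field j)) x) $ k = 0"
    by (simp add: killing_on_def smooth_on_coord_field)
  then show "lie_conn \<Gamma> X i j k x = 0"
    using K lie_conn_tensorial[OF assms(1) \<open>x \<in> S\<close> \<Gamma> _ smooth_on_coord_field[where i=i] smooth_on_coord_field[where i=j],
      where X = X and k = k] exhaust_2[of i] exhaust_2[of j]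
    by (auto simp: killing_on_def coord_field_nth sum_2)
next
  assume R: "smooth_map_on S X \<and> (\<forall>x\<in>S. \<forall>i j k. lie_conn \<Gamma> X i j k x = 0)"
  have "bracket X (nabla \<Gamma> Y Z) x = nabla \<Gamma> (bracket X Y) Z x + nabla \<Gamma> Y (bracket X Z) x"
    if "smooth_map_on S Y" "smooth_map_on S Z" "x \<in> S" for Y Z x
  proof -
    have "bracket X (nabla \<Gamma> Y Z) x - nabla \<Gamma> (bracket X Y) Z x - nabla \<Gamma> Y (bracket X Z) x = 0"
      unfolding vec_eq_iff using R that lie_conn_tensorial[OF assms(1) \<open>x \<in> S\<close> \<Gamma>] by simp
    then show ?thesis by (simp add: algebra_simps)
  qed
  with R show "killing_on \<Gamma> S X" by (simp add: killing_on_def)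
qed (simp add: killing_on_def)

section \<open>Naturality under affine diffeomorphisms\<close>

text \<open>The push-forward along \<open>\<tau>\<close>, kept as a relation so that no inverse map
  is involved and the operations on fields can be compared one by one.\<close>

definition related :: "(real^2 \<Rightarrow> real^2) \<Rightarrow> (real^2) set \<Rightarrow> vfield \<Rightarrow> vfield \<Rightarrow> bool" where
  "related \<tau> U X X' \<longleftrightarrow> (\<forall>x\<in>U. \<forall>a. X' (\<tau> x) $ a = (\<Sum>i\<in>UNIV. pdc i \<tau> a x * X x $ i))"

text \<open>Affinity is assumed for both maps, as the definitions of compatible charts and local
  affine diffeomorphisms provide it. This makes the locale symmetric, so every transport result can
  also be read backwards.\<close>

locale affine_iso =
  fixes \<Gamma> :: christoffel and U and \<Gamma>' :: christoffel and V and \<tau> \<sigma> :: "real^2 \<Rightarrow> real^2"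
  assumes open_U: "open U" and open_V: "open V"
    and \<tau>_in: "\<And>x. x \<in> U \<Longrightarrow> \<tau> x \<in> V" and \<sigma>_in: "\<And>y. y \<in> V \<Longrightarrow> \<sigma> y \<in> U"
    and \<sigma>_\<tau>: "\<And>x. x \<in> U \<Longrightarrow> \<sigma> (\<tau> x) = x" and \<tau>_\<sigma>: "\<And>y. y \<in> V \<Longrightarrow> \<tau> (\<sigma> y) = y"
    and affine_\<tau>: "affine_map_on U \<Gamma> \<Gamma>' \<tau>" and affine_\<sigma>: "affine_map_on V \<Gamma>' \<Gamma> \<sigma>"
    and smooth_\<Gamma>: "smooth_conn_on U \<Gamma>" and smooth_\<Gamma>': "smooth_conn_on V \<Gamma>'"
begin

lemma inverse_iso: "affine_iso \<Gamma>' V \<Gamma> U \<sigma> \<tau>"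
  using open_U open_V \<tau>_in \<sigma>_in \<sigma>_\<tau> \<tau>_\<sigma> affine_\<tau> affine_\<sigma> smooth_\<Gamma> smooth_\<Gamma>'
  by unfold_locales auto

lemma smooth_\<tau>: "smooth_on U (\<lambda>y. \<tau> y $ a)"
  using affine_\<tau> by (auto simp: affine_map_on_def smooth_map_on_def)

lemma smooth_\<sigma>: "smooth_on V (\<lambda>y. \<sigma> y $ a)"
  using affine_\<sigma> by (auto simp: affine_map_on_def smooth_map_on_def)

lemma diff_\<tau>: "x \<in> U \<Longrightarrow> (\<lambda>y. \<tau> y $ a) differentiable (at x)"
  using smooth_on_differentiable[OF smooth_\<tau> open_U] .

lemma diff_pd_\<tau>: "x \<in> U \<Longrightarrow> pdc i \<tau> a differentiable (at x)"
  using smooth_on_differentiable[OF smooth_on_pd[OF smooth_\<tau>] open_U] .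

lemma affine_eq:
  "x \<in> U \<Longrightarrow> pd i (pdc j \<tau> c) x = (\<Sum>k\<in>UNIV. \<Gamma> i j k x * pdc k \<tau> c x)
     - (\<Sum>a\<in>UNIV. \<Sum>b\<in>UNIV. pdc i \<tau> a x * pdc j \<tau> b x * \<Gamma>' a b c (\<tau> x))"
  using affine_\<tau> unfolding affine_map_on_def by (simp add: algebra_simps)

lemma jacobian_inverse:
  assumes "x \<in> U"
  shows "(\<Sum>a\<in>UNIV. pdc a \<sigma> k (\<tau> x) * pdc i \<tau> a x) = (if i = k then 1 else 0)"
proof -
  have "(\<Sum>a\<in>UNIV. pdc a \<sigma> k (\<tau> x) * pdc i \<tau> a x) = pd i (\<lambda>y. \<sigma> (\<tau> y) $ k) x"
    by (rule pd_chain[symmetric])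
      (use assms diff_\<tau> smooth_on_differentiable[OF smooth_\<sigma> open_V \<tau>_in[OF assms]] in auto)
  also have "\<dots> = pd i (\<lambda>y. y $ k) x"
    by (rule pd_cong_open[OF open_U assms]) (simp add: \<sigma>_\<tau>)
  finally show ?thesis by simp
qed

lemma jacobian_det_nonzero:
  assumes "x \<in> U"
  shows "pdc 1 \<tau> 1 x * pdc 2 \<tau> 2 x - pdc 1 \<tau> 2 x * pdc 2 \<tau> 1 x \<noteq> 0"
proof
  assume 0: "pdc 1 \<tau> 1 x * pdc 2 \<tau> 2 x - pdc 1 \<tau> 2 x * pdc 2 \<tau> 1 x = 0"
  define J K where "J = (\<lambda>i a. pdc i \<tau> a x)" and "K = (\<lambda>a k. pdc a \<sigma> k (\<tau> x))"
  have "K 1 k * J i 1 + K 2 k * J i 2 = (if i = k then 1 else 0)" for i k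
    using jacobian_inverse[OF assms, of k i] by (simp add: sum_2 J_def K_def)
  from this[of 1 1] this[of 2 1] this[of 1 2] this[of 2 2] 0
  have "K 1 1 * J 1 1 + K 2 1 * J 1 2 = 1" "K 1 1 * J 2 1 + K 2 1 * J 2 2 = 0"
    "K 1 2 * J 1 1 + K 2 2 * J 1 2 = 0" "K 1 2 * J 2 1 + K 2 2 * J 2 2 = 1" "J 1 1 * J 2 2 - J 1 2 * J 2 1 = 0"
    by (simp_all add: J_def)
  then show False by algebra
qed

text \<open>Differentiating the relation produces second derivatives of \<open>\<tau>\<close>. In
  covariant derivatives the affine law removes them; in brackets they cancel by symmetry.\<close>

lemma related_pd:
  assumes "related \<tau> U Y Y'" "smooth_map_on U Y" "smooth_map_on V Y'" "x \<in> U"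
  shows "(\<Sum>b\<in>UNIV. pdc b Y' a (\<tau> x) * pdc m \<tau> b x)
    = (\<Sum>i\<in>UNIV. pd m (pdc i \<tau> a) x * Y x $ i + pdc i \<tau> a x * pdc m Y i x)"
proof -
  have d: "(\<lambda>y. Y y $ i) differentiable (at x)" for i
    using assms(2,4) smooth_on_differentiable[OF _ open_U] by (auto simp: smooth_map_on_def)
  have d': "(\<lambda>y. Y' y $ a) differentiable (at (\<tau> x))"
    using assms(3) smooth_on_differentiable[OF _ open_V \<tau>_in[OF assms(4)]] by (auto simp: smooth_map_on_def)
  have "(\<Sum>b\<in>UNIV. pdc b Y' a (\<tau> x) * pdc m \<tau> b x) = pd m (\<lambda>y. Y' (\<tau> y) $ a) x"
    by (rule pd_chain[symmetric]) (use diff_\<tau>[OF assms(4)] d' in auto)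
  also have "\<dots> = pd m (\<lambda>y. \<Sum>i\<in>UNIV. pdc i \<tau> a y * Y y $ i) x"
    by (rule pd_cong_open[OF open_U assms(4)]) (use assms(1) in \<open>auto simp: related_def\<close>)
  finally show ?thesis
    by (simp add: sum_2 pd_rules d diff_pd_\<tau> assms(4))
qed

lemma related_nabla:
  assumes X: "related \<tau> U X X'" and Y: "related \<tau> U Y Y'" "smooth_map_on U Y" "smooth_map_on V Y'"
  shows "related \<tau> U (nabla \<Gamma> X Y) (nabla \<Gamma>' X' Y')"
  unfolding related_def
proof (intro ballI allI)
  fix x a assume x: "x \<in> U"
  define J H where "J = (\<lambda>i a. pdc i \<tau> a x)" and "H = (\<lambda>i j a. pd i (pdc j \<tau> a) x)"
  define P where "P = (\<lambda>b a. pdc b Y' a (\<tau> x))"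
  have E: "P 1 a * J m 1 + P 2 a * J m 2 = H m 1 a * Y x $ 1 + J 1 a * pdc m Y 1 x
     + (H m 2 a * Y x $ 2 + J 2 a * pdc m Y 2 x)" for m
    using related_pd[OF Y x, of a m] by (simp add: sum_2 J_def H_def P_def)
  have H: "H i j a = \<Gamma> i j 1 x * J 1 a + \<Gamma> i j 2 x * J 2 a
      - (J i 1 * J j 1 * \<Gamma>' 1 1 a (\<tau> x) + J i 1 * J j 2 * \<Gamma>' 1 2 a (\<tau> x)
       + (J i 2 * J j 1 * \<Gamma>' 2 1 a (\<tau> x) + J i 2 * J j 2 * \<Gamma>' 2 2 a (\<tau> x)))" for i j
    using affine_eq[OF x, of i j a] by (simp add: sum_2 J_def H_def)
  have X': "X' (\<tau> x) $ b = J 1 b * X x $ 1 + J 2 b * X x $ 2"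
    and Y': "Y' (\<tau> x) $ b = J 1 b * Y x $ 1 + J 2 b * Y x $ 2" for b
    using X Y(1) x by (simp_all add: related_def sum_2 J_def)
  have "nabla \<Gamma>' X' Y' (\<tau> x) $ a
    = X x $ 1 * (P 1 a * J 1 1 + P 2 a * J 1 2) + X x $ 2 * (P 1 a * J 2 1 + P 2 a * J 2 2)
      + (X' (\<tau> x) $ 1 * (\<Gamma>' 1 1 a (\<tau> x) * Y' (\<tau> x) $ 1 + \<Gamma>' 1 2 a (\<tau> x) * Y' (\<tau> x) $ 2)
       + X' (\<tau> x) $ 2 * (\<Gamma>' 2 1 a (\<tau> x) * Y' (\<tau> x) $ 1 + \<Gamma>' 2 2 a (\<tau> x) * Y' (\<tau> x) $ 2))"
    by (simp add: nabla_def sum_2 P_def X' algebra_simps)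
  also have "\<dots> = J 1 a * nabla \<Gamma> X Y x $ 1 + J 2 a * nabla \<Gamma> X Y x $ 2"
    unfolding E H X' Y' by (simp add: nabla_def sum_2 algebra_simps)
  finally show "nabla \<Gamma>' X' Y' (\<tau> x) $ a = (\<Sum>i\<in>UNIV. pdc i \<tau> a x * nabla \<Gamma> X Y x $ i)"
    by (simp add: sum_2 J_def)
qed

lemma related_bracket:
  assumes X: "related \<tau> U X X'" "smooth_map_on U X" "smooth_map_on V X'"
    and Y: "related \<tau> U Y Y'" "smooth_map_on U Y" "smooth_map_on V Y'"
  shows "related \<tau> U (bracket X Y) (bracket X' Y')"
  unfolding related_def
proof (intro ballI allI)
  fix x a assume x: "x \<in> U"
  define J H where "J = (\<lambda>i a. pdc i \<tau> a x)" and "H = (\<lambda>i j a. pd i (pdc j \<tau> a) x)"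
  define P Q where "P = (\<lambda>b a. pdc b Y' a (\<tau> x))" and "Q = (\<lambda>b a. pdc b X' a (\<tau> x))"
  have E: "P 1 a * J m 1 + P 2 a * J m 2 = H m 1 a * Y x $ 1 + J 1 a * pdc m Y 1 x
     + (H m 2 a * Y x $ 2 + J 2 a * pdc m Y 2 x)" for m
    using related_pd[OF Y x, of a m] by (simp add: sum_2 J_def H_def P_def)
  have F: "Q 1 a * J m 1 + Q 2 a * J m 2 = H m 1 a * X x $ 1 + J 1 a * pdc m X 1 x
     + (H m 2 a * X x $ 2 + J 2 a * pdc m X 2 x)" for m
    using related_pd[OF X x, of a m] by (simp add: sum_2 J_def H_def Q_def)
  have H: "H 2 1 a = H 1 2 a"
    unfolding H_def by (rule pd_commute[OF open_U smooth_\<tau> x])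
  have X': "X' (\<tau> x) $ b = J 1 b * X x $ 1 + J 2 b * X x $ 2"
    and Y': "Y' (\<tau> x) $ b = J 1 b * Y x $ 1 + J 2 b * Y x $ 2" for b
    using X Y(1) x by (simp_all add: related_def sum_2 J_def)
  have "bracket X' Y' (\<tau> x) $ a
    = X x $ 1 * (P 1 a * J 1 1 + P 2 a * J 1 2) + X x $ 2 * (P 1 a * J 2 1 + P 2 a * J 2 2)
      - (Y x $ 1 * (Q 1 a * J 1 1 + Q 2 a * J 1 2) + Y x $ 2 * (Q 1 a * J 2 1 + Q 2 a * J 2 2))"
    by (simp add: bracket_def sum_2 P_def Q_def X' Y' algebra_simps)
  also have "\<dots> = J 1 a * bracket X Y x $ 1 + J 2 a * bracket X Y x $ 2"
    unfolding E F H by (simp add: bracket_def sum_2 algebra_simps)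
  finally show "bracket X' Y' (\<tau> x) $ a = (\<Sum>i\<in>UNIV. pdc i \<tau> a x * bracket X Y x $ i)"
    by (simp add: sum_2 J_def)
qed

lemma related_curvature:
  assumes X: "related \<tau> U X X'" "smooth_map_on U X" "smooth_map_on V X'"
    and Y: "related \<tau> U Y Y'" "smooth_map_on U Y" "smooth_map_on V Y'"
    and Z: "related \<tau> U Z Z'" "smooth_map_on U Z" "smooth_map_on V Z'"
  shows "related \<tau> U (curvature \<Gamma> X Y Z) (curvature \<Gamma>' X' Y' Z')"
proof -
  note smooth = smooth_on_nabla[OF open_U smooth_\<Gamma>] smooth_on_nabla[OF open_V smooth_\<Gamma>']
  have "related \<tau> U (nabla \<Gamma> X (nabla \<Gamma> Y Z)) (nabla \<Gamma>' X' (nabla \<Gamma>' Y' Z'))"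
    "related \<tau> U (nabla \<Gamma> Y (nabla \<Gamma> X Z)) (nabla \<Gamma>' Y' (nabla \<Gamma>' X' Z'))"
    "related \<tau> U (nabla \<Gamma> (bracket X Y) Z) (nabla \<Gamma>' (bracket X' Y') Z')"
    using X Y Z by (auto intro!: related_nabla related_bracket smooth)
  then show ?thesis
    by (simp add: related_def curvature_def right_diff_distrib sum_subtractf)
qed

definition push :: "vfield \<Rightarrow> vfield" where
  "push X y = (\<chi> a. \<Sum>i\<in>UNIV. pdc i \<tau> a (\<sigma> y) * X (\<sigma> y) $ i)"

lemma related_push: "related \<tau> U X (push X)"
  by (simp add: related_def push_def \<sigma>_\<tau>)

lemma smooth_push:
  assumes "smooth_map_on U X"
  shows "smooth_map_on V (push X)"
proof -
  have "smooth_on V (\<lambda>y. f (\<sigma> y))" if "smooth_on U f" for f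
    by (rule smooth_on_chain[OF open_V open_U smooth_\<sigma> _ that]) (use \<sigma>_in in auto)
  then show ?thesis
    using assms unfolding smooth_map_on_def push_def
    by (auto intro!: smooth_on_sum[OF open_V] smooth_on_mult[OF open_V] smooth_on_pd smooth_\<tau>)
qed

text \<open>The Jacobians of \<open>\<tau>\<close> and \<open>\<sigma>\<close> are inverse matrices,
  so relatedness can be read backwards. This is how test fields on \<open>V\<close> are pulled back
  to \<open>U\<close>.\<close>

lemma related_inverse:
  assumes "related \<sigma> V Y' Y"
  shows "related \<tau> U Y Y'"
  unfolding related_def
proof (intro ballI allI)
  fix x a assume x: "x \<in> U"
  interpret inv: affine_iso \<Gamma>' V \<Gamma> U \<sigma> \<tau> by (rule inverse_iso)
  define J K where "J = (\<lambda>i a. pdc i \<tau> a x)" and "K = (\<lambda>a k. pdc a \<sigma> k (\<tau> x))"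
  have JK: "J 1 k * K i 1 + J 2 k * K i 2 = (if i = k then 1 else 0)" for i k
    using inv.jacobian_inverse[OF \<tau>_in[OF x], of k i] by (simp add: sum_2 J_def K_def \<sigma>_\<tau> x)
  have Y: "Y x $ k = K 1 k * Y' (\<tau> x) $ 1 + K 2 k * Y' (\<tau> x) $ 2" for k
    using assms[unfolded related_def, rule_format, OF \<tau>_in[OF x], of k] by (simp add: sum_2 K_def \<sigma>_\<tau>[OF x])
  have "J 1 a * Y x $ 1 + J 2 a * Y x $ 2 = (J 1 a * K 1 1 + J 2 a * K 1 2) * Y' (\<tau> x) $ 1
     + (J 1 a * K 2 1 + J 2 a * K 2 2) * Y' (\<tau> x) $ 2"
    unfolding Y by (simp add: algebra_simps)
  also have "\<dots> = Y' (\<tau> x) $ a" unfolding JK using exhaust_2[of a] by auto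
  finally show "Y' (\<tau> x) $ a = (\<Sum>i\<in>UNIV. pdc i \<tau> a x * Y x $ i)"
    by (simp add: sum_2 J_def)
qed

text \<open>Any two test fields on \<open>V\<close> are related to test fields on \<open>U\<close>,
  so the defining identity itself is transported, bracket by bracket.\<close>

lemma killing_on_push:
  assumes "killing_on \<Gamma> U X"
  shows "killing_on \<Gamma>' V (push X)"
  unfolding killing_on_def
proof (intro conjI allI impI ballI)
  have X: "related \<tau> U X (push X)" "smooth_map_on U X" "smooth_map_on V (push X)"
    using assms by (auto simp: killing_on_def related_push smooth_push)
  then show "smooth_map_on V (push X)" by simp
  fix Y' Z' y assume YZ': "smooth_map_on V Y'" "smooth_map_on V Z'" and y: "y \<in> V"
  interpret inv: affine_iso \<Gamma>' V \<Gamma> U \<sigma> \<tau> by (rule inverse_iso)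
  define Y Z where "Y = inv.push Y'" and "Z = inv.push Z'"
  have Y: "related \<tau> U Y Y'" "smooth_map_on U Y" and Z: "related \<tau> U Z Z'" "smooth_map_on U Z"
    unfolding Y_def Z_def by (intro related_inverse inv.related_push inv.smooth_push YZ')+
  note smooth = smooth_on_nabla[OF open_U smooth_\<Gamma>] smooth_on_nabla[OF open_V smooth_\<Gamma>']
    smooth_on_bracket[OF open_U] smooth_on_bracket[OF open_V]
  have "related \<tau> U (bracket X (nabla \<Gamma> Y Z)) (bracket (push X) (nabla \<Gamma>' Y' Z'))"
    "related \<tau> U (nabla \<Gamma> (bracket X Y) Z) (nabla \<Gamma>' (bracket (push X) Y') Z')"
    "related \<tau> U (nabla \<Gamma> Y (bracket X Z)) (nabla \<Gamma>' Y' (bracket (push X) Z'))"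
    using X Y Z YZ' by (auto intro!: related_nabla related_bracket smooth)
  moreover have "bracket X (nabla \<Gamma> Y Z) (\<sigma> y) = nabla \<Gamma> (bracket X Y) Z (\<sigma> y) + nabla \<Gamma> Y (bracket X Z) (\<sigma> y)"
    using assms Y Z \<sigma>_in[OF y] by (auto simp: killing_on_def)
  ultimately show "bracket (push X) (nabla \<Gamma>' Y' Z') y
      = nabla \<Gamma>' (bracket (push X) Y') Z' y + nabla \<Gamma>' Y' (bracket (push X) Z') y"
    using \<sigma>_in[OF y] by (auto simp: related_def vec_eq_iff sum_2 \<tau>_\<sigma>[OF y] algebra_simps dest!: bspec[of _ _ "\<sigma> y"])
qed

lemma riem_transform:
  assumes x: "x \<in> U"
  shows "(\<Sum>k\<in>UNIV. pdc k \<tau> a x * riem \<Gamma> m i j k x)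
    = (\<Sum>d\<in>UNIV. \<Sum>b\<in>UNIV. \<Sum>c\<in>UNIV. pdc m \<tau> d x * pdc i \<tau> b x * pdc j \<tau> c x
        * riem \<Gamma>' d b c a (\<tau> x))"
proof -
  have P: "related \<tau> U (coord_field i) (push (coord_field i))" "smooth_map_on V (push (coord_field i))"
    "push (coord_field i) (\<tau> x) $ a = pdc i \<tau> a x" for i a
    using exhaust_2[of i]
    by (auto simp: related_push smooth_push smooth_on_coord_field) (auto simp: push_def coord_field_nth sum_2 \<sigma>_\<tau>[OF x])
  have "curvature \<Gamma>' (push (coord_field m)) (push (coord_field i)) (push (coord_field j)) (\<tau> x) $ a
      = (\<Sum>k\<in>UNIV. pdc k \<tau> a x * riem \<Gamma> m i j k x)"
    using related_curvature[OF P(1) smooth_on_coord_field P(2) P(1) smooth_on_coord_field P(2) P(1) smooth_on_coord_field P(2), of m i j] x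
    by (simp add: related_def curvature_coord_field)
  then show ?thesis
    using curvature_tensorial[OF open_V \<tau>_in[OF x] smooth_\<Gamma>' P(2) P(2) P(2), of m i j a] by (simp add: P(3))
qed

lemma ricci_transform:
  assumes x: "x \<in> U"
  shows "ricci \<Gamma> i j x = (\<Sum>a\<in>UNIV. \<Sum>b\<in>UNIV. pdc i \<tau> a x * pdc j \<tau> b x * ricci \<Gamma>' a b (\<tau> x))"
proof -
  define J where "J = (\<lambda>i a. pdc i \<tau> a x)"
  define R R' where "R = (\<lambda>j k. riem \<Gamma> 1 2 j k x)" and "R' = (\<lambda>j k. riem \<Gamma>' 1 2 j k (\<tau> x))"
  have D: "J 1 1 * J 2 2 - J 1 2 * J 2 1 \<noteq> 0"
    using jacobian_det_nonzero[OF x] by (simp add: J_def)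
  have M: "J 1 a * R j 1 + J 2 a * R j 2 = (J 1 1 * J 2 2 - J 1 2 * J 2 1) * (J j 1 * R' 1 a + J j 2 * R' 2 a)" for j a
    using riem_transform[OF x, of a 1 2 j] by (simp add: sum_2 riem_alternating J_def R_def R'_def algebra_simps)
  \<comment> \<open>Cramer's rule applied to \<open>M\<close>: the Jacobian determinant contributed
    by the two alternating slots cancels the one in the denominator.\<close>
  have 1: "R j 1 = J 2 2 * (J j 1 * R' 1 1 + J j 2 * R' 2 1) - J 2 1 * (J j 1 * R' 1 2 + J j 2 * R' 2 2)"
    using M[of 1 j] M[of 2 j] D by algebra
  have 2: "R j 2 = J 1 1 * (J j 1 * R' 1 2 + J j 2 * R' 2 2) - J 1 2 * (J j 1 * R' 1 1 + J j 2 * R' 2 1)"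
    using M[of 1 j] M[of 2 j] D by algebra
  have ric: "ricci \<Gamma> 1 j x = - R j 2" "ricci \<Gamma> 2 j x = R j 1"
    "ricci \<Gamma>' 1 j (\<tau> x) = - R' j 2" "ricci \<Gamma>' 2 j (\<tau> x) = R' j 1" for j
    by (simp_all add: ricci_eq_riem sum_2 riem_alternating R_def R'_def)
  have "ricci \<Gamma> i j x = (\<Sum>a\<in>UNIV. \<Sum>b\<in>UNIV. J i a * J j b * ricci \<Gamma>' a b (\<tau> x))"
    using exhaust_2[of i] by (auto simp: sum_2 ric 1 2 algebra_simps)
  then show ?thesis by (simp add: J_def)
qed

text \<open>Differentiating the transformation law of \<open>T\<close> yields second derivatives of
  \<open>\<tau>\<close>; \<open>affine_eq\<close> trades them for the Christoffel terms of the two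
  covariant derivatives.\<close>

lemma nabla_tensor2_transform:
  assumes T: "\<And>x i j. x \<in> U \<Longrightarrow>
      T i j x = (\<Sum>a\<in>UNIV. \<Sum>b\<in>UNIV. pdc i \<tau> a x * pdc j \<tau> b x * T' a b (\<tau> x))"
    and T': "\<And>a b. smooth_on V (T' a b)" and x: "x \<in> U"
  shows "nabla_tensor2 \<Gamma> T k i j x = (\<Sum>d\<in>UNIV. \<Sum>a\<in>UNIV. \<Sum>b\<in>UNIV.
     pdc k \<tau> d x * pdc i \<tau> a x * pdc j \<tau> b x * nabla_tensor2 \<Gamma>' T' d a b (\<tau> x))"
proof -
  have dT': "T' a b differentiable (at (\<tau> x))" for a b
    by (rule smooth_on_differentiable[OF T' open_V \<tau>_in[OF x]])
  have d: "(\<lambda>y. T' a b (\<tau> y)) differentiable (at x)" for a b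
    by (rule differentiable_chain2[of \<tau>, OF diff_\<tau>[OF x] dT'])
  have c: "pd k (\<lambda>y. T' a b (\<tau> y)) x = (\<Sum>d\<in>UNIV. pd d (T' a b) (\<tau> x) * pdc k \<tau> d x)" for a b
    by (rule pd_chain[of \<tau>, OF diff_\<tau>[OF x] dT'])
  have "pd k (T i j) x = pd k (\<lambda>x. \<Sum>a\<in>UNIV. \<Sum>b\<in>UNIV. pdc i \<tau> a x * pdc j \<tau> b x * T' a b (\<tau> x)) x"
    by (rule pd_cong_open[OF open_U x]) (rule T)
  then show ?thesis
    unfolding nabla_tensor2_def T[OF x]
    by (simp add: sum_2 pd_rules d diff_pd_\<tau>[OF x] c affine_eq[OF x]) (simp add: algebra_simps)
qed

end

section \<open>Germs of Killing fields\<close>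

context affine_iso begin

lemma restrict:
  assumes "open N" "N \<subseteq> U"
  shows "affine_iso \<Gamma> N \<Gamma>' (\<tau> ` N) \<tau> \<sigma>"
proof
  have eq: "\<tau> ` N = \<sigma> -` N \<inter> V"
    using assms(2) \<sigma>_\<tau> \<tau>_\<sigma> \<tau>_in by (force simp: image_iff)
  have "continuous_on V (\<lambda>y. \<chi> a. \<sigma> y $ a)"
    by (intro continuous_on_vec_lambda smooth_on_continuous[OF smooth_\<sigma>])
  then have "continuous_on V \<sigma>" by simp
  then show "open (\<tau> ` N)"
    unfolding eq using continuous_open_preimage[OF _ open_V assms(1), of \<sigma>] by (simp add: Int_commute)
  have sub: "\<tau> ` N \<subseteq> V" using eq by blast
  show "affine_map_on N \<Gamma> \<Gamma>' \<tau>" "affine_map_on (\<tau> ` N) \<Gamma>' \<Gamma> \<sigma>"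
    using affine_\<tau> affine_\<sigma> assms(2) sub smooth_on_subset
    unfolding affine_map_on_def smooth_map_on_def by (meson subsetD)+
  show "smooth_conn_on N \<Gamma>" "smooth_conn_on (\<tau> ` N) \<Gamma>'"
    using smooth_conn_on_subset smooth_\<Gamma> smooth_\<Gamma>' assms(2) sub by blast+
qed (use assms \<sigma>_\<tau> \<tau>_\<sigma> in auto)

lemma eventually_pullback:
  assumes "x \<in> U" "\<forall>\<^sub>F z in nhds x. P z"
  shows "\<forall>\<^sub>F y in nhds (\<tau> x). y \<in> V \<and> P (\<sigma> y)"
proof -
  obtain S where S: "open S" "x \<in> S" "\<And>z. z \<in> S \<Longrightarrow> P z"
    using assms(2) by (auto simp: eventually_nhds)
  interpret r: affine_iso \<Gamma> "S \<inter> U" \<Gamma>' "\<tau> ` (S \<inter> U)" \<tau> \<sigma>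
    by (rule restrict) (use S(1) open_U in auto)
  show ?thesis
    unfolding eventually_nhds
    by (rule exI[of _ "\<tau> ` (S \<inter> U)"]) (use r.open_V S assms(1) \<tau>_in \<sigma>_\<tau> in auto)
qed

lemma push_sum: "push (\<lambda>x. \<Sum>m<n. a m *\<^sub>R X m x) y = (\<Sum>m<(n::nat). a m *\<^sub>R push (X m) y)"
  by (simp add: push_def vec_eq_iff sum_2 sum_distrib_left sum.distrib algebra_simps)

end

text \<open>Smoothness of \<open>\<Gamma>\<close> on \<open>N\<close> takes the place of the
  inclusion of \<open>N\<close> in a chart image. The notion thus refers to the germ of
  \<open>\<Gamma>\<close> only and can be compared between charts.\<close>

definition kill_near :: "christoffel \<Rightarrow> real^2 \<Rightarrow> vfield \<Rightarrow> bool" where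
  "kill_near \<Gamma> x X \<longleftrightarrow> (\<exists>N. open N \<and> x \<in> N \<and> smooth_conn_on N \<Gamma> \<and> killing_on \<Gamma> N X)"

definition killing_dim_at :: "christoffel \<Rightarrow> real^2 \<Rightarrow> nat \<Rightarrow> bool" where
  "killing_dim_at \<Gamma> x n \<longleftrightarrow> (\<exists>X :: nat \<Rightarrow> vfield.
     (\<forall>m<n. kill_near \<Gamma> x (X m)) \<and>
     (\<forall>a. (\<forall>\<^sub>F z in nhds x. (\<Sum>m<n. a m *\<^sub>R X m z) = 0) \<longrightarrow> (\<forall>m<n. a m = 0)) \<and>
     (\<forall>Y. kill_near \<Gamma> x Y \<longrightarrow> (\<exists>a. \<forall>\<^sub>F z in nhds x. Y z = (\<Sum>m<n. a m *\<^sub>R X m z))))"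

lemma killing_on_subset:
  assumes "killing_on \<Gamma> N X" "open N" "smooth_conn_on N \<Gamma>" "open N'" "N' \<subseteq> N"
  shows "killing_on \<Gamma> N' X"
  using assms(1) smooth_conn_on_subset[OF assms(3,5)] smooth_on_subset[OF _ assms(5)] assms(5)
  unfolding killing_on_iff_lie_conn[OF assms(2,3)] killing_on_iff_lie_conn[OF assms(4) smooth_conn_on_subset[OF assms(3,5)]]
    smooth_map_on_def by blast

lemma kill_near_subset:
  assumes "kill_near \<Gamma> x X" "open S" "x \<in> S"
  obtains N where "open N" "x \<in> N" "N \<subseteq> S" "smooth_conn_on N \<Gamma>" "killing_on \<Gamma> N X"
proof -
  obtain N where N: "open N" "x \<in> N" "smooth_conn_on N \<Gamma>" "killing_on \<Gamma> N X"
    using assms(1) by (auto simp: kill_near_def)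
  show ?thesis
    by (rule that[of "N \<inter> S"])
      (use N assms smooth_conn_on_subset killing_on_subset[OF N(4,1,3), of "N \<inter> S"] in auto)
qed

lemma killing_near_iff:
  assumes "open (chart_image c)" "smooth_conn_on (chart_image c) (chart_sym c)" "chart_map c p \<in> chart_image c"
  shows "killing_near c p X \<longleftrightarrow> kill_near (chart_sym c) (chart_map c p) X"
proof
  show "killing_near c p X \<Longrightarrow> kill_near (chart_sym c) (chart_map c p) X"
    using smooth_conn_on_subset[OF assms(2)] by (auto simp: killing_near_def kill_near_def)
  assume "kill_near (chart_sym c) (chart_map c p) X"
  from kill_near_subset[OF this assms(1,3)] show "killing_near c p X"
    unfolding killing_near_def by metis
qed

lemma killing_dim_iff:
  assumes "open (chart_image c)" "smooth_conn_on (chart_image c) (chart_sym c)" "chart_map c p \<in> chart_image c"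
  shows "killing_dim c p n \<longleftrightarrow> killing_dim_at (chart_sym c) (chart_map c p) n"
  unfolding killing_dim_def killing_dim_at_def killing_near_iff[OF assms] ..

context affine_iso begin

lemma kill_near_push:
  assumes "kill_near \<Gamma> x X" "x \<in> U"
  shows "kill_near \<Gamma>' (\<tau> x) (push X)"
proof -
  obtain N where N: "open N" "x \<in> N" "N \<subseteq> U" "killing_on \<Gamma> N X"
    using kill_near_subset[OF assms(1) open_U assms(2)] by metis
  interpret r: affine_iso \<Gamma> N \<Gamma>' "\<tau> ` N" \<tau> \<sigma>
    by (rule restrict[OF N(1,3)])
  show ?thesis
    unfolding kill_near_def using r.open_V r.smooth_\<Gamma>' r.killing_on_push[OF N(4)] N(2) by blast
qed

lemma killing_dim_at_transport:
  assumes "killing_dim_at \<Gamma> x n" "x \<in> U"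
  shows "killing_dim_at \<Gamma>' (\<tau> x) n"
proof -
  interpret inv: affine_iso \<Gamma>' V \<Gamma> U \<sigma> \<tau> by (rule inverse_iso)
  obtain X where X: "\<And>m. m < n \<Longrightarrow> kill_near \<Gamma> x (X m)"
    "\<And>a m. \<forall>\<^sub>F z in nhds x. (\<Sum>m<n. a m *\<^sub>R X m z) = 0 \<Longrightarrow> m < n \<Longrightarrow> a m = 0"
    "\<And>Y. kill_near \<Gamma> x Y \<Longrightarrow> \<exists>a. \<forall>\<^sub>F z in nhds x. Y z = (\<Sum>m<n. a m *\<^sub>R X m z)"
    using assms(1) unfolding killing_dim_at_def by blast
  show ?thesis unfolding killing_dim_at_def
  proof (rule exI[of _ "\<lambda>m. push (X m)"], intro conjI allI impI)
    show "kill_near \<Gamma>' (\<tau> x) (push (X m))" if "m < n" for m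
      by (rule kill_near_push[OF X(1)[OF that] assms(2)])
  next
    fix a m assume a: "\<forall>\<^sub>F y in nhds (\<tau> x). (\<Sum>m<n. a m *\<^sub>R push (X m) y) = 0" and "m < n"
    have "\<forall>\<^sub>F z in nhds x. z \<in> U \<and> (\<Sum>m<n. a m *\<^sub>R push (X m) (\<tau> z)) = 0"
      using inv.eventually_pullback[OF \<tau>_in[OF assms(2)] a] by (simp add: \<sigma>_\<tau> assms(2))
    then have "\<forall>\<^sub>F z in nhds x. (\<Sum>m<n. a m *\<^sub>R X m z) = 0"
    proof eventually_elim
      case (elim z)
      let ?Y = "\<lambda>z. \<Sum>m<n. a m *\<^sub>R X m z"
      have "related \<sigma> V (push ?Y) ?Y"
        by (rule inv.related_inverse[OF related_push])
      then have "?Y (\<sigma> (\<tau> z)) $ b = 0" for b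
        using elim \<tau>_in[of z] by (auto simp only: related_def push_sum zero_index mult_zero_right sum.neutral_const)
      then show ?case using elim by (simp add: vec_eq_iff \<sigma>_\<tau>)
    qed
    then show "a m = 0" using X(2) \<open>m < n\<close> by blast
  next
    fix Y assume Y: "kill_near \<Gamma>' (\<tau> x) Y"
    obtain a where a: "\<forall>\<^sub>F z in nhds x. inv.push Y z = (\<Sum>m<n. a m *\<^sub>R X m z)"
      using X(3) inv.kill_near_push[OF Y \<tau>_in[OF assms(2)]] by (auto simp: \<sigma>_\<tau> assms(2))
    have r: "related \<tau> U (inv.push Y) Y" by (rule related_inverse[OF inv.related_push])
    have "\<forall>\<^sub>F y in nhds (\<tau> x). Y y = (\<Sum>m<n. a m *\<^sub>R push (X m) y)"
      using eventually_pullback[OF assms(2) a]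
    proof eventually_elim
      case (elim y)
      have "Y y = push (inv.push Y) y"
        unfolding vec_eq_iff using r[unfolded related_def, rule_format, OF \<sigma>_in[of y]] elim
        by (simp add: \<tau>_\<sigma> push_def)
      also have "push (inv.push Y) y = push (\<lambda>z. \<Sum>m<n. a m *\<^sub>R X m z) y"
        using elim by (simp add: push_def)
      finally show ?case unfolding push_sum .
    qed
    then show "\<exists>a. \<forall>\<^sub>F y in nhds (\<tau> x). Y y = (\<Sum>m<n. a m *\<^sub>R push (X m) y)" by blast
  qed
qed

lemma noncommuting_transport:
  assumes "kill_near \<Gamma> x X" "kill_near \<Gamma> x Y" "bracket X Y x \<noteq> 0" "x \<in> U"
  shows "\<exists>X Y. kill_near \<Gamma>' (\<tau> x) X \<and> kill_near \<Gamma>' (\<tau> x) Y \<and> bracket X Y (\<tau> x) \<noteq> 0"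
proof (intro exI conjI)
  show "kill_near \<Gamma>' (\<tau> x) (push X)" "kill_near \<Gamma>' (\<tau> x) (push Y)"
    using kill_near_push assms by blast+
  obtain N where N: "open N" "x \<in> N" "N \<subseteq> U" "killing_on \<Gamma> N X"
    using kill_near_subset[OF assms(1) open_U assms(4)] by metis
  obtain M where M: "open M" "x \<in> M" "M \<subseteq> N" "killing_on \<Gamma> M Y"
    using kill_near_subset[OF assms(2) N(1,2)] by metis
  interpret r: affine_iso \<Gamma> M \<Gamma>' "\<tau> ` M" \<tau> \<sigma>
    by (rule restrict) (use M N in auto)
  interpret inv: affine_iso \<Gamma>' "\<tau> ` M" \<Gamma> M \<sigma> \<tau> by (rule r.inverse_iso)
  have s: "smooth_map_on M X" "smooth_map_on M Y"
    using N(4) M(3,4) smooth_on_subset[OF _ M(3)] unfolding killing_on_def smooth_map_on_def by blast+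
  have "related \<tau> M (bracket X Y) (bracket (push X) (push Y))"
    by (intro r.related_bracket r.related_push r.smooth_push s)
  then have "related \<sigma> (\<tau> ` M) (bracket (push X) (push Y)) (bracket X Y)"
    by (rule inv.related_inverse)
  from this[unfolded related_def, rule_format, OF r.\<tau>_in[OF M(2)]]
  have "bracket X Y x $ b = 0" if "bracket (push X) (push Y) (\<tau> x) = 0" for b
    using that by (simp add: r.\<sigma>_\<tau>[OF M(2)])
  with assms(3) show "bracket (push X) (push Y) (\<tau> x) \<noteq> 0" by (auto simp: vec_eq_iff)
qed

end

section \<open>Lie derivatives along Killing fields\<close>

text \<open>The left side is the Lie derivative of the curvature, the right side the exterior
  covariant derivative of the Lie derivative of the connection. The identity holds for every smooth
  \<open>X\<close>; the third derivatives of \<open>X\<close> cancel by symmetry.\<close>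

lemma lie_conn_integrability:
  assumes "open S" "x \<in> S" and \<Gamma>: "smooth_conn_on S \<Gamma>" and X: "smooth_map_on S X"
  shows "(\<Sum>l\<in>UNIV. X x $ l * pd l (riem \<Gamma> 1 2 j k) x - riem \<Gamma> 1 2 j l x * pdc l X k x
        + riem \<Gamma> l 2 j k x * pdc 1 X l x + riem \<Gamma> 1 l j k x * pdc 2 X l x
        + riem \<Gamma> 1 2 l k x * pdc j X l x)
    = pd 1 (lie_conn \<Gamma> X 2 j k) x - pd 2 (lie_conn \<Gamma> X 1 j k) x
     + (\<Sum>l\<in>UNIV. \<Gamma> 1 l k x * lie_conn \<Gamma> X 2 j l x - \<Gamma> 1 j l x * lie_conn \<Gamma> X 2 l k x
        - \<Gamma> 2 l k x * lie_conn \<Gamma> X 1 j l x + \<Gamma> 2 j l x * lie_conn \<Gamma> X 1 l k x)"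
proof -
  note sd = smooth_on_differentiable[OF _ assms(1,2)]
  have sX: "smooth_on S (\<lambda>y. X y $ l)" and s\<Gamma>: "smooth_on S (\<Gamma> i j l)" for i j l
    using X \<Gamma> by (auto simp: smooth_map_on_def smooth_conn_on_def)
  have d: "(\<lambda>y. X y $ l) differentiable (at x)" "\<Gamma> i j l differentiable (at x)"
      "pd i (\<Gamma> m j l) differentiable (at x)"
      "pdc i X l differentiable (at x)" "pd m (pdc i X l) differentiable (at x)" for i j l m
    by (intro sd smooth_on_pd sX s\<Gamma>)+
  have c: "pd 2 (pdc 1 X l) x = pd 1 (pdc 2 X l) x"
      "pd 2 (pd 1 (pdc i X l)) x = pd 1 (pd 2 (pdc i X l)) x"
      "pd 2 (pd 1 (\<Gamma> i j l)) x = pd 1 (pd 2 (\<Gamma> i j l)) x" for i j l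
    by (intro pd_commute[OF assms(1) _ assms(2)] smooth_on_pd sX s\<Gamma>)+
  have R: "pd m (riem \<Gamma> a i p q) x = pd m (pd a (\<Gamma> i p q)) x - pd m (pd i (\<Gamma> a p q)) x
      + (\<Sum>l\<in>UNIV. pd m (\<Gamma> a l q) x * \<Gamma> i p l x + \<Gamma> a l q x * pd m (\<Gamma> i p l) x
        - (pd m (\<Gamma> i l q) x * \<Gamma> a p l x + \<Gamma> i l q x * pd m (\<Gamma> a p l) x))" for m a i p q
    unfolding riem_def[abs_def] sum_2 by (simp only: pd_rules d)
  have L: "pd m (lie_conn \<Gamma> X i p q) x = pd m (pd i (pdc p X q)) x
      + (\<Sum>l\<in>UNIV. pdc m X l x * pd l (\<Gamma> i p q) x + X x $ l * pd m (pd l (\<Gamma> i p q)) x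
         - (pd m (\<Gamma> i p l) x * pdc l X q x + \<Gamma> i p l x * pd m (pdc l X q) x)
         + (pd m (\<Gamma> l p q) x * pdc i X l x + \<Gamma> l p q x * pd m (pdc i X l) x)
         + (pd m (\<Gamma> i l q) x * pdc p X l x + \<Gamma> i l q x * pd m (pdc p X l) x))" for m i p q
    unfolding lie_conn_def[abs_def] sum_2 by (simp only: pd_rules d)
  have jk: "j = 1 \<and> k = 1 \<or> j = 1 \<and> k = 2 \<or> j = 2 \<and> k = 1 \<or> j = 2 \<and> k = 2"
    using exhaust_2[of j] exhaust_2[of k] by auto
  show ?thesis
    unfolding R L unfolding riem_def lie_conn_def sum_2
    using jk by (elim disjE conjE; hypsubst; simp only: c; simp only: algebra_simps; simp)
qed

definition lie_tensor2 :: "vfield \<Rightarrow> (2 \<Rightarrow> 2 \<Rightarrow> real^2 \<Rightarrow> real) \<Rightarrow> 2 \<Rightarrow> 2 \<Rightarrow> real^2 \<Rightarrow> real" where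
  "lie_tensor2 X T i j x = (\<Sum>l\<in>UNIV. X x $ l * pd l (T i j) x
     + T l j x * pdc i X l x + T i l x * pdc j X l x)"

text \<open>For a Killing field the right side of the integrability identity vanishes. The
  components of \<open>ricci\<close> are, up to sign, those of \<open>riem \<Gamma> 1 2\<close>, so
  the identity for \<open>k = 1\<close> and \<open>k = 2\<close> is already the claim.\<close>

lemma lie_tensor2_ricci:
  assumes S: "open S" "smooth_conn_on S \<Gamma>" and K: "killing_on \<Gamma> S X" and x: "x \<in> S"
  shows "lie_tensor2 X (ricci \<Gamma>) i j x = 0"
proof -
  have X: "smooth_map_on S X" and L: "lie_conn \<Gamma> X i j k y = 0" if "y \<in> S" for i j k y
    using K that unfolding killing_on_iff_lie_conn[OF S] by auto
  have L': "pd m (lie_conn \<Gamma> X i j k) x = 0" for m i j k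
    using pd_cong_open[OF S(1) x, of "lie_conn \<Gamma> X i j k" "\<lambda>_. 0" m] L by simp
  have ric: "ricci \<Gamma> 1 j = (\<lambda>x. - riem \<Gamma> 1 2 j 2 x)" "ricci \<Gamma> 2 j = riem \<Gamma> 1 2 j 1" for j
    by (auto simp: fun_eq_iff ricci_eq_riem sum_2 riem_alternating)
  have d: "riem \<Gamma> m i j k differentiable (at x)" for m i j k
    by (rule smooth_on_differentiable[OF smooth_on_riem[OF S] S(1) x])
  have "(\<Sum>l\<in>UNIV. X x $ l * pd l (riem \<Gamma> 1 2 j k) x - riem \<Gamma> 1 2 j l x * pdc l X k x
        + riem \<Gamma> l 2 j k x * pdc 1 X l x + riem \<Gamma> 1 l j k x * pdc 2 X l x
        + riem \<Gamma> 1 2 l k x * pdc j X l x) = 0" for j k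
    using lie_conn_integrability[OF S(1) x S(2) X[OF x], of j k] by (simp add: L' L[OF x])
  from this[of j 1] this[of j 2] show ?thesis
    using exhaust_2[of i] by (auto simp: lie_tensor2_def ric sum_2 riem_alternating pd_minus d algebra_simps)
qed

text \<open>Lie derivation along a Killing field commutes with covariant differentiation. At a zero
  of \<open>X\<close> only the linear part of \<open>X\<close> remains, acting as a derivation; the
  second derivatives of \<open>X\<close> are eliminated by the Killing equation
  \<open>H\<close>.\<close>

lemma isotropy_nabla_tensor2:
  assumes S: "open S" "smooth_conn_on S \<Gamma>" and T: "\<And>i j. smooth_on S (T i j)" and K: "killing_on \<Gamma> S X" and x: "x \<in> S"
    and L: "\<And>y i j. y \<in> S \<Longrightarrow> lie_tensor2 X T i j y = 0" and X0: "X x = 0"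
  shows "(\<Sum>l\<in>UNIV. pdc k X l x * nabla_tensor2 \<Gamma> T l i j x
     + pdc i X l x * nabla_tensor2 \<Gamma> T k l j x + pdc j X l x * nabla_tensor2 \<Gamma> T k i l x) = 0"
proof -
  have X: "smooth_map_on S X" and C: "lie_conn \<Gamma> X i j k x = 0" for i j k
    using K x unfolding killing_on_iff_lie_conn[OF S] by auto
  have H: "pd i (pdc j X k) x = (\<Sum>l\<in>UNIV. \<Gamma> i j l x * pdc l X k x
      - \<Gamma> l j k x * pdc i X l x - \<Gamma> i l k x * pdc j X l x)" for i j k
    using C[of i j k] by (simp add: lie_conn_def X0 sum_2)
  note sd = smooth_on_differentiable[OF _ S(1) x]
  have sX: "smooth_on S (\<lambda>y. X y $ l)" for l using X by (simp add: smooth_map_on_def)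
  have d: "(\<lambda>y. X y $ l) differentiable (at x)" "pdc i X l differentiable (at x)"
      "T i j differentiable (at x)" "pd m (T i j) differentiable (at x)" for i j l m
    by (intro sd smooth_on_pd sX T)+
  have "pd k (lie_tensor2 X T i j) x = 0"
    using pd_cong_open[OF S(1) x, of "lie_tensor2 X T i j" "\<lambda>_. 0" k] L by simp
  moreover have "lie_tensor2 X T a b x = 0" for a b by (rule L[OF x])
  then have L0: "(\<Sum>l\<in>UNIV. T l b x * pdc a X l x + T a l x * pdc b X l x) = 0" for a b
    by (simp add: lie_tensor2_def X0)
  ultimately have E: "(\<Sum>l\<in>UNIV. pdc k X l x * pd l (T i j) x
      + pd k (T l j) x * pdc i X l x + T l j x * pd k (pdc i X l) x
      + pd k (T i l) x * pdc j X l x + T i l x * pd k (pdc j X l) x) = 0"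
    by (simp add: lie_tensor2_def[abs_def] sum_2 pd_rules d X0 algebra_simps)
  have "(\<Sum>l\<in>UNIV. pdc k X l x * nabla_tensor2 \<Gamma> T l i j x
     + pdc i X l x * nabla_tensor2 \<Gamma> T k l j x + pdc j X l x * nabla_tensor2 \<Gamma> T k i l x)
    = (\<Sum>l\<in>UNIV. pdc k X l x * pd l (T i j) x
      + pd k (T l j) x * pdc i X l x + T l j x * pd k (pdc i X l) x
      + pd k (T i l) x * pdc j X l x + T i l x * pd k (pdc j X l) x)
    - (\<Sum>m\<in>UNIV. \<Gamma> k j m x * (\<Sum>l\<in>UNIV. T l m x * pdc i X l x + T i l x * pdc m X l x)
       + \<Gamma> k i m x * (\<Sum>l\<in>UNIV. T l j x * pdc m X l x + T m l x * pdc j X l x))"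
    unfolding H nabla_tensor2_def sum_2 by (simp add: algebra_simps)
  then show ?thesis unfolding E L0 by simp
qed

text \<open>Gronwall's argument along the ray from \<open>x0\<close> to \<open>x\<close>: the sum of
  squares \<open>G\<close> of the unknowns starts at zero and satisfies
  \<open>G' \<le> K * G\<close>.\<close>

lemma linear_pde_zero:
  fixes w :: "'i::finite \<Rightarrow> real^2 \<Rightarrow> real"
  assumes d: "\<And>a x. x \<in> ball x0 r \<Longrightarrow> w a differentiable (at x)"
    and le: "\<And>a j x. x \<in> ball x0 r \<Longrightarrow> \<bar>pd j (w a) x\<bar> \<le> C * (\<Sum>b\<in>UNIV. \<bar>w b x\<bar>)"
    and w0: "\<And>a. w a x0 = 0" and x: "x \<in> ball x0 r" and "C \<ge> 0"
  shows "w a x = 0"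
proof -
  define h where "h = x - x0"
  define y where "y t = x0 + t *\<^sub>R h" for t
  have y: "y t \<in> ball x0 r" if "0 \<le> t" "t \<le> 1" for t
  proof -
    have "dist x0 (y t) = t * norm h" using that by (simp add: y_def dist_norm)
    also have "\<dots> \<le> norm h" using that mult_right_mono[of t 1 "norm h"] by simp
    also have "\<dots> < r" using x by (simp add: h_def dist_norm norm_minus_commute)
    finally show ?thesis by simp
  qed
  define G where "G t = (\<Sum>a\<in>UNIV. (w a (y t))\<^sup>2)" for t
  define G' where "G' t = (\<Sum>a\<in>UNIV. 2 * (w a (y t) * (pd 1 (w a) (y t) * h $ 1 + pd 2 (w a) (y t) * h $ 2)))" for t
  have DG: "(G has_real_derivative G' t) (at t)" if "0 \<le> t" "t \<le> 1" for t
  proof -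
    have "(y has_derivative (\<lambda>s. s *\<^sub>R h)) (at t)"
      unfolding y_def[abs_def] by (auto intro!: derivative_eq_intros)
    from has_derivative_compose[OF this has_derivative_pd[OF d[OF y[OF that]]]]
    have 1: "((\<lambda>t. w a (y t)) has_real_derivative pd 1 (w a) (y t) * h $ 1 + pd 2 (w a) (y t) * h $ 2) (at t)" for a
      unfolding has_field_derivative_def by (rule has_derivative_eq_rhs) (auto simp: algebra_simps)
    show ?thesis unfolding G_def[abs_def] G'_def
      by (rule DERIV_sum) (use DERIV_power[OF 1, where n = 2] in \<open>simp add: algebra_simps\<close>)
  qed
  \<comment> \<open>The 2 comes from differentiating squares, the components of \<open>h\<close>
    from the chain rule along the ray, and the cardinality from Cauchy-Schwarz applied to the sum
    \<open>S\<close> of absolute values.\<close>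
  define K where "K = 2 * (C * (\<bar>h $ 1\<bar> + \<bar>h $ 2\<bar>) * real CARD('i))"
  have G'_le: "G' t \<le> K * G t" if "0 \<le> t" "t \<le> 1" for t
  proof -
    define S where "S = (\<Sum>b\<in>UNIV. \<bar>w b (y t)\<bar>)"
    have "S \<ge> 0" unfolding S_def by (simp add: sum_nonneg)
    have "w a (y t) * (pd 1 (w a) (y t) * h $ 1 + pd 2 (w a) (y t) * h $ 2) \<le> \<bar>w a (y t)\<bar> * (C * S * (\<bar>h $ 1\<bar> + \<bar>h $ 2\<bar>))" for a
    proof -
      have "\<bar>pd j (w a) (y t) * h $ j\<bar> \<le> C * S * \<bar>h $ j\<bar>" for j
        using mult_right_mono[OF le[OF y[OF that], of j a], of "\<bar>h $ j\<bar>"] by (simp add: S_def abs_mult)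
      from this[of 1] this[of 2]
      have "\<bar>pd 1 (w a) (y t) * h $ 1 + pd 2 (w a) (y t) * h $ 2\<bar> \<le> C * S * (\<bar>h $ 1\<bar> + \<bar>h $ 2\<bar>)"
        unfolding distrib_left by linarith
      then have "\<bar>w a (y t)\<bar> * \<bar>pd 1 (w a) (y t) * h $ 1 + pd 2 (w a) (y t) * h $ 2\<bar> \<le> \<bar>w a (y t)\<bar> * (C * S * (\<bar>h $ 1\<bar> + \<bar>h $ 2\<bar>))"
        by (intro mult_left_mono) auto
      then show ?thesis by (metis abs_le_D1 abs_mult)
    qed
    then have "G' t \<le> (\<Sum>a\<in>UNIV. 2 * (\<bar>w a (y t)\<bar> * (C * S * (\<bar>h $ 1\<bar> + \<bar>h $ 2\<bar>))))"
      unfolding G'_def by (intro sum_mono) simp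
    also have "\<dots> = 2 * (C * (\<bar>h $ 1\<bar> + \<bar>h $ 2\<bar>)) * S\<^sup>2"
      unfolding sum_distrib_left[symmetric] sum_distrib_right[symmetric] S_def[symmetric] by (simp add: power2_eq_square)
    also have "\<dots> \<le> 2 * (C * (\<bar>h $ 1\<bar> + \<bar>h $ 2\<bar>)) * (G t * real CARD('i))"
    proof (rule mult_left_mono)
      show "S\<^sup>2 \<le> G t * real CARD('i)"
        using sum_squared_le_sum_of_squares[of "\<lambda>b. \<bar>w b (y t)\<bar>" UNIV] by (simp add: S_def G_def)
    qed (use \<open>C \<ge> 0\<close> in simp)
    finally show ?thesis by (simp add: K_def algebra_simps)
  qed
  define E where "E t = G t * exp (- (K * t))" for t
  have "E 1 \<le> E 0"
  proof (rule DERIV_nonpos_imp_nonincreasing[of 0 1 E])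
    fix t :: real assume t: "0 \<le> t" "t \<le> 1"
    have "(E has_real_derivative (G' t - K * G t) * exp (- (K * t))) (at t)"
      unfolding E_def[abs_def] by (auto intro!: derivative_eq_intros DG t simp: algebra_simps)
    moreover have "(G' t - K * G t) * exp (- (K * t)) \<le> 0"
      using G'_le[OF t] by (intro mult_nonpos_nonneg) auto
    ultimately show "\<exists>z. (E has_real_derivative z) (at t) \<and> z \<le> 0" by blast
  qed simp
  then have "G 1 * exp (- K) \<le> 0" by (simp add: E_def G_def y_def w0)
  then have "G 1 \<le> 0" by (simp add: mult_le_0_iff)
  moreover have "(w a x)\<^sup>2 \<le> G 1"
    unfolding G_def y_def h_def using member_le_sum[of a UNIV "\<lambda>a. (w a x)\<^sup>2"] by simp
  ultimately have "(w a x)\<^sup>2 \<le> 0" by linarith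
  then show ?thesis by simp
qed

lemma finite_family_bounded:
  fixes f :: "'i::finite \<Rightarrow> real^2 \<Rightarrow> real"
  assumes "compact K" "\<And>a. continuous_on K (f a)"
  shows "\<exists>B\<ge>0. \<forall>a. \<forall>x\<in>K. \<bar>f a x\<bar> \<le> B"
proof -
  have "\<exists>b. \<forall>x\<in>K. \<bar>f a x\<bar> \<le> b" for a
    using compact_imp_bounded[OF compact_continuous_image[OF assms(2,1)]]
    by (auto simp: bounded_iff)
  then obtain b where b: "\<And>a x. x \<in> K \<Longrightarrow> \<bar>f a x\<bar> \<le> b a" by metis
  have "\<bar>f a x\<bar> \<le> (\<Sum>a\<in>UNIV. \<bar>b a\<bar>)" if "x \<in> K" for a x
    using b[OF that, of a] member_le_sum[of a UNIV "\<lambda>a. \<bar>b a\<bar>"] by fastforce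
  then show ?thesis by (intro exI[of _ "\<Sum>a\<in>UNIV. \<bar>b a\<bar>"]) (auto simp: sum_nonneg)
qed

text \<open>The Killing equation expresses the second derivatives of \<open>X\<close> through its 1-jet, so the
  1-jet solves a linear system along rays.\<close>

lemma killing_unique:
  assumes "kill_near \<Gamma> x0 X" "X x0 = 0" "\<And>i k. pdc i X k x0 = 0"
  shows "\<forall>\<^sub>F x in nhds x0. X x = 0"
proof -
  obtain N where N: "open N" "x0 \<in> N" "smooth_conn_on N \<Gamma>" "killing_on \<Gamma> N X"
    using assms(1) by (auto simp: kill_near_def)
  have X: "smooth_on N (\<lambda>y. X y $ k)" and L: "x \<in> N \<Longrightarrow> lie_conn \<Gamma> X i j k x = 0" for x i j k
    using N(4) unfolding killing_on_iff_lie_conn[OF N(1,3)] smooth_map_on_def by auto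
  obtain r where r: "r > 0" "cball x0 r \<subseteq> N" using N(1,2) open_contains_cball by blast
  obtain B1 where B1: "B1 \<ge> 0" "\<And>a x. x \<in> cball x0 r \<Longrightarrow> \<bar>(\<lambda>(i, j, k). \<Gamma> i j k) a x\<bar> \<le> B1"
    using finite_family_bounded[of "cball x0 r" "\<lambda>(i, j, k). \<Gamma> i j k"]
      continuous_on_subset[OF smooth_on_continuous[OF smooth_conn_onD[OF N(3)]] r(2)] by auto
  obtain B2 where B2: "B2 \<ge> 0" "\<And>a x. x \<in> cball x0 r \<Longrightarrow> \<bar>(\<lambda>(l, i, j, k). pd l (\<Gamma> i j k)) a x\<bar> \<le> B2"
    using finite_family_bounded[of "cball x0 r" "\<lambda>(l, i, j, k). pd l (\<Gamma> i j k)"]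
      continuous_on_subset[OF smooth_on_continuous[OF smooth_on_pd[OF smooth_conn_onD[OF N(3)]]] r(2)] by auto
  \<comment> \<open>The 1-jet as one finite family: \<open>None\<close> stands for the value of
    \<open>X\<close>, \<open>Some i\<close> for its derivative in direction
    \<open>i\<close>.\<close>
  define w :: "2 option \<times> 2 \<Rightarrow> real^2 \<Rightarrow> real"
    where "w = (\<lambda>(p, k). case p of None \<Rightarrow> (\<lambda>y. X y $ k) | Some i \<Rightarrow> pdc i X k)"
  \<comment> \<open>The 1 serves the derivatives of the values. The Killing equation has two terms
    with a derivative of \<open>\<Gamma>\<close> and six with \<open>\<Gamma>\<close>
    itself.\<close>
  define C where "C = 1 + 2 * B2 + 6 * B1"
  have w: "smooth_on N (w a)" for a
    by (cases a) (auto simp: w_def X smooth_on_pd split: option.splits)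
  have w_zero: "w a x = 0" if x: "x \<in> ball x0 r" for a :: "2 option \<times> 2" and x
  proof (rule linear_pde_zero[of x0 r w C])
    show "C \<ge> 0" using B1(1) B2(1) by (simp add: C_def)
    show "w a differentiable (at x)" if "x \<in> ball x0 r" for a :: "2 option \<times> 2" and x
      by (rule smooth_on_differentiable[OF w N(1)]) (use that r(2) in auto)
    show "w a x0 = 0" for a :: "2 option \<times> 2"
      using assms(2,3) by (cases a) (auto simp: w_def split: option.splits)
    fix a :: "2 option \<times> 2" and j x assume x: "x \<in> ball x0 r"
    define S where "S = (\<Sum>b\<in>UNIV. \<bar>w b x\<bar>)"
    have S: "\<bar>w b x\<bar> \<le> S" for b unfolding S_def by (rule member_le_sum) auto
    have S0: "\<bar>X x $ k\<bar> \<le> S" and S1: "\<bar>pdc i X k x\<bar> \<le> S" for i k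
      using S[of "(None, k)"] S[of "(Some i, k)"] by (simp_all add: w_def)
    have "S \<ge> 0" unfolding S_def by (simp add: sum_nonneg)
    obtain p k where a: "a = (p, k)" by (cases a)
    show "\<bar>pd j (w a) x\<bar> \<le> C * (\<Sum>b\<in>UNIV. \<bar>w b x\<bar>)"
    proof (cases p)
      case None
      have "\<bar>pd j (w a) x\<bar> \<le> 1 * S" using S1[of j k] by (simp add: a None w_def)
      also have "\<dots> \<le> C * S" using \<open>S \<ge> 0\<close> B1(1) B2(1) by (intro mult_right_mono) (auto simp: C_def)
      finally show ?thesis by (simp add: S_def)
    next
      case (Some i)
      have xN: "x \<in> N" "x \<in> cball x0 r" using x r(2) by auto
      have G1: "\<bar>\<Gamma> i j k x\<bar> \<le> B1" and G2: "\<bar>pd l (\<Gamma> i j k) x\<bar> \<le> B2" for i j k l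
        using B1(2)[OF xN(2), of "(i, j, k)"] B2(2)[OF xN(2), of "(l, i, j, k)"] by auto
      have T0: "\<bar>X x $ l * pd l (\<Gamma> j i k) x\<bar> \<le> B2 * S" for l
        unfolding abs_mult using mult_mono[OF S0[of l] G2[of l j i k]] \<open>S \<ge> 0\<close> by (simp add: mult.commute)
      have T1: "\<bar>\<Gamma> i' j' k' x * pdc m X l x\<bar> \<le> B1 * S" for i' j' k' m l
        unfolding abs_mult using mult_mono[OF G1[of i' j' k'] S1[of m l]] B1(1) by simp
      note T = T0[of 1] T0[of 2] T1[of j i 1 1 k] T1[of j i 2 2 k] T1[of 1 i k j 1] T1[of 2 i k j 2]
        T1[of j 1 k i 1] T1[of j 2 k i 2]
      have "pd j (w a) x = pd j (pdc i X k) x" by (simp add: a Some w_def)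
      also have "\<dots> = - (X x $ 1 * pd 1 (\<Gamma> j i k) x) - X x $ 2 * pd 2 (\<Gamma> j i k) x
         + \<Gamma> j i 1 x * pdc 1 X k x + \<Gamma> j i 2 x * pdc 2 X k x
         - \<Gamma> 1 i k x * pdc j X 1 x - \<Gamma> 2 i k x * pdc j X 2 x
         - \<Gamma> j 1 k x * pdc i X 1 x - \<Gamma> j 2 k x * pdc i X 2 x"
        using L[OF xN(1), of j i k] by (simp add: lie_conn_def sum_2)
      also have "\<bar>\<dots>\<bar> \<le> 2 * (B2 * S) + 6 * (B1 * S)"
        using T[THEN abs_le_D1] T[THEN abs_le_D2] by (intro abs_leI; linarith)
      also have "\<dots> \<le> C * S" using \<open>S \<ge> 0\<close> by (simp add: C_def algebra_simps)
      finally show ?thesis by (simp add: S_def)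
    qed
  qed (rule x)
  then have "X x = 0" if "x \<in> ball x0 r" for x
    unfolding vec_eq_iff using w_zero[OF that, of "(None, k)" for k] by (simp add: w_def)
  then show ?thesis
    using r(1) eventually_nhds_in_open[of "ball x0 r" x0] by (auto elim: eventually_mono)
qed

section \<open>Pointwise algebra of the Ricci tensor\<close>

text \<open>The factor \<open>e\<close> carries the sign of \<open>\<rho>\<close>, which a real
  square cannot. The factor \<open>t\<close> may vanish, so that a parallel \<open>\<rho>\<close> is
  included.\<close>

definition cubic_type :: "(2 \<Rightarrow> 2 \<Rightarrow> real) \<Rightarrow> (2 \<Rightarrow> 2 \<Rightarrow> 2 \<Rightarrow> real) \<Rightarrow> bool" where
  "cubic_type \<rho> T \<longleftrightarrow> (\<exists>e (a :: 2 \<Rightarrow> real) t. e \<noteq> 0 \<and> (a 1 \<noteq> 0 \<or> a 2 \<noteq> 0) \<and>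
     (\<forall>i j. \<rho> i j = e * a i * a j) \<and> (\<forall>k i j. T k i j = t * a k * a i * a j))"

definition cubic_at :: "christoffel \<Rightarrow> real^2 \<Rightarrow> bool" where
  "cubic_at \<Gamma> x \<longleftrightarrow> cubic_type (\<lambda>i j. ricci \<Gamma> i j x) (\<lambda>k i j. nabla_ricci \<Gamma> k i j x)"

lemma symmetric_rank_one:
  fixes \<rho> :: "2 \<Rightarrow> 2 \<Rightarrow> real"
  assumes sym: "\<rho> 1 2 = \<rho> 2 1" and det: "\<rho> 1 1 * \<rho> 2 2 = \<rho> 1 2 * \<rho> 2 1" and nz: "\<exists>i j. \<rho> i j \<noteq> 0"
  shows "\<exists>e (a :: 2 \<Rightarrow> real). e \<noteq> 0 \<and> (a 1 \<noteq> 0 \<or> a 2 \<noteq> 0) \<and> (\<forall>i j. \<rho> i j = e * a i * a j)"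
proof (cases "\<rho> 1 1 = 0")
  case False
  \<comment> \<open>A symmetric matrix of rank one with non-zero corner is the square of its first
    row divided by that corner.\<close>
  show ?thesis
    by (rule exI[of _ "1 / \<rho> 1 1"], rule exI[of _ "\<lambda>i. \<rho> 1 i"])
      (use False sym det in \<open>auto simp: forall_2 field_simps\<close>)
next
  case True
  then have "\<rho> 1 2 = 0" "\<rho> 2 1 = 0" using sym det by auto
  then show ?thesis
    by (intro exI[of _ "\<rho> 2 2"] exI[of _ "\<lambda>i. if i = 2 then 1 else 0"])
      (use True nz in \<open>auto simp: forall_2, metis exhaust_2\<close>)
qed

text \<open>A vector orthogonal to \<open>(- a 2, a 1)\<close> is a multiple of \<open>a\<close>;
  the factor is the coefficient of the orthogonal projection.\<close>

lemma proportional_2: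
  fixes F a :: "2 \<Rightarrow> real"
  assumes "a 1 * F 2 = a 2 * F 1" "a 1 \<noteq> 0 \<or> a 2 \<noteq> 0"
  shows "F k = a k * ((a 1 * F 1 + a 2 * F 2) / (a 1 * a 1 + a 2 * a 2))"
proof -
  have "a 1 * a 1 + a 2 * a 2 \<noteq> 0" using assms(2) by (simp add: sum_squares_eq_zero_iff)
  moreover have "F k * (a 1 * a 1 + a 2 * a 2) = a k * (a 1 * F 1 + a 2 * F 2)"
  proof -
    consider "k = 1" | "k = 2" using exhaust_2[of k] by auto
    then show ?thesis
    proof cases
      case 1 show ?thesis unfolding 1 using assms(1) by algebra
    next
      case 2 show ?thesis unfolding 2 using assms(1) by algebra
    qed
  qed
  ultimately show ?thesis by (simp add: field_simps)
qed

text \<open>By hypothesis the contraction of any slot with \<open>(- a 2, a 1)\<close>, which spans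
  the kernel of \<open>a\<close>, is zero. Each slot therefore splits off one factor
  \<open>a\<close>.\<close>

lemma cubic_of_contractions:
  fixes T :: "2 \<Rightarrow> 2 \<Rightarrow> 2 \<Rightarrow> real"
  assumes a: "a 1 \<noteq> 0 \<or> a 2 \<noteq> 0"
    and "\<And>i j. a 1 * T 2 i j = a 2 * T 1 i j" "\<And>k j. a 1 * T k 2 j = a 2 * T k 1 j"
    and "\<And>k i. a 1 * T k i 2 = a 2 * T k i 1"
  shows "\<exists>t. \<forall>k i j. T k i j = t * a k * a i * a j"
proof -
  define n where "n = a 1 * a 1 + a 2 * a 2"
  have "n \<noteq> 0" using a by (simp add: n_def sum_squares_eq_zero_iff)
  define P where "P i j = (a 1 * T 1 i j + a 2 * T 2 i j) / n" for i j
  define Q where "Q j = (a 1 * P 1 j + a 2 * P 2 j) / n" for j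
  have 1: "T k i j = a k * P i j" for k i j
    unfolding P_def n_def using proportional_2[of a "\<lambda>k. T k i j", OF assms(2) a] .
  have P2: "a 1 * P 2 j = a 2 * P 1 j" for j
  proof -
    have "a 1 * (a 1 * T 1 2 j + a 2 * T 2 2 j) = a 2 * (a 1 * T 1 1 j + a 2 * T 2 1 j)"
      using assms(3)[of 1 j] assms(3)[of 2 j] by algebra
    then show ?thesis by (simp add: P_def)
  qed
  have 2: "P i j = a i * Q j" for i j
    unfolding Q_def n_def using proportional_2[of a "\<lambda>i. P i j", OF P2 a] .
  have "a k * a i * (a 1 * Q 2) = a k * a i * (a 2 * Q 1)" for k i
    using assms(4)[of k i] unfolding 1 2 by (simp add: algebra_simps)
  from this[of 1 1] this[of 2 2] have Q2: "a 1 * Q 2 = a 2 * Q 1" using a by auto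
  have 3: "Q j = a j * ((a 1 * Q 1 + a 2 * Q 2) / n)" for j
    unfolding n_def using proportional_2[of a Q, OF Q2 a] .
  show ?thesis
    by (rule exI[of _ "(a 1 * Q 1 + a 2 * Q 2) / n"], intro allI, subst 1, subst 2, subst 3) (simp only: mult_ac)
qed

text \<open>For the converse, \<open>T = w \<otimes> \<rho>\<close> with
  \<open>\<rho> = e a \<otimes> a\<close>; interchanging the first two slots makes \<open>w\<close>
  a multiple of \<open>a\<close>.\<close>

lemma cubic_type_iff:
  "cubic_type \<rho> T \<longleftrightarrow> (\<forall>i j. \<rho> i j = \<rho> j i) \<and> \<rho> 1 1 * \<rho> 2 2 = \<rho> 1 2 * \<rho> 2 1 \<and> (\<exists>i j. \<rho> i j \<noteq> 0) \<and>
     (\<exists>w. \<forall>k i j. T k i j = w k * \<rho> i j) \<and> (\<forall>i j k. T i j k = T j i k)"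
proof
  assume "cubic_type \<rho> T"
  then obtain e and a :: "2 \<Rightarrow> real" and t where *: "e \<noteq> 0" "a 1 \<noteq> 0 \<or> a 2 \<noteq> 0"
    "\<And>i j. \<rho> i j = e * a i * a j" "\<And>k i j. T k i j = t * a k * a i * a j"
    unfolding cubic_type_def by blast
  have "\<exists>i j. \<rho> i j \<noteq> 0" using * by (metis mult_eq_0_iff)
  moreover have "\<exists>w. \<forall>k i j. T k i j = w k * \<rho> i j"
    by (rule exI[of _ "\<lambda>k. t * a k / e"]) (use * in simp)
  ultimately show "(\<forall>i j. \<rho> i j = \<rho> j i) \<and> \<rho> 1 1 * \<rho> 2 2 = \<rho> 1 2 * \<rho> 2 1 \<and> (\<exists>i j. \<rho> i j \<noteq> 0) \<and>
     (\<exists>w. \<forall>k i j. T k i j = w k * \<rho> i j) \<and> (\<forall>i j k. T i j k = T j i k)"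
    by (simp add: *)
next
  assume R: "(\<forall>i j. \<rho> i j = \<rho> j i) \<and> \<rho> 1 1 * \<rho> 2 2 = \<rho> 1 2 * \<rho> 2 1 \<and> (\<exists>i j. \<rho> i j \<noteq> 0) \<and>
     (\<exists>w. \<forall>k i j. T k i j = w k * \<rho> i j) \<and> (\<forall>i j k. T i j k = T j i k)"
  then obtain e and a :: "2 \<Rightarrow> real" where a: "e \<noteq> 0" "a 1 \<noteq> 0 \<or> a 2 \<noteq> 0" "\<And>i j. \<rho> i j = e * a i * a j"
    using symmetric_rank_one[of \<rho>] by blast
  obtain w where w: "\<And>k i j. T k i j = w k * \<rho> i j" using R by blast
  have "T 2 1 j = T 1 2 j" for j using R by blast
  then have "e * a j * (a 1 * w 2) = e * a j * (a 2 * w 1)" for j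
    by (simp add: w a(3) algebra_simps)
  from this[of 1] this[of 2] have w2: "a 1 * w 2 = a 2 * w 1" using a(1,2) by auto
  define s where "s = (a 1 * w 1 + a 2 * w 2) / (a 1 * a 1 + a 2 * a 2)"
  have s: "w k = a k * s" for k unfolding s_def by (rule proportional_2[OF w2 a(2)])
  have "T k i j = (e * s) * a k * a i * a j" for k i j
    by (simp add: w a(3) s)
  with a show "cubic_type \<rho> T" unfolding cubic_type_def by blast
qed

text \<open>The covector \<open>a\<close> is pulled back to \<open>b\<close>, which stays non-zero
  because the Jacobian is invertible; \<open>e\<close> and \<open>t\<close> do not change.\<close>

lemma cubic_type_transform:
  assumes \<rho>: "\<And>i j. \<rho> i j = (\<Sum>a\<in>UNIV. \<Sum>b\<in>UNIV. J i a * J j b * \<rho>' a b)"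
    and T: "\<And>k i j. T k i j = (\<Sum>d\<in>UNIV. \<Sum>a\<in>UNIV. \<Sum>b\<in>UNIV. J k d * J i a * J j b * T' d a b)"
    and det: "J 1 1 * J 2 2 - J 1 2 * J 2 1 \<noteq> 0"
    and "cubic_type \<rho>' T'"
  shows "cubic_type \<rho> T"
proof -
  obtain e and a :: "2 \<Rightarrow> real" and t where *: "e \<noteq> 0" "a 1 \<noteq> 0 \<or> a 2 \<noteq> 0"
    "\<And>i j. \<rho>' i j = e * a i * a j" "\<And>k i j. T' k i j = t * a k * a i * a j"
    using assms(4) unfolding cubic_type_def by blast
  define b where "b i = J i 1 * a 1 + J i 2 * a 2" for i
  have "b 1 \<noteq> 0 \<or> b 2 \<noteq> 0"
  proof (rule ccontr)
    assume "\<not> ?thesis"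
    then have "J 1 1 * a 1 + J 1 2 * a 2 = 0" "J 2 1 * a 1 + J 2 2 * a 2 = 0" by (auto simp: b_def)
    then have "(J 1 1 * J 2 2 - J 1 2 * J 2 1) * a 1 = 0" "(J 1 1 * J 2 2 - J 1 2 * J 2 1) * a 2 = 0"
      by algebra+
    with det *(2) show False by simp
  qed
  moreover have "\<rho> i j = e * b i * b j" for i j
    unfolding \<rho> by (simp add: *(3) sum_2 b_def algebra_simps)
  moreover have "T k i j = t * b k * b i * b j" for k i j
    unfolding T by (simp add: *(4) sum_2 b_def algebra_simps)
  ultimately show ?thesis using *(1) unfolding cubic_type_def by blast
qed

text \<open>Both matrices are multiples of one fixed matrix, so \<open>b 2 * B 1 - b 1 * B 2\<close>
  vanishes and they cannot span a plane. This settles the cases with a one-dimensional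
  stabiliser.\<close>

lemma proportional_derivations_dependent:
  fixes B :: "2 \<Rightarrow> 2 \<Rightarrow> 2 \<Rightarrow> real" and b :: "2 \<Rightarrow> real"
  assumes ind: "\<And>x y. (\<And>i l. x * B 1 i l + y * B 2 i l = 0) \<Longrightarrow> x = 0 \<and> y = 0" and d: "d \<noteq> 0"
    and c: "\<And>p. d * B p 1 1 = b p * n11" "\<And>p. d * B p 1 2 = b p * n12"
      "\<And>p. d * B p 2 1 = b p * n21" "\<And>p. d * B p 2 2 = b p * n22"
  shows False
proof -
  have il: "i = 1 \<and> l = 1 \<or> i = 1 \<and> l = 2 \<or> i = 2 \<and> l = 1 \<or> i = 2 \<and> l = 2" for i l :: 2
    using exhaust_2[of i] exhaust_2[of l] by auto
  have "d * (b 2 * B 1 i l + - b 1 * B 2 i l) = 0" for i l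
    using il[of i l]
  proof (elim disjE conjE)
    show ?thesis if "i = 1" "l = 1" unfolding that using c(1)[of 1] c(1)[of 2] by algebra
    show ?thesis if "i = 1" "l = 2" unfolding that using c(2)[of 1] c(2)[of 2] by algebra
    show ?thesis if "i = 2" "l = 1" unfolding that using c(3)[of 1] c(3)[of 2] by algebra
    show ?thesis if "i = 2" "l = 2" unfolding that using c(4)[of 1] c(4)[of 2] by algebra
  qed
  then have "b 2 * B 1 i l + - b 1 * B 2 i l = 0" for i l using d mult_eq_0_iff by blast
  from ind[OF this] have "b 1 = 0" by simp
  then have "d * B 1 i l = 0" for i l
    using il[of i l] c[of 1] by (elim disjE conjE) (simp_all only: mult_zero_left)
  then have "B 1 i l = 0" for i l using d mult_eq_0_iff by blast
  then have "1 * B 1 i l + 0 * B 2 i l = 0" for i l by simp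
  from ind[OF this] show False by simp
qed

text \<open>A plane of derivations annihilating \<open>\<rho>\<close> is, unless \<open>\<rho>\<close> is alternating, the space of all
  \<open>w \<otimes> v\<close> with \<open>v\<close> spanning the kernel of \<open>\<rho>\<close>; it then also forces the shape of \<open>T\<close>.\<close>

lemma isotropy_plane_cubic:
  fixes \<rho> :: "2 \<Rightarrow> 2 \<Rightarrow> real" and T :: "2 \<Rightarrow> 2 \<Rightarrow> 2 \<Rightarrow> real" and B :: "2 \<Rightarrow> 2 \<Rightarrow> 2 \<Rightarrow> real"
  assumes ind: "\<And>x y. (\<And>i l. x * B 1 i l + y * B 2 i l = 0) \<Longrightarrow> x = 0 \<and> y = 0"
    and \<rho>: "\<And>p i j. (\<Sum>l\<in>UNIV. B p i l * \<rho> l j + B p j l * \<rho> i l) = 0"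
    and T: "\<And>p k i j. (\<Sum>l\<in>UNIV. B p k l * T l i j + B p i l * T k l j + B p j l * T k i l) = 0"
    and na: "\<not> (\<forall>i j. \<rho> i j = - \<rho> j i)"
  shows "cubic_type \<rho> T"
proof -
  \<comment> \<open>The symmetric part of \<open>\<rho>\<close> inherits the invariance and is
    non-zero by \<open>na\<close>.\<close>
  define g where "g i j = \<rho> i j + \<rho> j i" for i j
  have gB: "B p i 1 * g 1 j + B p i 2 * g 2 j + B p j 1 * g i 1 + B p j 2 * g i 2 = 0" for p i j
    using \<rho>[of p i j] \<rho>[of p j i] by (simp add: g_def sum_2 algebra_simps)
  have g21: "g 2 1 = g 1 2" by (simp add: g_def)
  \<comment> \<open>A non-degenerate symmetric form has a one-dimensional stabiliser: all entries of
    \<open>B p\<close> are fixed multiples of the single parameter \<open>b p\<close>.\<close>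
  have D: "g 1 1 * g 2 2 = g 1 2 * g 2 1"
  proof (rule ccontr)
    assume D: "\<not> ?thesis"
    define b where "b p = B p 1 1 * g 1 2 + B p 1 2 * g 2 2" for p
    have e: "B p 1 1 * g 1 1 + B p 1 2 * g 1 2 = 0" "B p 2 1 * g 1 2 + B p 2 2 * g 2 2 = 0"
       "B p 2 1 * g 1 1 + B p 2 2 * g 1 2 = - b p" for p
      using gB[of p 1 1] gB[of p 2 2] gB[of p 1 2] unfolding b_def g21 by linarith+
    let ?d = "g 1 1 * g 2 2 - g 1 2 * g 2 1"
    have c: "?d * B p 1 1 = b p * - g 1 2"
      "?d * B p 1 2 = b p * g 1 1"
      "?d * B p 2 1 = b p * - g 2 2"
      "?d * B p 2 2 = b p * g 1 2" for p
      subgoal using e(1)[of p] b_def[of p] unfolding g21 by algebra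
      subgoal using e(1)[of p] b_def[of p] unfolding g21 by algebra
      subgoal using e(2,3)[of p] unfolding g21 by algebra
      subgoal using e(2,3)[of p] unfolding g21 by algebra
      done
    have D': "?d \<noteq> 0" using D by linarith
    show False by (rule proportional_derivations_dependent[where B = B and b = b, OF ind D' c])
  qed
  have "\<exists>i j. g i j \<noteq> 0" using na by (auto simp: g_def add_eq_0_iff2)
  with symmetric_rank_one[of g] D g21 obtain e and a :: "2 \<Rightarrow> real"
    where a: "e \<noteq> 0" "a 1 \<noteq> 0 \<or> a 2 \<noteq> 0" "\<And>i j. g i j = e * a i * a j" by metis
  have n: "a 1 * a 1 + a 2 * a 2 \<noteq> 0" using a(2) by (simp add: sum_squares_eq_zero_iff)
  \<comment> \<open>Invariance of \<open>a \<otimes> a\<close> reads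
    \<open>c \<otimes> a + a \<otimes> c = 0\<close>, hence \<open>c = 0\<close>.\<close>
  have aB: "B p i 1 * a 1 + B p i 2 * a 2 = 0" for p i
  proof -
    define c where "c i = B p i 1 * a 1 + B p i 2 * a 2" for i
    have "e * (c i * a j + c j * a i) = 0" for i j
      using gB[of p i j] unfolding a(3) by (simp add: c_def algebra_simps)
    then have "c i * a j + c j * a i = 0" for i j using a(1) by simp
    from this[of 1 1] this[of 1 2] this[of 2 2] have "c 1 = 0" "c 2 = 0" using a(2) by auto
    then show ?thesis using exhaust_2[of i] by (auto simp: c_def)
  qed
  \<comment> \<open>\<open>v\<close> spans the kernel of \<open>a\<close>, so by \<open>aB\<close>
    every row of \<open>B p\<close> is a multiple of it.\<close>
  define v :: "2 \<Rightarrow> real" where "v l = (if l = 1 then - a 2 else a 1)" for l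
  define u where "u p i = (v 1 * B p i 1 + v 2 * B p i 2) / (a 1 * a 1 + a 2 * a 2)" for p i
  have B: "B p i l = u p i * v l" for p i l
  proof -
    have "B p i 1 * (a 1 * a 1 + a 2 * a 2) = (v 1 * B p i 1 + v 2 * B p i 2) * v 1"
      "B p i 2 * (a 1 * a 1 + a 2 * a 2) = (v 1 * B p i 1 + v 2 * B p i 2) * v 2"
      using aB[of p i] unfolding v_def by (simp_all, algebra+)
    then show ?thesis using n exhaust_2[of l] by (auto simp: u_def field_simps)
  qed
  \<comment> \<open>Independence of the two derivations passes to the vectors \<open>u 1\<close> and
    \<open>u 2\<close>; a linear form that vanishes on both is then zero, which is
    \<open>lin\<close>.\<close>
  have W: "u 1 1 * u 2 2 - u 1 2 * u 2 1 \<noteq> 0"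
  proof
    assume W: "u 1 1 * u 2 2 - u 1 2 * u 2 1 = 0"
    have "u 2 1 * B 1 i l + - u 1 1 * B 2 i l = 0" "u 2 2 * B 1 i l + - u 1 2 * B 2 i l = 0" for i l
      using W exhaust_2[of i] by (auto simp: B algebra_simps)
    from ind[OF this(1)] ind[OF this(2)] have "u p i = 0" for p i
      using exhaust_2[of p] exhaust_2[of i] by auto
    then show False using ind[of 1 0] by (simp add: B)
  qed
  have lin: "F 1 = 0 \<and> F 2 = 0" if "\<And>p. u p 1 * F 1 + u p 2 * F 2 = 0" for F :: "2 \<Rightarrow> real"
  proof -
    have "(u 1 1 * u 2 2 - u 1 2 * u 2 1) * F 1 = 0" "(u 1 1 * u 2 2 - u 1 2 * u 2 1) * F 2 = 0"
      using that[of 1] that[of 2] by algebra+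
    with W show ?thesis by simp
  qed
  \<comment> \<open>A derivation multiplies the alternating part of \<open>\<rho>\<close> by its
    trace, here \<open>u p 1 * v 1 + u p 2 * v 2\<close>, and this trace cannot vanish for both
    \<open>p\<close>.\<close>
  have "(\<rho> 1 2 - \<rho> 2 1) * v 1 = 0 \<and> (\<rho> 1 2 - \<rho> 2 1) * v 2 = 0"
  proof (rule lin[of "\<lambda>l. (\<rho> 1 2 - \<rho> 2 1) * v l"])
    fix p
    show "u p 1 * ((\<rho> 1 2 - \<rho> 2 1) * v 1) + u p 2 * ((\<rho> 1 2 - \<rho> 2 1) * v 2) = 0"
      using \<rho>[of p 1 2] \<rho>[of p 2 1] by (simp add: sum_2 B algebra_simps)
  qed
  then have "\<rho> 1 2 = \<rho> 2 1" using a(2) by (auto simp: v_def)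
  then have sym: "\<rho> i j = \<rho> j i" for i j using exhaust_2[of i] exhaust_2[of j] by auto
  then have \<rho>a: "\<rho> i j = (e / 2) * a i * a j" for i j
    using a(3)[of i j] by (simp add: g_def)
  \<comment> \<open>The contractions of \<open>T\<close> with \<open>v\<close> in its three slots;
    the aim is to show that they vanish.\<close>
  define P Q R where "P i j = v 1 * T 1 i j + v 2 * T 2 i j" and "Q k j = v 1 * T k 1 j + v 2 * T k 2 j"
    and "R k i = v 1 * T k i 1 + v 2 * T k i 2" for i j k
  define \<delta> :: "2 \<Rightarrow> 2 \<Rightarrow> real" where "\<delta> i j = (if i = j then 1 else 0)" for i j
  \<comment> \<open>Since \<open>u 1\<close> and \<open>u 2\<close> form a basis, the invariance of
    \<open>T\<close> also holds with the unit vectors, encoded by \<open>\<delta>\<close>, in place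
    of \<open>u p\<close>.\<close>
  have PQR: "\<delta> s k * P i j + \<delta> s i * Q k j + \<delta> s j * R k i = 0" for s k i j
  proof -
    have "u p k * P i j + u p i * Q k j + u p j * R k i = 0" for p
      using T[of p k i j] by (simp add: sum_2 B P_def Q_def R_def algebra_simps)
    moreover have uk: "u p k = u p 1 * \<delta> 1 k + u p 2 * \<delta> 2 k" for p k
      using exhaust_2[of k] by (auto simp: \<delta>_def)
    have "u p 1 * (\<delta> 1 k * P i j + \<delta> 1 i * Q k j + \<delta> 1 j * R k i)
       + u p 2 * (\<delta> 2 k * P i j + \<delta> 2 i * Q k j + \<delta> 2 j * R k i) = u p k * P i j + u p i * Q k j + u p j * R k i" for p
      unfolding uk[of p k] uk[of p i] uk[of p j] by (simp add: algebra_simps)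
    ultimately have "u p 1 * (\<delta> 1 k * P i j + \<delta> 1 i * Q k j + \<delta> 1 j * R k i)
       + u p 2 * (\<delta> 2 k * P i j + \<delta> 2 i * Q k j + \<delta> 2 j * R k i) = 0" for p
      by simp
    from lin[of "\<lambda>s. \<delta> s k * P i j + \<delta> s i * Q k j + \<delta> s j * R k i", OF this] show ?thesis
      using exhaust_2[of s] by auto
  qed
  have d: "\<delta> 1 1 = 1" "\<delta> 2 2 = 1" "\<delta> 1 2 = 0" "\<delta> 2 1 = 0" by (simp_all add: \<delta>_def)
  have 0: "P 2 2 = 0" "P 1 1 = 0" "Q 2 2 = 0" "Q 1 1 = 0" "R 2 2 = 0" "R 1 1 = 0"
    using PQR[of 1 1 2 2] PQR[of 2 2 1 1] PQR[of 1 2 1 2] PQR[of 2 1 2 1] PQR[of 1 2 2 1] PQR[of 2 1 1 2]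
    by (simp_all add: d)
  have 1: "Q 1 2 = - P 1 2" "R 1 2 = - P 2 1" "Q 2 1 = - P 2 1" "R 2 1 = - P 1 2" "R 1 2 = - Q 1 2" "R 2 1 = - Q 2 1"
    using PQR[of 1 1 1 2] PQR[of 1 1 2 1] PQR[of 2 2 2 1] PQR[of 2 2 1 2] PQR[of 2 1 2 2] PQR[of 1 2 1 1]
    by (simp_all add: d)
  \<comment> \<open>Contracting the first two slots with \<open>v\<close> gives the same result in
    either order; this disposes of the components \<open>P 1 2\<close> and \<open>P 2 1\<close> left
    open by \<open>PQR\<close>.\<close>
  have "v 1 * P 1 j + v 2 * P 2 j = v 1 * Q 1 j + v 2 * Q 2 j" for j
    by (simp add: P_def Q_def algebra_simps)
  from this[of 1] this[of 2] have "v 2 * P 2 1 = 0" "v 1 * P 1 2 = 0"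
    using 0 1 by simp_all
  moreover have "P 2 1 = - P 1 2" using 1 by simp
  ultimately have "P 1 2 = 0" "P 2 1 = 0" using a(2) by (auto simp: v_def)
  with 0 1 have z: "P i j = 0" "Q i j = 0" "R i j = 0" for i j
    using exhaust_2[of i] exhaust_2[of j] by auto
  have "\<exists>t. \<forall>k i j. T k i j = t * a k * a i * a j"
  proof (rule cubic_of_contractions[OF a(2)])
    fix i j
    show "a 1 * T 2 i j = a 2 * T 1 i j" "a 1 * T i 2 j = a 2 * T i 1 j" "a 1 * T i j 2 = a 2 * T i j 1"
      using z[of i j] by (simp_all add: P_def Q_def R_def v_def)
  qed
  with a(1,2) \<rho>a show ?thesis unfolding cubic_type_def by (metis divide_eq_0_iff zero_neq_numeral)
qed

section \<open>Linear algebra of Killing germs\<close>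

lemma differentiable_coord: "(\<lambda>x::real^2. x $ i) differentiable (at x)"
  by (simp add: bounded_linear_imp_differentiable bounded_linear_vec_nth)

lemma kill_near_differentiable:
  assumes "kill_near \<Gamma> x X"
  shows "(\<lambda>y. X y $ k) differentiable (at x)"
  using assms smooth_on_differentiable by (auto simp: kill_near_def killing_on_def smooth_map_on_def)

lemma kill_near_lincomb:
  assumes "kill_near \<Gamma> x X" "kill_near \<Gamma> x Y"
  shows "kill_near \<Gamma> x (\<lambda>z. a *\<^sub>R X z + b *\<^sub>R Y z)"
proof -
  obtain M where M: "open M" "x \<in> M" "smooth_conn_on M \<Gamma>" "killing_on \<Gamma> M X"
    using assms(1) by (auto simp: kill_near_def)
  obtain N where N: "open N" "x \<in> N" "N \<subseteq> M" "smooth_conn_on N \<Gamma>" "killing_on \<Gamma> N Y"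
    using kill_near_subset[OF assms(2) M(1,2)] by metis
  have K: "killing_on \<Gamma> N X" by (rule killing_on_subset[OF M(4,1,3) N(1,3)])
  have X: "smooth_on N (\<lambda>y. X y $ k)" and Y: "smooth_on N (\<lambda>y. Y y $ k)"
    and LX: "z \<in> N \<Longrightarrow> lie_conn \<Gamma> X i j k z = 0" and LY: "z \<in> N \<Longrightarrow> lie_conn \<Gamma> Y i j k z = 0" for i j k z
    using K N(5) unfolding killing_on_iff_lie_conn[OF N(1,4)] smooth_map_on_def by auto
  have dX: "(\<lambda>y. X y $ k) differentiable (at z)" "pdc i X k differentiable (at z)"
    and dY: "(\<lambda>y. Y y $ k) differentiable (at z)" "pdc i Y k differentiable (at z)" if "z \<in> N" for i k z
    using X Y smooth_on_pd smooth_on_differentiable[OF _ N(1) that] by blast+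
  have p1: "pd i (\<lambda>y. a * X y $ k + b * Y y $ k) z = a * pdc i X k z + b * pdc i Y k z" if "z \<in> N" for i k z
    by (simp add: pd_add pd_cmult dX dY that differentiable_mult)
  have p2: "pd i (pd j (\<lambda>y. a * X y $ k + b * Y y $ k)) z = a * pd i (pdc j X k) z + b * pd i (pdc j Y k) z" if "z \<in> N" for i j k z
    by (subst pd_cong_open[OF N(1) that p1]) (simp_all add: pd_add pd_cmult dX dY that differentiable_mult)
  have "killing_on \<Gamma> N (\<lambda>z. a *\<^sub>R X z + b *\<^sub>R Y z)"
    unfolding killing_on_iff_lie_conn[OF N(1,4)]
  proof (intro conjI ballI allI)
    show "smooth_map_on N (\<lambda>z. a *\<^sub>R X z + b *\<^sub>R Y z)"
      using X Y by (auto simp: smooth_map_on_def intro!: smooth_on_add smooth_on_mult smooth_on_const N(1))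
    fix z i j k assume z: "z \<in> N"
    have "lie_conn \<Gamma> (\<lambda>z. a *\<^sub>R X z + b *\<^sub>R Y z) i j k z = a * lie_conn \<Gamma> X i j k z + b * lie_conn \<Gamma> Y i j k z"
      by (simp add: lie_conn_def sum_2 p1 p2 z algebra_simps)
    then show "lie_conn \<Gamma> (\<lambda>z. a *\<^sub>R X z + b *\<^sub>R Y z) i j k z = 0" using LX LY z by simp
  qed
  with N show ?thesis unfolding kill_near_def by blast
qed

lemma kill_near_sum:
  assumes "\<And>m. m < n \<Longrightarrow> kill_near \<Gamma> x (X m)" "0 < (n::nat)"
  shows "kill_near \<Gamma> x (\<lambda>z. \<Sum>m<n. a m *\<^sub>R X m z)"
  using assms
proof (induction n)
  case (Suc n)
  show ?case
  proof (cases "n = 0")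
    case True
    then show ?thesis using kill_near_lincomb[of \<Gamma> x "X 0" "X 0" "a 0" 0] Suc.prems by simp
  next
    case False
    then have "kill_near \<Gamma> x (\<lambda>z. \<Sum>m<n. a m *\<^sub>R X m z)" using Suc by simp
    from kill_near_lincomb[OF this Suc.prems(1)[of n], of 1 "a n"] show ?thesis by simp
  qed
qed simp

text \<open>The minors \<open>c\<close> are the coefficients of a relation. If all of them vanish,
  either \<open>p 0\<close> is zero or \<open>p 0\<close> and \<open>p 1\<close> are
  proportional.\<close>

lemma three_vectors_dependent:
  fixes p :: "nat \<Rightarrow> real^2"
  shows "\<exists>a :: nat \<Rightarrow> real. (\<exists>m<3. a m \<noteq> 0) \<and> (\<Sum>m<3. a m *\<^sub>R p m) = 0"
proof -
  define c where "c m n = p m $ 1 * p n $ 2 - p m $ 2 * p n $ 1" for m n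
  have S: "(\<Sum>m<3. f m) = f 0 + f 1 + f (2::nat)" for f :: "nat \<Rightarrow> real^2"
    by (simp add: eval_nat_numeral)
  have E: "(\<exists>m<3. P m) \<longleftrightarrow> P 0 \<or> P 1 \<or> P (2::nat)" for P
    by (auto simp: eval_nat_numeral less_Suc_eq)
  consider "c 1 2 \<noteq> 0 \<or> c 2 0 \<noteq> 0 \<or> c 0 1 \<noteq> 0" | "p 0 = 0" | i where "p 0 $ i \<noteq> 0" "c 0 1 = 0"
    by (auto simp: vec_eq_iff)
  then show ?thesis
  proof cases
    case 1
    have "c 1 2 *\<^sub>R p 0 + c 2 0 *\<^sub>R p 1 + c 0 1 *\<^sub>R p 2 = 0"
      by (simp add: vec_eq_iff forall_2 c_def algebra_simps)
    then show ?thesis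
      by (intro exI[of _ "\<lambda>m. if m = 0 then c 1 2 else if m = 1 then c 2 0 else c 0 1"]) (use 1 in \<open>auto simp: S E\<close>)
  next
    case 2
    show ?thesis by (rule exI[of _ "\<lambda>m. if m = 0 then 1 else 0"]) (simp add: S E 2)
  next
    case (3 i)
    have "p 1 $ i *\<^sub>R p 0 + (- p 0 $ i) *\<^sub>R p 1 = 0"
      using 3(2) exhaust_2[of i] by (auto simp: vec_eq_iff forall_2 c_def algebra_simps)
    then show ?thesis
      by (intro exI[of _ "\<lambda>m. if m = 0 then p 1 $ i else if m = 1 then - p 0 $ i else 0"]) (use 3(1) in \<open>auto simp: S E\<close>)
  qed
qed

text \<open>After a relation that involves \<open>p i\<close>, a second one is found with
  \<open>p 3\<close> substituted for \<open>p i\<close>. It has no entry at \<open>i\<close> and is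
  therefore independent of the first.\<close>

lemma four_vectors_two_relations:
  fixes p :: "nat \<Rightarrow> real^2"
  shows "\<exists>a b :: nat \<Rightarrow> real. (\<Sum>m<4. a m *\<^sub>R p m) = 0 \<and> (\<Sum>m<4. b m *\<^sub>R p m) = 0 \<and>
    (\<forall>x y. (\<forall>m<4. x * a m + y * b m = 0) \<longrightarrow> x = 0 \<and> y = 0)"
proof -
  have S3: "(\<Sum>m<3. f m) = f 0 + f 1 + f (2::nat)" and S4: "(\<Sum>m<4. f m) = f 0 + f 1 + f 2 + f (3::nat)" for f :: "nat \<Rightarrow> real^2"
    by (simp_all add: eval_nat_numeral)
  obtain a :: "nat \<Rightarrow> real" and i where a: "i < 3" "a i \<noteq> 0" "(\<Sum>m<3. a m *\<^sub>R p m) = 0"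
    using three_vectors_dependent[of p] by blast
  obtain b :: "nat \<Rightarrow> real" and j where b: "j < 3" "b j \<noteq> 0" "(\<Sum>m<3. b m *\<^sub>R p (if m = i then 3 else m)) = 0"
    using three_vectors_dependent[of "\<lambda>m. p (if m = i then 3 else m)"] by blast
  have i: "i = 0 \<or> i = 1 \<or> i = 2" and j: "j = 0 \<or> j = 1 \<or> j = 2" using a(1) b(1) by auto
  show ?thesis
  proof (rule exI[of _ "\<lambda>m. if m = 3 then 0 else a m"], rule exI[of _ "\<lambda>m. if m = 3 then b i else if m = i then 0 else b m"],
      intro conjI allI impI)
    show "(\<Sum>m<4. (if m = 3 then 0 else a m) *\<^sub>R p m) = 0" using a(3) by (simp add: S3 S4)
    show "(\<Sum>m<4. (if m = 3 then b i else if m = i then 0 else b m) *\<^sub>R p m) = 0"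
      using b(3) i by (auto simp: S3 S4 add_ac)
    fix x y :: real
    assume *: "\<forall>m<4. x * (if m = 3 then 0 else a m) + y * (if m = 3 then b i else if m = i then 0 else b m) = 0"
    from *[rule_format, of i] a(1,2) show "x = 0" by auto
    then show "y = 0"
      using *[rule_format, of 3] *[rule_format, of j] b(1,2) by (cases "j = i") auto
  qed
qed

text \<open>The trace-free matrices with a given non-zero \<open>\<tau>\<close> in their kernel form
  a line, spanned by a nilpotent matrix, so they contain no plane.\<close>

lemma isotropy_plane_alternating:
  fixes \<tau> :: "2 \<Rightarrow> real" and B :: "2 \<Rightarrow> 2 \<Rightarrow> 2 \<Rightarrow> real"
  assumes ind: "\<And>x y. (\<And>i l. x * B 1 i l + y * B 2 i l = 0) \<Longrightarrow> x = 0 \<and> y = 0"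
    and tr: "\<And>p. B p 1 1 + B p 2 2 = 0" and \<tau>: "\<And>p k. B p k 1 * \<tau> 1 + B p k 2 * \<tau> 2 = 0"
  shows "\<tau> 1 = 0 \<and> \<tau> 2 = 0"
proof (rule ccontr)
  assume "\<not> ?thesis"
  then have n: "\<tau> 1 * \<tau> 1 + \<tau> 2 * \<tau> 2 \<noteq> 0" by (simp add: sum_squares_eq_zero_iff)
  define b where "b p = B p 1 2 - B p 2 1" for p
  let ?d = "\<tau> 1 * \<tau> 1 + \<tau> 2 * \<tau> 2"
  have c: "?d * B p 1 1 = b p * (- \<tau> 1 * \<tau> 2)"
    "?d * B p 1 2 = b p * (\<tau> 1 * \<tau> 1)"
    "?d * B p 2 1 = b p * (- \<tau> 2 * \<tau> 2)"
    "?d * B p 2 2 = b p * (\<tau> 1 * \<tau> 2)" for p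
    using tr[of p] \<tau>[of p 1] \<tau>[of p 2] unfolding b_def by algebra+
  show False by (rule proportional_derivations_dependent[where B = B and b = b, OF ind n c])
qed

section \<open>Type B connections\<close>

locale type_B_conn =
  fixes \<Gamma> :: christoffel and S :: "(real^2) set" and C :: "2 \<Rightarrow> 2 \<Rightarrow> 2 \<Rightarrow> real"
  assumes open_S: "open S" and x1: "\<And>x. x \<in> S \<Longrightarrow> x $ 1 \<noteq> 0"
    and \<Gamma>: "\<And>x i j k. x \<in> S \<Longrightarrow> \<Gamma> i j k x = inverse (x $ 1) * C i j k"
    and C_sym: "\<And>i j k. C i j k = C j i k"
begin

lemma smooth_\<Gamma>: "smooth_conn_on S \<Gamma>"
  unfolding smooth_conn_on_def
proof (intro allI)
  fix i j k
  have "smooth_on S (\<lambda>x. inverse (x $ 1) * C i j k)"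
    by (intro smooth_on_mult smooth_on_inverse smooth_on_const smooth_on_coord open_S x1)
  then show "smooth_on S (\<Gamma> i j k)"
    using smooth_on_cong[OF open_S, of "\<Gamma> i j k" "\<lambda>x. inverse (x $ 1) * C i j k"] \<Gamma> by simp
qed

lemma pd_inverse_power:
  assumes "x \<in> S"
  shows "pd m (\<lambda>x. inverse (x $ 1) ^ n * a) x = (if m = 1 then - real n * inverse (x $ 1) ^ Suc n * a else 0)"
proof -
  have "((\<lambda>t. inverse t ^ n * a) has_real_derivative - real n * inverse (x $ 1) ^ Suc n * a) (at (x $ 1))"
    by (rule DERIV_cong[OF DERIV_cmult_right[OF DERIV_power[OF DERIV_inverse[OF x1[OF assms]]], of n a]])
      (cases n; simp add: power2_eq_square algebra_simps)
  from pd_real_comp[OF differentiable_coord this, of m] show ?thesis by simp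
qed

lemma pd_\<Gamma>:
  assumes "x \<in> S"
  shows "pd m (\<Gamma> i j k) x = (if m = 1 then - (inverse (x $ 1) ^ 2 * C i j k) else 0)"
proof -
  have "pd m (\<Gamma> i j k) x = pd m (\<lambda>x. inverse (x $ 1) ^ 1 * C i j k) x"
    by (rule pd_cong_open[OF open_S assms]) (simp add: \<Gamma>)
  then show ?thesis by (simp only: pd_inverse_power[OF assms]) (simp add: numeral_2_eq_2)
qed

text \<open>\<open>r\<close>, \<open>\<rho>\<close> and \<open>T\<close> are the constant
  coefficients of curvature, Ricci tensor and its covariant derivative, which are homogeneous in
  \<open>x $ 1\<close> of degrees -2, -2 and -3. The two conditional terms of \<open>r\<close> are
  the derivatives of the symbols.\<close>

definition r where "r m i j k = (if i = 1 then C m j k else 0) - (if m = 1 then C i j k else 0)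
  + (\<Sum>l\<in>UNIV. C m l k * C i j l - C i l k * C m j l)"

definition \<rho> where "\<rho> i j = (\<Sum>k\<in>UNIV. r k i j k)"

definition T where "T k i j = - (if k = 1 then 2 * \<rho> i j else 0)
  - (\<Sum>l\<in>UNIV. C k i l * \<rho> l j) - (\<Sum>l\<in>UNIV. C k j l * \<rho> i l)"

lemma riem_eq: "x \<in> S \<Longrightarrow> riem \<Gamma> m i j k x = inverse (x $ 1) ^ 2 * r m i j k"
  by (simp add: riem_def r_def pd_\<Gamma> \<Gamma> sum_2 power2_eq_square algebra_simps)

lemma ricci_eq: "x \<in> S \<Longrightarrow> ricci \<Gamma> i j x = inverse (x $ 1) ^ 2 * \<rho> i j"
  by (simp add: ricci_eq_riem riem_eq \<rho>_def sum_distrib_left)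

lemma nabla_ricci_eq:
  assumes "x \<in> S"
  shows "nabla_ricci \<Gamma> k i j x = inverse (x $ 1) ^ 3 * T k i j"
proof -
  have "pd k (ricci \<Gamma> i j) x = pd k (\<lambda>x. inverse (x $ 1) ^ 2 * \<rho> i j) x"
    by (rule pd_cong_open[OF open_S assms]) (simp add: ricci_eq)
  then have "pd k (ricci \<Gamma> i j) x = (if k = 1 then - 2 * inverse (x $ 1) ^ 3 * \<rho> i j else 0)"
    by (simp only: pd_inverse_power[OF assms]) (simp add: numeral_3_eq_3 numeral_2_eq_2)
  then show ?thesis
    by (simp add: nabla_tensor2_def T_def ricci_eq[OF assms] \<Gamma>[OF assms] sum_2 power2_eq_square power3_eq_cube algebra_simps)
qed

text \<open>Up to sign, the alternating part of the Ricci tensor is the exterior derivative of the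
  trace form of \<Gamma>. As this depends on \<open>x $ 1\<close> only, just its second component
  contributes, with coefficient \<open>C 2 1 1 + C 2 2 2\<close>.\<close>

lemma \<rho>_alt: "\<rho> 1 2 - \<rho> 2 1 = C 1 2 1 + C 2 2 2"
  by (simp add: \<rho>_def r_def sum_2 C_sym[of 2 1] algebra_simps)

lemma cubic_type_imp:
  assumes "x \<in> S" "cubic_at \<Gamma> x"
  shows "C 1 2 1 = 0 \<and> C 2 2 1 = 0 \<and> C 2 2 2 = 0"
proof -
  define q where "q = inverse (x $ 1)"
  have q: "q \<noteq> 0" using x1[OF assms(1)] by (simp add: q_def)
  obtain e and a :: "2 \<Rightarrow> real" and t where *: "e \<noteq> 0" "a 1 \<noteq> 0 \<or> a 2 \<noteq> 0"
    "\<And>i j. q ^ 2 * \<rho> i j = e * a i * a j" "\<And>k i j. q ^ 3 * T k i j = t * a k * a i * a j"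
    using assms(2) unfolding cubic_at_def cubic_type_def ricci_eq[OF assms(1)] nabla_ricci_eq[OF assms(1)] q_def[symmetric] by blast
  define d s where "d = e / q ^ 2" and "s = t / q ^ 3"
  have d: "d \<noteq> 0" using *(1) q by (simp add: d_def)
  have \<rho>: "\<rho> i j = d * a i * a j" for i j using *(3)[of i j] q by (simp add: d_def field_simps)
  have T: "T k i j = s * a k * a i * a j" for k i j using *(4)[of k i j] q by (simp add: s_def field_simps)
  define A where "A k i = C k i 1 * a 1 + C k i 2 * a 2" for k i
  have A_sym: "A k i = A i k" for k i by (simp add: A_def C_sym[of k i])
  define c :: "2 \<Rightarrow> real" where "c k = (if k = 1 then 1 else 0)" for k
  \<comment> \<open>This is \<nabla>\<rho> for \<open>\<rho> = d a \<otimes> a\<close>: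
    \<open>c\<close> stems from the factor of degree -2, and \<open>A\<close> collects the
    Christoffel terms.\<close>
  have E: "s * a k * a i * a j = - d * (c k * (2 * a i * a j) + A k i * a j + A k j * a i)" for k i j
    unfolding T[symmetric] T_def \<rho> by (simp add: sum_2 A_def c_def algebra_simps)
  \<comment> \<open>\<open>F\<close> measures how far the kernel of \<open>a\<close> is from being
    parallel. Contracting \<open>E\<close> with the kernel vector in slot \<open>k\<close> gives
    \<open>F i = a 2 * a i\<close>, contracting in slot \<open>i\<close> gives \<open>F = 0\<close>;
    together they yield \<open>a 2 = 0\<close>.\<close>
  define F where "F i = a 1 * A 2 i - a 2 * A 1 i" for i
  have "d * (F i * a j + F j * a i) = d * (2 * a 2 * a i * a j)" for i j
    using E[of 1 i j] E[of 2 i j] unfolding F_def c_def by simp algebra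
  then have FF: "F i * a j + F j * a i = 2 * a 2 * a i * a j" for i j using d by simp
  have F: "F i = a 2 * a i" for i
    using FF[of 1 1] FF[of 1 2] FF[of 2 2] *(2) exhaust_2[of i]
    by (cases "a 1 = 0"; cases "a 2 = 0") (auto simp: algebra_simps)
  have "s * a k * (a 1 * a 2 - a 2 * a 1) * a j = - d * ((a 1 * A k 2 - a 2 * A k 1) * a j)" for k j
    using E[of k 1 j] E[of k 2 j] by algebra
  moreover have "a 1 * A k 2 - a 2 * A k 1 = F k" for k
    unfolding F_def A_sym[of k 1] A_sym[of k 2] ..
  ultimately have "d * F k * a j = 0" for k j by simp
  then have "F k = 0" for k using d *(2) by (metis mult_eq_0_iff)
  with F have "a 2 = 0" using *(2) by (metis mult_eq_0_iff)
  with \<open>\<And>k. F k = 0\<close> *(2) have A0: "A 2 i = 0" for i by (auto simp: F_def)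
  from A0[of 1] A0[of 2] \<open>a 2 = 0\<close> *(2) have C0: "C 1 2 1 = 0" "C 2 2 1 = 0"
    using C_sym[of 2 1 1] by (auto simp: A_def)
  \<comment> \<open>With \<open>a 2 = 0\<close> the coefficient \<open>C 2 2 2\<close> drops out of
    \<open>A\<close>; the symmetry of \<open>\<rho>\<close> recovers it through
    \<open>\<rho>_alt\<close>.\<close>
  moreover have "\<rho> 1 2 = \<rho> 2 1" by (simp add: \<rho>)
  ultimately show ?thesis using \<rho>_alt by simp
qed

text \<open>Translations in \<open>x $ 2\<close> and dilations preserve every Type B connection, and
  the bracket of their fields is the translation field.\<close>

lemma noncommuting:
  assumes x: "x \<in> S"
  shows "\<exists>X Y. kill_near \<Gamma> x X \<and> kill_near \<Gamma> x Y \<and> bracket X Y x \<noteq> 0"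
proof (intro exI conjI)
  let ?X = "\<lambda>z::real^2. axis 2 1 :: real^2" and ?Y = "\<lambda>z::real^2. z"
  have cc: "pd i (\<lambda>z::real^2. z $ k) = (\<lambda>_. if i = k then 1 else 0)" for i k
    by (simp add: fun_eq_iff)
  have c0: "pd i (\<lambda>z::real^2. c) = (\<lambda>_. 0)" for i c by (simp add: fun_eq_iff)
  have "killing_on \<Gamma> S ?X"
    unfolding killing_on_iff_lie_conn[OF open_S smooth_\<Gamma>]
    by (auto simp: smooth_map_on_def smooth_on_const lie_conn_def c0 sum_2 pd_\<Gamma>) (simp add: axis_def)
  then show "kill_near \<Gamma> x ?X" using open_S x smooth_\<Gamma> unfolding kill_near_def by blast
  have "killing_on \<Gamma> S ?Y"
    unfolding killing_on_iff_lie_conn[OF open_S smooth_\<Gamma>]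
  proof (intro conjI ballI allI)
    show "smooth_map_on S ?Y" by (simp add: smooth_map_on_def smooth_on_coord)
    fix z i j k assume z: "z \<in> S"
    show "lie_conn \<Gamma> ?Y i j k z = 0"
      using exhaust_2[of i] exhaust_2[of j] exhaust_2[of k] x1[OF z]
      by (auto simp: lie_conn_def cc c0 sum_2 pd_\<Gamma>[OF z] \<Gamma>[OF z] power2_eq_square)
  qed
  then show "kill_near \<Gamma> x ?Y" using open_S x smooth_\<Gamma> unfolding kill_near_def by blast
  show "bracket ?X ?Y x \<noteq> 0"
    by (simp add: bracket_def vec_eq_iff forall_2 sum_2 axis_def)
qed

lemma killing_dim_imp_cubic:
  assumes x: "x \<in> S" and dim: "killing_dim_at \<Gamma> x 4" and nz: "\<exists>i j. ricci \<Gamma> i j x \<noteq> 0"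
  shows "cubic_at \<Gamma> x"
proof -
  obtain X :: "nat \<Rightarrow> vfield" where X: "\<And>m. m < 4 \<Longrightarrow> kill_near \<Gamma> x (X m)"
    "\<And>a. \<forall>\<^sub>F z in nhds x. (\<Sum>m<4. a m *\<^sub>R X m z) = 0 \<Longrightarrow> \<forall>m<4. a m = 0"
    using dim unfolding killing_dim_at_def by blast
  \<comment> \<open>Two independent relations between the four values at \<open>x\<close> are two
    independent elements of the kernel of evaluation.\<close>
  obtain a b :: "nat \<Rightarrow> real" where ab: "(\<Sum>m<4. a m *\<^sub>R X m x) = 0" "(\<Sum>m<4. b m *\<^sub>R X m x) = 0"
    "\<forall>x y. (\<forall>m<4. x * a m + y * b m = 0) \<longrightarrow> x = 0 \<and> y = 0"
    using four_vectors_two_relations[of "\<lambda>m. X m x"] by auto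
  define Y where "Y p z = (\<Sum>m<4. (if p = 1 then a m else b m) *\<^sub>R X m z)" for p :: 2 and z
  have Y: "kill_near \<Gamma> x (Y p)" for p unfolding Y_def using X(1) by (intro kill_near_sum) auto
  have Y0: "Y p x = 0" for p using ab(1,2) by (cases "p = 1") (simp_all add: Y_def)
  define B where "B p i l = pd i (\<lambda>y. Y p y $ l) x" for p i l
  \<comment> \<open>A combination with vanishing linear part has vanishing 1-jet, so it is the zero
    germ, and independence of \<open>X\<close> applies.\<close>
  have ind: "u = 0 \<and> v = 0" if uv: "\<And>i l. u * B 1 i l + v * B 2 i l = 0" for u v
  proof (rule ab(3)[rule_format])
    fix m :: nat assume "m < 4"
    have "kill_near \<Gamma> x (\<lambda>z. u *\<^sub>R Y 1 z + v *\<^sub>R Y 2 z)" by (rule kill_near_lincomb[OF Y Y])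
    moreover have "pd i (\<lambda>y. (u *\<^sub>R Y 1 y + v *\<^sub>R Y 2 y) $ k) x = 0" for i k
      using uv[of i k] by (simp add: pd_add pd_cmult kill_near_differentiable[OF Y] differentiable_mult B_def)
    ultimately have "\<forall>\<^sub>F z in nhds x. u *\<^sub>R Y 1 z + v *\<^sub>R Y 2 z = 0"
      by (intro killing_unique) (auto simp: Y0)
    moreover have "u *\<^sub>R Y 1 z + v *\<^sub>R Y 2 z = (\<Sum>m<4. (u * a m + v * b m) *\<^sub>R X m z)" for z
      by (simp add: Y_def scaleR_sum_right scaleR_left_distrib sum.distrib)
    ultimately show "u * a m + v * b m = 0" using X(2)[of "\<lambda>m. u * a m + v * b m"] \<open>m < 4\<close> by simp
  qed
  have inv: "(\<Sum>l\<in>UNIV. B p i l * ricci \<Gamma> l j x + B p j l * ricci \<Gamma> i l x) = 0"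
    "(\<Sum>l\<in>UNIV. B p k l * nabla_ricci \<Gamma> l i j x + B p i l * nabla_ricci \<Gamma> k l j x
       + B p j l * nabla_ricci \<Gamma> k i l x) = 0" for p k i j
  proof -
    obtain N where N: "open N" "x \<in> N" "smooth_conn_on N \<Gamma>" "killing_on \<Gamma> N (Y p)"
      using Y[of p] by (auto simp: kill_near_def)
    have L: "y \<in> N \<Longrightarrow> lie_tensor2 (Y p) (ricci \<Gamma>) i j y = 0" for y i j
      by (rule lie_tensor2_ricci[OF N(1,3,4)])
    from L[OF N(2), of i j] show "(\<Sum>l\<in>UNIV. B p i l * ricci \<Gamma> l j x + B p j l * ricci \<Gamma> i l x) = 0"
      by (simp add: lie_tensor2_def Y0 B_def mult.commute)
    show "(\<Sum>l\<in>UNIV. B p k l * nabla_ricci \<Gamma> l i j x + B p i l * nabla_ricci \<Gamma> k l j x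
       + B p j l * nabla_ricci \<Gamma> k i l x) = 0"
      unfolding B_def by (rule isotropy_nabla_tensor2[OF N(1,3) smooth_on_ricci[OF N(1,3)] N(4,2) L Y0])
  qed
  \<comment> \<open>If \<open>\<rho>\<close> is an area form, its stabiliser consists of trace-free
    matrices. The covector \<open>T k 1 2\<close> is annihilated by a plane of them and must vanish,
    but its second component is \<open>- (C 1 2 1 + C 2 2 2) * \<rho> 1 2\<close>, which equals
    \<open>- 2 * \<rho> 1 2 * \<rho> 1 2\<close> by \<open>\<rho>_alt\<close>.\<close>
  have "\<not> (\<forall>i j. ricci \<Gamma> i j x = - ricci \<Gamma> j i x)"
  proof
    assume alt: "\<forall>i j. ricci \<Gamma> i j x = - ricci \<Gamma> j i x"
    define q where "q = inverse (x $ 1)"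
    have q: "q \<noteq> 0" using x1[OF x] by (simp add: q_def)
    have "q ^ 2 * \<rho> i j = q ^ 2 * (- \<rho> j i)" for i j
      using alt[rule_format, of i j] unfolding ricci_eq[OF x] by (simp add: q_def)
    then have \<rho>alt: "\<rho> i j = - \<rho> j i" for i j using q by (metis mult_left_cancel power_not_zero)
    have d0: "\<rho> 1 1 = 0" "\<rho> 2 2 = 0" "\<rho> 2 1 = - \<rho> 1 2" using \<rho>alt[of 1 1] \<rho>alt[of 2 2] \<rho>alt[of 2 1] by simp_all
    have "\<exists>i j. \<rho> i j \<noteq> 0" using nz ricci_eq[OF x] by auto
    then have ne: "\<rho> 1 2 \<noteq> 0" using d0 by (metis exhaust_2 neg_equal_0_iff_equal)
    have "q ^ 2 * (\<Sum>l\<in>UNIV. B p i l * \<rho> l j + B p j l * \<rho> i l) = 0" for p i j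
      using inv(1)[of p i j] by (simp add: ricci_eq[OF x] q_def sum_2 algebra_simps)
    then have I1: "(\<Sum>l\<in>UNIV. B p i l * \<rho> l j + B p j l * \<rho> i l) = 0" for p i j
      using q mult_eq_0_iff power_not_zero by blast
    have "(B p 1 1 + B p 2 2) * \<rho> 1 2 = 0" for p
      using I1[of p 1 2] d0 by (simp add: sum_2 algebra_simps)
    then have tr: "B p 1 1 + B p 2 2 = 0" for p using ne by simp
    have Talt: "T k 1 1 = 0" "T k 2 2 = 0" "T k 2 1 = - T k 1 2" for k
      unfolding T_def by (simp_all add: sum_2 d0)
    have "q ^ 3 * (\<Sum>l\<in>UNIV. B p k l * T l i j + B p i l * T k l j + B p j l * T k i l) = 0" for p k i j
      using inv(2)[of p k i j] by (simp add: nabla_ricci_eq[OF x] q_def sum_2 algebra_simps)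
    then have I2: "(\<Sum>l\<in>UNIV. B p k l * T l i j + B p i l * T k l j + B p j l * T k i l) = 0" for p k i j
      using q mult_eq_0_iff power_not_zero by blast
    have "B p k 1 * T 1 1 2 + B p k 2 * T 2 1 2 + (B p 1 1 + B p 2 2) * T k 1 2 = 0" for p k
      using I2[of p k 1 2] by (simp add: sum_2 Talt algebra_simps)
    then have "B p k 1 * T 1 1 2 + B p k 2 * T 2 1 2 = 0" for p k using tr by simp
    with isotropy_plane_alternating[of B "\<lambda>k. T k 1 2", OF ind tr] have "T 2 1 2 = 0" by blast
    then have "(C 1 2 1 + C 2 2 2) * \<rho> 1 2 = 0"
      by (simp add: T_def sum_2 d0 C_sym[of 2 1] algebra_simps)
    then show False using ne \<rho>_alt d0 by simp
  qed
  then show ?thesis unfolding cubic_at_def using isotropy_plane_cubic[of B "\<lambda>i j. ricci \<Gamma> i j x" "\<lambda>k i j. nabla_ricci \<Gamma> k i j x", OF ind inv] by blast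
qed

end

section \<open>Type A connections\<close>

text \<open>A trace-free \<open>M\<close> with \<open>M\<^sup>2 = - det M\<close> has eigenvalues \<open>\<plusminus>\<lambda>\<close>, so as a derivation on tensors with
  three slots it has eigenvalues \<open>\<plusminus>\<lambda>\<plusminus>\<lambda>\<plusminus>\<lambda> \<noteq> 0\<close>.\<close>

lemma derivation_injective:
  fixes M :: "2 \<Rightarrow> 2 \<Rightarrow> real" and G :: "2 \<Rightarrow> 2 \<Rightarrow> 2 \<Rightarrow> real"
  assumes tr: "M 2 2 = - M 1 1" and D: "M 1 1 * M 2 2 - M 1 2 * M 2 1 \<noteq> 0"
    and E: "\<And>i j k. (\<Sum>l\<in>UNIV. M i l * G l j k + M j l * G i l k - G i j l * M l k) = 0"
  shows "G i j k = 0"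
proof -
  define d where "d = M 1 1 * M 2 2 - M 1 2 * M 2 1"
  have sq: "(\<Sum>l\<in>UNIV. M i l * (\<Sum>m\<in>UNIV. M l m * f m)) = - d * f i" for i and f :: "2 \<Rightarrow> real"
    using exhaust_2[of i] by (auto simp: sum_2 d_def tr algebra_simps)
  define L where "L H i j k = (\<Sum>a\<in>UNIV. M i a * (\<Sum>b\<in>UNIV. M j b * H a b k))" for H :: "2 \<Rightarrow> 2 \<Rightarrow> 2 \<Rightarrow> real" and i j k
  \<comment> \<open>Write \<open>M1\<close>, \<open>M2\<close>, \<open>M3\<close> for the action of
    \<open>M\<close> on the three slots. The hypothesis says \<open>M1 + M2 = M3\<close> on
    \<open>G\<close>; multiplying by \<open>M1 + M2 + M3\<close> and using that \<open>M\<close>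
    squares to \<open>- d\<close> gives \<open>2 * M1 * M2 = d\<close>.\<close>
  have 1: "2 * L G i j k = d * G i j k" for i j k
  proof -
    define EE where "EE i j k = (\<Sum>l\<in>UNIV. M i l * G l j k + M j l * G i l k - G i j l * M l k)" for i j k
    have "2 * L G i j k - d * G i j k = (\<Sum>l\<in>UNIV. M i l * EE l j k + M j l * EE i l k + EE i j l * M l k)"
    proof -
      have "i = 1 \<or> i = 2" "j = 1 \<or> j = 2" "k = 1 \<or> k = 2" by (rule exhaust_2)+
      then show ?thesis
        by (elim disjE; simp add: EE_def L_def d_def tr sum_2; simp add: algebra_simps)
    qed
    then show ?thesis using E by (simp add: EE_def)
  qed
  \<comment> \<open>Here \<open>L\<close> is \<open>M1 * M2\<close>, whose square is
    \<open>d * d\<close> directly, whereas \<open>1\<close> applied twice says that four times its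
    square is \<open>d * d\<close>.\<close>
  have "L (L G) i j k = d * d * G i j k" for i j k
  proof -
    have "L (L G) i j k = (\<Sum>a\<in>UNIV. M i a * (\<Sum>c\<in>UNIV. M a c * (\<Sum>b\<in>UNIV. M j b * (\<Sum>e\<in>UNIV. M b e * G c e k))))"
      by (simp add: L_def sum_2 algebra_simps)
    also have "\<dots> = d * d * G i j k" by (simp only: sq)
    finally show ?thesis .
  qed
  moreover have "2 * (2 * L (L G) i j k) = d * (d * G i j k)" for i j k
  proof -
    have "2 * L (L G) i j k = L (\<lambda>i j k. 2 * L G i j k) i j k" by (simp add: L_def sum_2 algebra_simps)
    also have "\<dots> = d * L G i j k" unfolding 1 by (simp add: L_def sum_2 algebra_simps)
    finally have "2 * (2 * L (L G) i j k) = d * (2 * L G i j k)" by simp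
    then show ?thesis unfolding 1 .
  qed
  ultimately have "4 * (d * d * G i j k) = d * d * G i j k" by (simp add: algebra_simps)
  then have "d * d * G i j k = 0" by linarith
  then show ?thesis using D by (simp add: d_def)
qed

locale type_A_conn =
  fixes \<Gamma> :: christoffel and S :: "(real^2) set" and A :: "2 \<Rightarrow> 2 \<Rightarrow> 2 \<Rightarrow> real"
  assumes open_S: "open S"
    and \<Gamma>: "\<And>x i j k. x \<in> S \<Longrightarrow> \<Gamma> i j k x = A i j k"
    and A_sym: "\<And>i j k. A i j k = A j i k"
begin

lemma smooth_\<Gamma>: "smooth_conn_on S \<Gamma>"
  unfolding smooth_conn_on_def
proof (intro allI)
  fix i j k
  show "smooth_on S (\<Gamma> i j k)"
    using smooth_on_cong[OF open_S, of "\<Gamma> i j k" "\<lambda>_. A i j k"] \<Gamma> by (simp add: smooth_on_const)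
qed

lemma pd_\<Gamma>: "x \<in> S \<Longrightarrow> pd m (\<Gamma> i j k) x = 0"
  using pd_cong_open[OF open_S, of x "\<Gamma> i j k" "\<lambda>_. A i j k" m] \<Gamma> by simp

definition r where "r m i j k = (\<Sum>l\<in>UNIV. A m l k * A i j l - A i l k * A m j l)"

definition \<rho> where "\<rho> i j = (\<Sum>k\<in>UNIV. r k i j k)"

definition T where "T k i j = - (\<Sum>l\<in>UNIV. A k i l * \<rho> l j) - (\<Sum>l\<in>UNIV. A k j l * \<rho> i l)"

lemma ricci_eq: "x \<in> S \<Longrightarrow> ricci \<Gamma> i j x = \<rho> i j"
  by (simp add: ricci_eq_riem riem_def r_def pd_\<Gamma> \<Gamma> \<rho>_def)

lemma pd_ricci: "x \<in> S \<Longrightarrow> pd m (ricci \<Gamma> i j) x = 0"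
  using pd_cong_open[OF open_S, of x "ricci \<Gamma> i j" "\<lambda>_. \<rho> i j" m] ricci_eq by simp

lemma nabla_ricci_eq: "x \<in> S \<Longrightarrow> nabla_ricci \<Gamma> k i j x = T k i j"
  by (simp add: nabla_tensor2_def pd_ricci T_def \<Gamma> ricci_eq)

lemma \<rho>_sym: "\<rho> i j = \<rho> j i"
  using exhaust_2[of i] exhaust_2[of j] by (auto simp: \<rho>_def r_def sum_2 A_sym[of 2 1] algebra_simps)

text \<open>A polynomial identity in the constants \<open>A\<close>. Geometrically, connections with
  constant symbols are projectively flat, which for a symmetric Ricci tensor in dimension two is the
  Codazzi equation.\<close>

lemma T_sym: "T i j k = T j i k"
  using exhaust_2[of i] exhaust_2[of j] exhaust_2[of k]
  by (auto simp: T_def \<rho>_def r_def sum_2 A_sym[of 2 1] algebra_simps)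

lemma singular_cubic:
  assumes x: "x \<in> S" and det: "\<rho> 1 1 * \<rho> 2 2 = \<rho> 1 2 * \<rho> 2 1" and nz: "\<exists>i j. ricci \<Gamma> i j x \<noteq> 0"
  shows "cubic_at \<Gamma> x"
proof -
  obtain e and a :: "2 \<Rightarrow> real" where a: "e \<noteq> 0" "a 1 \<noteq> 0 \<or> a 2 \<noteq> 0" "\<And>i j. \<rho> i j = e * a i * a j"
    using symmetric_rank_one[OF \<rho>_sym det] nz ricci_eq[OF x] by auto
  define s where "s k i = A k i 1 * a 1 + A k i 2 * a 2" for k i
  have s_sym: "s k i = s i k" for k i by (simp add: s_def A_sym[of k i])
  have T: "T k i j = - e * (s k i * a j + s k j * a i)" for k i j
    unfolding T_def a(3) by (simp add: sum_2 s_def algebra_simps)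
  \<comment> \<open>Interchanging the first two slots of \<open>T\<close> shows that
    \<open>s\<close> is proportional to \<open>a\<close> in its first index, hence by symmetry also
    in its second.\<close>
  have "e * (s 2 j * a 1) = e * (s 1 j * a 2)" for j
    using T_sym[of 2 1 j] s_sym[of 1 2] unfolding T by algebra
  then have "s 2 j * a 1 = s 1 j * a 2" for j using a(1) mult_left_cancel by blast
  then have s: "a 1 * s 2 j = a 2 * s 1 j" for j by (simp only: mult.commute)
  have s': "a 1 * s j 2 = a 2 * s j 1" for j using s[of j] s_sym[of j] by simp
  have "\<exists>t. \<forall>k i j. T k i j = t * a k * a i * a j"
  proof (rule cubic_of_contractions[OF a(2)])
    fix i j
    show "a 1 * T 2 i j = a 2 * T 1 i j" unfolding T using s[of i] s[of j] by algebra
    show "a 1 * T i 2 j = a 2 * T i 1 j" unfolding T using s'[of i] by algebra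
    show "a 1 * T i j 2 = a 2 * T i j 1" unfolding T using s'[of i] by algebra
  qed
  with a show ?thesis unfolding cubic_at_def cubic_type_def ricci_eq[OF x] nabla_ricci_eq[OF x] by blast
qed

text \<open>The constant non-degenerate \<open>\<rho>\<close> plays the role of a flat metric, so
  second derivatives of \<open>X\<close> vanish at \<open>x\<close>. The linear part of
  \<open>X\<close> then annihilates the constants \<open>A\<close>; if it were non-zero, it would be
  trace-free and invertible, forcing \<open>A = 0\<close> and \<open>\<rho> = 0\<close>.\<close>

lemma regular_killing_constant:
  assumes x: "x \<in> S" and det: "\<rho> 1 1 * \<rho> 2 2 \<noteq> \<rho> 1 2 * \<rho> 2 1" and X: "kill_near \<Gamma> x X"
  shows "pdc i X k x = 0"
proof -
  obtain N where N: "open N" "x \<in> N" "N \<subseteq> S" "smooth_conn_on N \<Gamma>" "killing_on \<Gamma> N X"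
    using kill_near_subset[OF X open_S x] by metis
  have sX: "smooth_on N (\<lambda>y. X y $ k)" and L: "y \<in> N \<Longrightarrow> lie_conn \<Gamma> X i j k y = 0" for i j k y
    using N(5) unfolding killing_on_iff_lie_conn[OF N(1,4)] smooth_map_on_def by auto
  have K: "(\<Sum>l\<in>UNIV. \<rho> l j * pdc i X l y + \<rho> i l * pdc j X l y) = 0" if "y \<in> N" for i j y
  proof -
    have "y \<in> S" using that N(3) by blast
    then show ?thesis
      using lie_tensor2_ricci[OF N(1,4,5) that, of i j] by (simp add: lie_tensor2_def pd_ricci ricci_eq)
  qed
  define B H where "B i l = pdc i X l x" and "H m i l = pd m (pdc i X l) x" for m i l
  have H_sym: "H m i l = H i m l" for m i l
    unfolding H_def by (rule pd_commute[OF N(1) sX N(2)])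
  have dpd: "pdc i X l differentiable (at x)" for i l
    by (rule smooth_on_differentiable[OF smooth_on_pd[OF sX] N(1,2)])
  have HK: "(\<Sum>l\<in>UNIV. \<rho> l j * H m i l + \<rho> i l * H m j l) = 0" for m i j
  proof -
    have "pd m (\<lambda>y. \<Sum>l\<in>UNIV. \<rho> l j * pdc i X l y + \<rho> i l * pdc j X l y) x = pd m (\<lambda>_. 0) x"
      by (rule pd_cong_open[OF N(1,2) K])
    then show ?thesis by (simp add: sum_2 H_def pd_add pd_cmult differentiable_add differentiable_mult dpd)
  qed
  define d where "d = \<rho> 1 1 * \<rho> 2 2 - \<rho> 1 2 * \<rho> 2 1"
  have d: "d \<noteq> 0" using det by (simp add: d_def)
  have r21: "\<rho> 2 1 = \<rho> 1 2" by (rule \<rho>_sym)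
  \<comment> \<open>Lowering the upper index of \<open>H\<close> with \<open>\<rho>\<close> gives a
    tensor symmetric in its first two and skew in its last two indices; such a tensor is
    zero.\<close>
  define Y where "Y m i j = \<rho> 1 j * H m i 1 + \<rho> 2 j * H m i 2" for m i j
  have Y1: "Y m i j = Y i m j" and Y2: "Y m i j = - Y m j i" for m i j
    using HK[of j m i] \<rho>_sym[of i] by (simp_all add: Y_def sum_2 H_sym[of m i])
  have Y: "Y m i j = 0" for m i j
  proof -
    have "Y m i j = - Y m j i" by (rule Y2)
    also have "\<dots> = - Y j m i" by (simp add: Y1)
    also have "\<dots> = Y j i m" using Y2[of j m i] by simp
    also have "\<dots> = Y i j m" by (rule Y1)
    also have "\<dots> = - Y i m j" by (rule Y2)
    also have "\<dots> = - Y m i j" by (simp add: Y1)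
    finally show ?thesis by simp
  qed
  have H0: "H m i l = 0" for m i l
  proof -
    have "d * H m i 1 = \<rho> 2 2 * Y m i 1 - \<rho> 2 1 * Y m i 2" "d * H m i 2 = \<rho> 1 1 * Y m i 2 - \<rho> 1 2 * Y m i 1"
      by (simp_all add: d_def Y_def algebra_simps)
    then have "d * H m i 1 = 0" "d * H m i 2 = 0" by (simp_all add: Y)
    then show ?thesis using d exhaust_2[of l] by auto
  qed
  have E: "(\<Sum>l\<in>UNIV. B i l * A l j k + B j l * A i l k - A i j l * B l k) = 0" for i j k
  proof -
    have "lie_conn \<Gamma> X i j k x = (\<Sum>l\<in>UNIV. B i l * A l j k + B j l * A i l k - A i j l * B l k)"
      by (simp add: lie_conn_def H0[unfolded H_def] pd_\<Gamma>[OF x] \<Gamma>[OF x] B_def sum_2 algebra_simps)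
    then show ?thesis using L[OF N(2)] by simp
  qed
  \<comment> \<open>\<open>B\<close> lies in the one-dimensional orthogonal Lie algebra of
    \<open>\<rho>\<close>; \<open>b\<close> is its coordinate there, and its determinant is
    \<open>b * b / d\<close>.\<close>
  define b where "b = B 1 1 * \<rho> 1 2 + B 1 2 * \<rho> 2 2"
  have k: "B 1 1 * \<rho> 1 1 + B 1 2 * \<rho> 1 2 = 0" "B 2 1 * \<rho> 1 2 + B 2 2 * \<rho> 2 2 = 0"
       "B 2 1 * \<rho> 1 1 + B 2 2 * \<rho> 1 2 = - b"
    using K[OF N(2), of 1 1] K[OF N(2), of 2 2] K[OF N(2), of 1 2] by (simp_all add: sum_2 b_def B_def r21 algebra_simps)
  have c: "d * B 1 1 = - b * \<rho> 1 2" "d * B 1 2 = b * \<rho> 1 1" "d * B 2 1 = - b * \<rho> 2 2" "d * B 2 2 = b * \<rho> 1 2"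
    subgoal using k(1) b_def unfolding d_def r21 by algebra
    subgoal using k(1) b_def unfolding d_def r21 by algebra
    subgoal using k(2,3) unfolding d_def r21 by algebra
    subgoal using k(2,3) unfolding d_def r21 by algebra
    done
  have "b = 0"
  proof (rule ccontr)
    assume b: "b \<noteq> 0"
    have "d * (B 2 2 + B 1 1) = 0" using c(1,4) by (simp add: algebra_simps)
    then have tr: "B 2 2 = - B 1 1" using d by (simp add: add_eq_0_iff2)
    have "d * d * (B 1 1 * B 2 2 - B 1 2 * B 2 1) = b * b * d"
      using c unfolding d_def r21 by algebra
    then have "B 1 1 * B 2 2 - B 1 2 * B 2 1 \<noteq> 0" using b d by auto
    from derivation_injective[of B A, OF tr this E] have "A i j k = 0" for i j k .
    then have "\<rho> i j = 0" for i j by (simp add: \<rho>_def r_def)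
    then show False using det by simp
  qed
  then have "d * B i k = 0" using c exhaust_2[of i] exhaust_2[of k] by auto
  then show ?thesis using d by (simp add: B_def)
qed

lemma regular_commuting:
  assumes "x \<in> S" "\<rho> 1 1 * \<rho> 2 2 \<noteq> \<rho> 1 2 * \<rho> 2 1" "kill_near \<Gamma> x X" "kill_near \<Gamma> x Y"
  shows "bracket X Y x = 0"
  using regular_killing_constant[OF assms(1,2)] assms(3,4) by (simp add: bracket_def vec_eq_iff)

end

section \<open>The normal form with four Killing fields\<close>

definition model :: "real \<Rightarrow> real \<Rightarrow> 2 \<Rightarrow> 2 \<Rightarrow> 2 \<Rightarrow> real" where
  "model p e i j k = (if i = 1 \<and> j = 1 \<and> k = 1 then p else if i \<noteq> j \<and> k = 2 then e else 0)"

abbreviation model_conn :: "real \<Rightarrow> real \<Rightarrow> christoffel" where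
  "model_conn p e \<equiv> (\<lambda>i j k x. model p e i j k)"

lemma model_type_A: "type_A_conn (model_conn p e) UNIV (model p e)"
  by unfold_locales (auto simp: model_def)

lemma ricci_model: "ricci (model_conn p e) i j x = (if i = 1 \<and> j = 1 then e * (p - e) else 0)"
proof -
  interpret type_A_conn "model_conn p e" UNIV "model p e" by (rule model_type_A)
  show ?thesis using exhaust_2[of i] exhaust_2[of j]
    by (subst ricci_eq) (auto simp: \<rho>_def r_def sum_2 model_def algebra_simps)
qed

lemma killing_dim_model:
  assumes nz: "e * (p - e) \<noteq> 0"
  shows "killing_dim_at (model_conn p e) x 4"
proof -
  interpret type_A_conn "model_conn p e" UNIV "model p e" by (rule model_type_A)
  \<comment> \<open>The Killing equation for \<open>f(u)\<close> times the second coordinate field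
    is \<open>f'' = (p - 2 * e) * f'\<close>. The chosen \<open>f\<close> is a solution whose
    derivative never vanishes.\<close>
  define q where "q = p - 2 * e"
  define f f' where "f t = (if q = 0 then t else exp (q * t))" and "f' t = (if q = 0 then 1 else q * exp (q * t))" for t
  have Df: "(f has_real_derivative f' t) (at t)" and Df': "(f' has_real_derivative q * f' t) (at t)" for t
    unfolding f_def[abs_def] f'_def[abs_def]
    by (cases "q = 0"; auto intro!: derivative_eq_intros)+
  have f'0: "f' t \<noteq> 0" for t by (simp add: f'_def)
  have df: "(\<lambda>z::real^2. f (z $ 1)) differentiable (at z)" "(\<lambda>z::real^2. f' (z $ 1)) differentiable (at z)" for z
    by (rule differentiable_real_comp[OF differentiable_coord Df] differentiable_real_comp[OF differentiable_coord Df'])+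
  have sf: "smooth_on UNIV (\<lambda>z::real^2. f (z $ 1))"
    unfolding f_def by (cases "q = 0") (auto intro!: smooth_intros)
  have pf: "pd i (\<lambda>z. f (z $ 1)) = (\<lambda>z. if i = 1 then f' (z $ 1) else 0)" 
       "pd i (\<lambda>z. f' (z $ 1)) = (\<lambda>z. if i = 1 then q * f' (z $ 1) else 0)" for i
    using pd_real_comp[OF differentiable_coord Df] pd_real_comp[OF differentiable_coord Df'] by (auto simp: fun_eq_iff)
  define F :: "real \<Rightarrow> real \<Rightarrow> real \<Rightarrow> real \<Rightarrow> vfield"
    where "F a b c d z = a *\<^sub>R axis 1 1 + (b + c * z $ 2 + d * f (z $ 1)) *\<^sub>R axis 2 1" for a b c d z
  have F1: "F a b c d z $ 1 = a" and F2: "F a b c d z $ 2 = b + c * z $ 2 + d * f (z $ 1)" for a b c d z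
    by (simp_all add: F_def axis_def)
  have pF1: "pd i (\<lambda>z. F a b c d z $ 1) = (\<lambda>z. 0)" for i a b c d
    by (simp add: F1 fun_eq_iff)
  have pF2: "pd i (\<lambda>z. F a b c d z $ 2) = (\<lambda>z. if i = 1 then d * f' (z $ 1) else c)" for i a b c d
    unfolding F2 using exhaust_2[of i]
    by (auto simp: fun_eq_iff pd_add pd_cmult differentiable_add differentiable_mult differentiable_coord df pf)
  have KF: "kill_near (model_conn p e) x (F a b c d)" for a b c d
  proof -
    have "lie_conn (model_conn p e) (F a b c d) i j k z = 0" for i j k z
      using exhaust_2[of i] exhaust_2[of j] exhaust_2[of k]
      by (auto simp: lie_conn_def sum_2 pF1 pF2 pd_cmult df pf pd_\<Gamma> model_def q_def algebra_simps)
    moreover have "smooth_on UNIV (\<lambda>z. F a b c d z $ k)" for k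
      using exhaust_2[of k] sf by (auto simp: F1 F2 intro!: smooth_intros)
    ultimately have "killing_on (model_conn p e) UNIV (F a b c d)"
      unfolding killing_on_iff_lie_conn[OF open_UNIV smooth_\<Gamma>] smooth_map_on_def by blast
    then show ?thesis using smooth_\<Gamma> unfolding kill_near_def by blast
  qed
  define X :: "nat \<Rightarrow> vfield" where "X m = F (if m = 0 then 1 else 0) (if m = 1 then 1 else 0) (if m = 2 then 1 else 0) (if m = 3 then 1 else 0)" for m
  have S: "(\<Sum>m<4. a m *\<^sub>R X m z) = F (a 0) (a 1) (a 2) (a 3) z" for a z
    by (simp add: eval_nat_numeral X_def F_def algebra_simps)
  show ?thesis
    unfolding killing_dim_at_def
  proof (rule exI[of _ X], intro conjI allI impI)
    show "kill_near (model_conn p e) x (X m)" for m unfolding X_def by (rule KF)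
  next
    fix a :: "nat \<Rightarrow> real" and m :: nat
    assume "\<forall>\<^sub>F z in nhds x. (\<Sum>m<4. a m *\<^sub>R X m z) = 0" and "m < 4"
    then have ev: "\<forall>\<^sub>F z in nhds x. F (a 0) (a 1) (a 2) (a 3) z = 0" unfolding S by simp
    then have F0: "F (a 0) (a 1) (a 2) (a 3) x = 0" by (rule eventually_nhds_x_imp_x)
    have "pd i (\<lambda>z. F (a 0) (a 1) (a 2) (a 3) z $ 2) x = pd i (\<lambda>z. 0) x" for i
      by (rule pd_cong) (use ev in \<open>auto elim: eventually_mono\<close>)
    from this[of 1] this[of 2] have "a 3 = 0" "a 2 = 0" using f'0 by (simp_all add: pF2)
    moreover from this F0 have "a 0 = 0" "a 1 = 0" using F1 F2 by (metis zero_index, simp add: vec_eq_iff forall_2 F2)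
    ultimately show "a m = 0" using \<open>m < 4\<close> by (auto simp: eval_nat_numeral less_Suc_eq)
  next
    fix Y assume Y: "kill_near (model_conn p e) x Y"
    obtain N where N: "open N" "x \<in> N" "smooth_conn_on N (model_conn p e)" "killing_on (model_conn p e) N Y"
      using Y by (auto simp: kill_near_def)
    have "pd i (ricci (model_conn p e) j k) x = 0" for i j k by (simp add: pd_ricci)
    \<comment> \<open>Only \<open>ricci 1 1\<close> is non-zero, and its invariance kills both
      derivatives of the first component. The 1-jet of \<open>Y\<close> is left with four free
      numbers, as many as \<open>F\<close> has parameters.\<close>
    then have "(e * (p - e)) * pdc 1 Y 1 x = 0" "(e * (p - e)) * pdc 2 Y 1 x = 0"
      using lie_tensor2_ricci[OF N(1,3,4,2), of 1 1] lie_tensor2_ricci[OF N(1,3,4,2), of 1 2]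
      by (auto simp: lie_tensor2_def sum_2 ricci_model)
    then have Y1: "pdc i Y 1 x = 0" for i using nz exhaust_2[of i] by auto
    \<comment> \<open>The parameters are fitted so that \<open>F\<close> has the same 1-jet at
      \<open>x\<close> as \<open>Y\<close>; \<open>killing_unique\<close> does the rest.\<close>
    define d where "d = pdc 1 Y 2 x / f' (x $ 1)"
    define c where "c = pdc 2 Y 2 x"
    define b where "b = Y x $ 2 - c * x $ 2 - d * f (x $ 1)"
    define Z where "Z z = 1 *\<^sub>R Y z + (-1) *\<^sub>R F (Y x $ 1) b c d z" for z
    have "\<forall>\<^sub>F z in nhds x. Z z = 0"
    proof (rule killing_unique)
      show "kill_near (model_conn p e) x Z" unfolding Z_def by (rule kill_near_lincomb[OF Y KF])
      show "Z x = 0" by (simp add: Z_def vec_eq_iff forall_2 F1 F2 b_def)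
      fix i k
      have "pdc i Z k x = pdc i Y k x - pd i (\<lambda>y. F (Y x $ 1) b c d y $ k) x"
        unfolding Z_def by (simp add: pd_diff kill_near_differentiable[OF Y] kill_near_differentiable[OF KF])
      then show "pdc i Z k x = 0"
        using exhaust_2[of i] exhaust_2[of k] f'0 by (auto simp: pF1 pF2 Y1 c_def d_def)
    qed
    then have "\<forall>\<^sub>F z in nhds x. Y z = F (Y x $ 1) b c d z"
      by (rule eventually_mono) (simp add: Z_def)
    then show "\<exists>a. \<forall>\<^sub>F z in nhds x. Y z = (\<Sum>m<4. a m *\<^sub>R X m z)"
      unfolding S by (intro exI[of _ "\<lambda>m. if m = 0 then Y x $ 1 else if m = 1 then b else if m = 2 then c else d"]) simp
  qed
qed

context type_B_conn begin

text \<open>In the coordinates \<open>u = ln \<bar>x\<^sup>1\<bar>\<close> and \<open>v = x\<^sup>2 - \<phi> x\<^sup>1\<close> the Christoffel symbols are constant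
  provided that \<open>\<phi>'' + (2 C\<^sub>1\<^sub>2\<^sup>2 - C\<^sub>1\<^sub>1\<^sup>1) \<phi>' / x + C\<^sub>1\<^sub>1\<^sup>2 / x = 0\<close>.\<close>

lemma to_model:
  assumes C0: "C 1 2 1 = 0" "C 2 2 1 = 0" "C 2 2 2 = 0" and x0: "x0 \<in> S"
  shows "\<exists>N \<tau> \<sigma>. open N \<and> x0 \<in> N \<and> N \<subseteq> S \<and>
    affine_iso \<Gamma> N (model_conn (1 + C 1 1 1) (C 1 2 2)) (\<tau> ` N) \<tau> \<sigma>"
proof -
  define a b e where "a = C 1 1 1" and "b = C 1 1 2" and "e = C 1 2 2"
  have C: "C i j k = (if i = 1 \<and> j = 1 then if k = 1 then a else b else if i \<noteq> j \<and> k = 2 then e else 0)" for i j k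
    using exhaust_2[of i] exhaust_2[of j] exhaust_2[of k] C0 C_sym[of 2 1]
    by (auto simp: a_def b_def e_def)
  \<comment> \<open>With \<open>\<phi>' = \<kappa> - \<mu> * ln \<bar>x $ 1\<bar>\<close> the
    differential equation for \<open>\<phi>\<close> splits into these two conditions. A logarithm is
    brought in only in the resonant case \<open>2 * e = a\<close>.\<close>
  obtain \<kappa> \<mu> :: real where km: "(2 * e - a) * \<kappa> = \<mu> - b" "(2 * e - a) * \<mu> = 0"
  proof (cases "2 * e - a = 0")
    case True then show ?thesis using that[of 0 b] by simp
  next
    case False then show ?thesis using that[of "- b / (2 * e - a)" 0] by simp
  qed
  \<comment> \<open>\<open>s\<close> is the sign of \<open>x0 $ 1\<close>, so
    \<open>s * x $ 1\<close> is the absolute value on the half-plane \<open>H\<close>, and both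
    signs are treated at once.\<close>
  define s where "s = sgn (x0 $ 1)"
  have s2: "s * s = 1" using x1[OF x0] by (simp add: s_def sgn_real_def)
  then have s0: "s \<noteq> 0" by auto
  define H where "H = {x::real^2. s * x $ 1 > 0}"
  have H: "open H" unfolding H_def
    by (intro open_Collect_less continuous_on_const continuous_on_mult continuous_on_component continuous_on_id)
  define N where "N = S \<inter> H"
  have N: "open N" "x0 \<in> N" "N \<subseteq> S" "N \<subseteq> H"
    using open_S H x0 x1[OF x0] by (auto simp: N_def H_def s_def sgn_real_def)
  define \<phi> \<phi>' where "\<phi> t = \<kappa> * t - \<mu> * (t * ln (s * t) - t)" and "\<phi>' t = \<kappa> - \<mu> * ln (s * t)" for t
  \<comment> \<open>\<open>\<psi> w\<close> is \<open>\<phi>\<close> at \<open>s * exp w\<close>,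
    written out so that no logarithm occurs in the inverse map.\<close>
  define \<psi> \<psi>' where "\<psi> w = \<kappa> * (s * exp w) - \<mu> * (s * exp w * w - s * exp w)"
    and "\<psi>' w = s * exp w * (\<kappa> - \<mu> * w)" for w
  define \<tau> :: "real^2 \<Rightarrow> real^2" where "\<tau> x = (\<chi> k. if k = 1 then ln (s * x $ 1) else x $ 2 - \<phi> (x $ 1))" for x
  define \<sigma> :: "real^2 \<Rightarrow> real^2" where "\<sigma> u = (\<chi> k. if k = 1 then s * exp (u $ 1) else u $ 2 + \<psi> (u $ 1))" for u
  have \<tau>_nth: "\<tau> x $ 1 = ln (s * x $ 1)" "\<tau> x $ 2 = x $ 2 - \<phi> (x $ 1)" for x by (simp_all add: \<tau>_def)
  have \<sigma>_nth: "\<sigma> u $ 1 = s * exp (u $ 1)" "\<sigma> u $ 2 = u $ 2 + \<psi> (u $ 1)" for u by (simp_all add: \<sigma>_def)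
  have ss: "s * (s * t) = t" for t by (simp add: s2 flip: mult.assoc)
  have \<psi>\<phi>: "\<phi> (s * exp w) = \<psi> w" for w by (simp add: \<phi>_def \<psi>_def ss)
  have \<tau>\<sigma>: "\<tau> (\<sigma> u) = u" for u by (simp add: vec_eq_iff forall_2 \<tau>_nth \<sigma>_nth ss \<psi>\<phi>)
  have \<sigma>\<tau>: "\<sigma> (\<tau> x) = x" if "x \<in> H" for x
  proof -
    have "s * exp (ln (s * x $ 1)) = x $ 1" using that by (simp add: H_def ss)
    then show ?thesis using \<psi>\<phi>[of "ln (s * x $ 1)"] by (simp add: vec_eq_iff forall_2 \<tau>_nth \<sigma>_nth)
  qed
  have smooth_\<tau>: "smooth_on H (\<lambda>x. \<tau> x $ k)" for k
    using exhaust_2[of k] by (auto simp: \<tau>_nth \<phi>_def H_def intro!: smooth_intros H[unfolded H_def])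
  have smooth_\<sigma>: "smooth_on UNIV (\<lambda>x. \<sigma> x $ k)" for k
    using exhaust_2[of k] by (auto simp: \<sigma>_nth \<psi>_def intro!: smooth_intros)
  have D\<tau>: "((\<lambda>t. ln (s * t)) has_real_derivative inverse t) (at t)"
    "(\<phi> has_real_derivative \<phi>' t) (at t)" "(\<phi>' has_real_derivative - \<mu> * inverse t) (at t)" if "s * t > 0" for t
    unfolding \<phi>_def[abs_def] \<phi>'_def[abs_def]
    using that s0 by (auto intro!: derivative_eq_intros simp: field_simps)
  have D\<sigma>: "((\<lambda>w. s * exp w) has_real_derivative s * exp w) (at w)"
    "(\<psi> has_real_derivative \<psi>' w) (at w)" "(\<psi>' has_real_derivative \<psi>' w - \<mu> * (s * exp w)) (at w)" for w
    unfolding \<psi>_def[abs_def] \<psi>'_def[abs_def]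
    by (auto intro!: derivative_eq_intros simp: algebra_simps)
  have pd\<tau>: "pdc i \<tau> 1 x = (if i = 1 then inverse (x $ 1) else 0)"
    "pdc i \<tau> 2 x = (if i = 1 then - \<phi>' (x $ 1) else 1)" if "x \<in> H" for i x
  proof -
    have t: "s * x $ 1 > 0" using that by (simp add: H_def)
    note d = differentiable_coord differentiable_real_comp[OF differentiable_coord D\<tau>(2)[OF t]]
    show "pdc i \<tau> 1 x = (if i = 1 then inverse (x $ 1) else 0)"
      unfolding \<tau>_nth using pd_real_comp[OF differentiable_coord D\<tau>(1)[OF t], of i] by simp
    show "pdc i \<tau> 2 x = (if i = 1 then - \<phi>' (x $ 1) else 1)"
      unfolding \<tau>_nth using pd_real_comp[OF differentiable_coord D\<tau>(2)[OF t], of i] exhaust_2[of i]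
      by (auto simp: pd_diff d)
  qed
  have pd2\<tau>: "pd j (pdc i \<tau> 1) x = (if i = 1 \<and> j = 1 then - (inverse (x $ 1) * inverse (x $ 1)) else 0)"
    "pd j (pdc i \<tau> 2) x = (if i = 1 \<and> j = 1 then \<mu> * inverse (x $ 1) else 0)" if "x \<in> H" for i j x
  proof -
    have t: "s * x $ 1 > 0" "x $ 1 \<noteq> 0" using that by (auto simp: H_def)
    have "pd j (pdc i \<tau> 1) x = pd j (\<lambda>x. if i = 1 then inverse (x $ 1) else 0) x"
      by (rule pd_cong_open[OF H that pd\<tau>(1)])
    then show "pd j (pdc i \<tau> 1) x = (if i = 1 \<and> j = 1 then - (inverse (x $ 1) * inverse (x $ 1)) else 0)"
      using pd_real_comp[OF differentiable_coord DERIV_inverse[OF t(2)], of j] by (cases "i = 1") (auto simp: power2_eq_square)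
    have "pd j (pdc i \<tau> 2) x = pd j (\<lambda>x. if i = 1 then - \<phi>' (x $ 1) else 1) x"
      by (rule pd_cong_open[OF H that pd\<tau>(2)])
    then show "pd j (pdc i \<tau> 2) x = (if i = 1 \<and> j = 1 then \<mu> * inverse (x $ 1) else 0)"
      using pd_real_comp[OF differentiable_coord D\<tau>(3)[OF t(1)], of j]
        differentiable_real_comp[OF differentiable_coord D\<tau>(3)[OF t(1)]]
      by (cases "i = 1") (auto simp: pd_minus)
  qed
  have pd\<sigma>: "pdc i \<sigma> 1 = (\<lambda>u. if i = 1 then s * exp (u $ 1) else 0)"
    "pdc i \<sigma> 2 = (\<lambda>u. if i = 1 then \<psi>' (u $ 1) else 1)" for i
    unfolding \<sigma>_nth fun_eq_iff
    using pd_real_comp[OF differentiable_coord D\<sigma>(1), of i] pd_real_comp[OF differentiable_coord D\<sigma>(2), of i]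
      exhaust_2[of i]
    by (auto simp: pd_add differentiable_coord differentiable_real_comp[OF differentiable_coord D\<sigma>(2)])
  have pd2\<sigma>: "pd j (\<lambda>u. if i = 1 then s * exp (u $ 1) else 0) u = (if i = 1 \<and> j = 1 then s * exp (u $ 1) else 0)"
    "pd j (\<lambda>u. if i = 1 then \<psi>' (u $ 1) else 1) u = (if i = 1 \<and> j = 1 then \<psi>' (u $ 1) - \<mu> * (s * exp (u $ 1)) else 0)" for i j :: 2 and u
    using pd_real_comp[OF differentiable_coord D\<sigma>(1), of j] pd_real_comp[OF differentiable_coord D\<sigma>(3), of j]
    by (cases "i = 1"; simp)+
  have \<tau>N: "\<tau> ` N = \<sigma> -` N"
  proof (intro set_eqI iffI)
    show "u \<in> \<sigma> -` N" if "u \<in> \<tau> ` N" for u using that N(4) \<sigma>\<tau> by auto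
    show "u \<in> \<tau> ` N" if "u \<in> \<sigma> -` N" for u using that \<tau>\<sigma>[of u] by (metis image_eqI vimageE)
  qed
  have "affine_iso \<Gamma> N (model_conn (1 + a) e) (\<tau> ` N) \<tau> \<sigma>"
  proof
    show "open N" by fact
    have "continuous_on UNIV (\<lambda>u. \<chi> k. \<sigma> u $ k)"
      by (intro continuous_on_vec_lambda smooth_on_continuous[OF smooth_\<sigma>])
    then show "open (\<tau> ` N)" unfolding \<tau>N using open_vimage[OF N(1)] by simp
    show "x \<in> N \<Longrightarrow> \<tau> x \<in> \<tau> ` N" "y \<in> \<tau> ` N \<Longrightarrow> \<sigma> y \<in> N" "x \<in> N \<Longrightarrow> \<sigma> (\<tau> x) = x" "\<tau> (\<sigma> y) = y" for x y
      using \<sigma>\<tau> N(4) \<tau>\<sigma> by auto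
    show "smooth_conn_on N \<Gamma>" by (rule smooth_conn_on_subset[OF smooth_\<Gamma> N(3)])
    show "smooth_conn_on (\<tau> ` N) (model_conn (1 + a) e)" by (simp add: smooth_conn_on_def smooth_on_const)
    show "affine_map_on N \<Gamma> (model_conn (1 + a) e) \<tau>"
      unfolding affine_map_on_def
    proof (intro conjI ballI allI)
      show "smooth_map_on N \<tau>" using smooth_on_subset[OF smooth_\<tau> N(4)] by (simp add: smooth_map_on_def)
      fix x i j k assume x: "x \<in> N"
      define q where "q = inverse (x $ 1)"
      define f where "f = \<phi>' (x $ 1)"
      \<comment> \<open>This is the differential equation of \<open>\<phi>\<close>, needed for
        \<open>i = j = 1\<close> and \<open>k = 2\<close>. For \<open>k = 1\<close> the summand 1 in
        \<open>1 + a\<close> compensates the second derivative of the logarithm.\<close>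
      have "\<mu> * q - 2 * e * f * q = - a * q * f + b * q"
        using km unfolding f_def \<phi>'_def by algebra
      then show "pd i (pdc j \<tau> k) x + (\<Sum>a'\<in>UNIV. \<Sum>b'\<in>UNIV. pdc i \<tau> a' x * pdc j \<tau> b' x * model (1 + a) e a' b' k)
        = (\<Sum>l\<in>UNIV. \<Gamma> i j l x * pdc l \<tau> k x)"
        using exhaust_2[of i] exhaust_2[of j] exhaust_2[of k] x N(3,4) pd2\<tau> pd\<tau>
        by (auto simp: sum_2 subset_eq \<Gamma> C model_def algebra_simps simp flip: q_def f_def)
    qed
    show "affine_map_on (\<tau> ` N) (model_conn (1 + a) e) \<Gamma> \<sigma>"
      unfolding affine_map_on_def
    proof (intro conjI ballI allI)
      show "smooth_map_on (\<tau> ` N) \<sigma>" using smooth_on_subset[OF smooth_\<sigma>] by (simp add: smooth_map_on_def)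
      fix u i j k assume "u \<in> \<tau> ` N"
      then have u: "\<sigma> u \<in> S" using \<tau>N N(3) by blast
      define t where "t = s * exp (u $ 1)"
      have t: "t \<noteq> 0" using s0 by (simp add: t_def)
      have G: "\<Gamma> i j k (\<sigma> u) = inverse t * C i j k" for i j k using \<Gamma>[OF u] by (simp add: \<sigma>_nth t_def)
      have "\<psi>' (u $ 1) = t * (\<kappa> - \<mu> * u $ 1)" by (simp add: \<psi>'_def t_def)
      \<comment> \<open>The same differential equation in terms of \<open>\<psi>\<close>, with
        denominators cleared.\<close>
      then have K: "b * (t * t) + e * (t * (2 * \<psi>' (u $ 1))) = \<mu> * (t * t) + a * (t * \<psi>' (u $ 1))"
        using km by algebra
      have p: "pd i (\<lambda>u. s * exp (u $ 1)) u = (if i = 1 then t else 0)"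
        "pd i (\<lambda>u. \<psi>' (u $ 1)) u = (if i = 1 then \<psi>' (u $ 1) - \<mu> * t else 0)" for i
        using pd2\<sigma>[where i = 1 and j = i] by (simp_all add: t_def)
      show "pd i (pdc j \<sigma> k) u + (\<Sum>a'\<in>UNIV. \<Sum>b'\<in>UNIV. pdc i \<sigma> a' u * pdc j \<sigma> b' u * \<Gamma> a' b' k (\<sigma> u))
        = (\<Sum>l\<in>UNIV. model (1 + a) e i j l * pdc l \<sigma> k u)"
        using exhaust_2[of i] exhaust_2[of j] exhaust_2[of k] t
        by (auto simp: sum_2 pd\<sigma> p G C model_def field_simps simp flip: t_def) (rule K)
    qed
  qed
  then show ?thesis using N(1-3) unfolding a_def e_def by blast
qed

end

section \<open>Charts\<close>

lemma affine_map_on_subset: "affine_map_on S \<Gamma> \<Gamma>' \<tau> \<Longrightarrow> T \<subseteq> S \<Longrightarrow> affine_map_on T \<Gamma> \<Gamma>' \<tau>"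
  unfolding affine_map_on_def smooth_map_on_def using smooth_on_subset by (meson subsetD)

lemma affine_map_on_cong:
  assumes "open S" "\<And>x. x \<in> S \<Longrightarrow> \<tau> x = \<tau>' x" "affine_map_on S \<Gamma> \<Gamma>' \<tau>"
  shows "affine_map_on S \<Gamma> \<Gamma>' \<tau>'"
proof -
  have 1: "pdc i \<tau>' a x = pdc i \<tau> a x" if "x \<in> S" for i a x
    by (rule pd_cong_open[OF assms(1) that]) (simp add: assms(2))
  have 2: "pd j (pdc i \<tau>' a) x = pd j (pdc i \<tau> a) x" if "x \<in> S" for i j a x
    by (rule pd_cong_open[OF assms(1) that 1])
  have "smooth_on S (\<lambda>y. \<tau>' y $ a) \<longleftrightarrow> smooth_on S (\<lambda>y. \<tau> y $ a)" for a
    by (rule smooth_on_cong[OF assms(1)]) (simp add: assms(2))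
  then show ?thesis using assms(3) unfolding affine_map_on_def smooth_map_on_def
    by (simp add: 1 2 assms(2)[symmetric])
qed

lemma affine_map_on_comp:
  assumes "open S" "open T" "affine_map_on S \<Gamma> \<Gamma>' f" "affine_map_on T \<Gamma>' \<Gamma>'' g" "f ` S \<subseteq> T"
  shows "affine_map_on S \<Gamma> \<Gamma>'' (\<lambda>x. g (f x))"
  unfolding affine_map_on_def
proof (intro conjI ballI allI)
  have sf: "smooth_on S (\<lambda>y. f y $ a)" and sg: "smooth_on T (\<lambda>y. g y $ a)" for a
    using assms(3,4) by (auto simp: affine_map_on_def smooth_map_on_def)
  show "smooth_map_on S (\<lambda>x. g (f x))"
    unfolding smooth_map_on_def using smooth_on_chain[OF assms(1,2) sf assms(5) sg] by blast
  fix x i j k assume x: "x \<in> S"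
  have df: "(\<lambda>y. f y $ a) differentiable (at y)" "pdc b f a differentiable (at y)"
    and dg: "(\<lambda>y. g y $ a) differentiable (at (f y))" "pdc b g a differentiable (at (f y))"
    if "y \<in> S" for a b y
    using that assms(1,2,5) sf sg smooth_on_pd by (blast intro: smooth_on_differentiable)+
  have c1: "pd m (\<lambda>y. g (f y) $ a) y = (\<Sum>b\<in>UNIV. pdc b g a (f y) * pdc m f b y)" if "y \<in> S" for m a y
    using pd_chain[of f y "\<lambda>y. g y $ a" m, OF df(1)[OF that] dg(1)[OF that]] .
  have c2: "pd m (\<lambda>y. pdc b g a (f y)) x = (\<Sum>n\<in>UNIV. pd n (pdc b g a) (f x) * pdc m f n x)" for m a b
    using pd_chain[of f x "pdc b g a" m, OF df(1)[OF x] dg(2)[OF x]] .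
  have d2: "(\<lambda>y. pdc b g a (f y)) differentiable (at x)" for a b
    using differentiable_chain2[of f x "pdc b g a", OF df(1)[OF x] dg(2)[OF x]] .
  have c3: "pd i (pd j (\<lambda>y. g (f y) $ k)) x
    = pd i (\<lambda>y. \<Sum>b\<in>UNIV. pdc b g k (f y) * pdc j f b y) x"
    by (rule pd_cong_open[OF assms(1) x c1])
  have f2: "pd a (pdc b f c) x = (\<Sum>k\<in>UNIV. \<Gamma> a b k x * pdc k f c x)
     - (\<Sum>m\<in>UNIV. \<Sum>n\<in>UNIV. pdc a f m x * pdc b f n x * \<Gamma>' m n c (f x))" for a b c
    using assms(3) x unfolding affine_map_on_def by (simp add: algebra_simps)
  have g2: "pd a (pdc b g c) (f x) = (\<Sum>k\<in>UNIV. \<Gamma>' a b k (f x) * pdc k g c (f x))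
     - (\<Sum>m\<in>UNIV. \<Sum>n\<in>UNIV. pdc a g m (f x) * pdc b g n (f x) * \<Gamma>'' m n c (g (f x)))" for a b c
    using assms(4,5) x unfolding affine_map_on_def by (simp add: algebra_simps image_subset_iff)
  show "pd i (pd j (\<lambda>y. g (f y) $ k)) x + (\<Sum>a\<in>UNIV. \<Sum>b\<in>UNIV. pd i (\<lambda>y. g (f y) $ a) x * pd j (\<lambda>y. g (f y) $ b) x * \<Gamma>'' a b k (g (f x)))
      = (\<Sum>l\<in>UNIV. \<Gamma> i j l x * pd l (\<lambda>y. g (f y) $ k) x)"
    unfolding c3 c1[OF x]
    by (simp add: sum_2 pd_rules d2 df[OF x] c2 f2 g2) (simp add: algebra_simps)
qed

lemma is_chartD:
  assumes "is_chart c"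
  shows "open (chart_dom c)" "open (chart_image c)" "smooth_conn_on (chart_image c) (chart_sym c)"
    "\<And>x i j k. x \<in> chart_image c \<Longrightarrow> chart_sym c i j k x = chart_sym c j i k x"
    "\<And>p. p \<in> chart_dom c \<Longrightarrow> inv_into (chart_dom c) (chart_map c) (chart_map c p) = p"
    "continuous_on (chart_dom c) (chart_map c)"
    "continuous_on (chart_image c) (inv_into (chart_dom c) (chart_map c))"
  using assms unfolding is_chart_def homeomorphism_def smooth_conn_on_def by auto

lemma chart_image_open:
  assumes "is_chart c" "open P" "P \<subseteq> chart_dom c"
  shows "open (chart_map c ` P)"
proof -
  have "chart_map c ` P = chart_image c \<inter> inv_into (chart_dom c) (chart_map c) -` P"
    using assms(3) is_chartD(5)[OF assms(1)] by (auto simp: chart_image_def)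
  then show ?thesis
    using continuous_open_preimage[OF is_chartD(7,2)[OF assms(1)] assms(2)] by simp
qed

text \<open>Coordinate changes and germs of symmetries of the surface are both instances, so a
  single invariance argument serves for the choice of chart and for homogeneity.\<close>

definition linked :: "christoffel \<Rightarrow> real^2 \<Rightarrow> christoffel \<Rightarrow> real^2 \<Rightarrow> bool" where
  "linked \<Gamma> x \<Gamma>' x' \<longleftrightarrow> (\<exists>U V \<tau> \<sigma>. affine_iso \<Gamma> U \<Gamma>' V \<tau> \<sigma> \<and> x \<in> U \<and> x' = \<tau> x)"

lemma linked_sym:
  assumes "linked \<Gamma> x \<Gamma>' x'"
  shows "linked \<Gamma>' x' \<Gamma> x"
proof -
  obtain U V \<tau> \<sigma> where i: "affine_iso \<Gamma> U \<Gamma>' V \<tau> \<sigma>" and x: "x \<in> U" "x' = \<tau> x"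
    using assms unfolding linked_def by blast
  interpret affine_iso \<Gamma> U \<Gamma>' V \<tau> \<sigma> by (rule i)
  show ?thesis unfolding linked_def using inverse_iso x \<tau>_in \<sigma>_\<tau> by metis
qed

text \<open>Applied with \<open>f\<close> the identity for chart changes, and with a local affine
  diffeomorphism for homogeneity. \<open>P\<close> is the part of the domain of \<open>c\<close> on
  which the coordinate expression of \<open>f\<close> makes sense.\<close>

lemma affine_iso_of_charts:
  assumes c: "is_chart c" and d: "is_chart d" and W: "open W" "open W'"
    and f: "homeomorphism W W' f g"
    and fwd: "affine_between W f c d" and bwd: "affine_between W' g d c"
  defines "P \<equiv> {p \<in> W \<inter> chart_dom c. f p \<in> chart_dom d}"
  shows "affine_iso (chart_sym c) (chart_map c ` P) (chart_sym d) (chart_map d ` f ` P) (in_charts c d f) (in_charts d c g)"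
    and "p \<in> P \<Longrightarrow> in_charts c d f (chart_map c p) = chart_map d (f p)"
proof -
  have fg: "g (f p) = p" "f p \<in> W'" if "p \<in> W" for p using f that unfolding homeomorphism_def by auto
  have gf: "f (g q) = q" "g q \<in> W" if "q \<in> W'" for q using f that unfolding homeomorphism_def by auto
  have cf: "continuous_on W f" "continuous_on W' g" using f unfolding homeomorphism_def by auto
  have P: "P = chart_dom c \<inter> (W \<inter> f -` chart_dom d)" by (auto simp: P_def)
  have oP: "open P"
    unfolding P using continuous_open_preimage[OF cf(1) W(1)] is_chartD(1)[OF c] is_chartD(1)[OF d] by blast
  have fP: "f ` P = {q \<in> W' \<inter> chart_dom d. g q \<in> chart_dom c}"
  proof (intro set_eqI iffI)
    show "q \<in> {q \<in> W' \<inter> chart_dom d. g q \<in> chart_dom c}" if "q \<in> f ` P" for q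
      using that fg by (auto simp: P_def)
    show "q \<in> f ` P" if "q \<in> {q \<in> W' \<inter> chart_dom d. g q \<in> chart_dom c}" for q
      using that gf by (intro image_eqI[of _ _ "g q"]) (auto simp: P_def)
  qed
  have e1: "in_charts c d f (chart_map c p) = chart_map d (f p)" if "p \<in> P" for p
    using that is_chartD(5)[OF c] by (simp add: in_charts_def P_def)
  have e2: "in_charts d c g (chart_map d (f p)) = chart_map c p" if "p \<in> P" for p
    using that is_chartD(5)[OF d] fg by (simp add: in_charts_def P_def)
  have A: "affine_map_on (chart_map c ` P) (chart_sym c) (chart_sym d) (in_charts c d f)"
    using fwd unfolding affine_between_def P_def .
  have B: "affine_map_on (chart_map d ` f ` P) (chart_sym d) (chart_sym c) (in_charts d c g)"
    using bwd unfolding affine_between_def fP .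
  have "f ` P = chart_dom d \<inter> (W' \<inter> g -` chart_dom c)" unfolding fP by auto
  then have "open (f ` P)"
    using continuous_open_preimage[OF cf(2) W(2)] is_chartD(1)[OF c] is_chartD(1)[OF d] by (metis open_Int)
  then have oQ: "open (chart_map d ` f ` P)" by (rule chart_image_open[OF d]) (auto simp: P_def)
  show "p \<in> P \<Longrightarrow> in_charts c d f (chart_map c p) = chart_map d (f p)" by (rule e1)
  show "affine_iso (chart_sym c) (chart_map c ` P) (chart_sym d) (chart_map d ` f ` P) (in_charts c d f) (in_charts d c g)"
  proof
    show "open (chart_map c ` P)" by (rule chart_image_open[OF c oP]) (auto simp: P_def)
    show "open (chart_map d ` f ` P)" by (rule oQ)
    show "smooth_conn_on (chart_map c ` P) (chart_sym c)"
      by (rule smooth_conn_on_subset[OF is_chartD(3)[OF c]]) (auto simp: P_def chart_image_def)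
    show "smooth_conn_on (chart_map d ` f ` P) (chart_sym d)"
      by (rule smooth_conn_on_subset[OF is_chartD(3)[OF d]]) (auto simp: P_def chart_image_def)
  qed (use e1 e2 A B in auto)
qed

section \<open>Invariants of pointed germs\<close>

lemma linked_ricci_nonzero:
  assumes "linked \<Gamma> x \<Gamma>' x'" "\<exists>i j. ricci \<Gamma> i j x \<noteq> 0"
  shows "\<exists>i j. ricci \<Gamma>' i j x' \<noteq> 0"
proof -
  obtain U V \<tau> \<sigma> where i: "affine_iso \<Gamma> U \<Gamma>' V \<tau> \<sigma>" and x: "x \<in> U" "x' = \<tau> x"
    using assms unfolding linked_def by blast
  interpret affine_iso \<Gamma> U \<Gamma>' V \<tau> \<sigma> by (rule i)
  show ?thesis
  proof (rule ccontr)
    assume "\<not> ?thesis"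
    then show False using ricci_transform[OF x(1)] assms(2) x(2) by simp
  qed
qed

lemma (in affine_iso) nabla_ricci_transform:
  assumes "x \<in> U"
  shows "nabla_ricci \<Gamma> k i j x = (\<Sum>d\<in>UNIV. \<Sum>a\<in>UNIV. \<Sum>b\<in>UNIV.
     pdc k \<tau> d x * pdc i \<tau> a x * pdc j \<tau> b x * nabla_ricci \<Gamma>' d a b (\<tau> x))"
  by (rule nabla_tensor2_transform[OF ricci_transform smooth_on_ricci[OF open_V smooth_\<Gamma>'] assms])

lemma linked_cubic_at:
  assumes "linked \<Gamma> x \<Gamma>' x'" "cubic_at \<Gamma> x"
  shows "cubic_at \<Gamma>' x'"
proof -
  obtain U V \<tau> \<sigma> where i: "affine_iso \<Gamma>' U \<Gamma> V \<tau> \<sigma>" and x: "x' \<in> U" "x = \<tau> x'"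
    using linked_sym[OF assms(1)] unfolding linked_def by blast
  interpret affine_iso \<Gamma>' U \<Gamma> V \<tau> \<sigma> by (rule i)
  show ?thesis unfolding cubic_at_def
    by (rule cubic_type_transform[OF ricci_transform[OF x(1)] nabla_ricci_transform[OF x(1)] jacobian_det_nonzero[OF x(1)]])
      (use assms(2) x(2) in \<open>simp add: cubic_at_def\<close>)
qed

lemma linked_killing_dim:
  assumes "linked \<Gamma> x \<Gamma>' x'" "killing_dim_at \<Gamma> x n"
  shows "killing_dim_at \<Gamma>' x' n"
  using assms affine_iso.killing_dim_at_transport unfolding linked_def by blast

definition noncommuting_at :: "christoffel \<Rightarrow> real^2 \<Rightarrow> bool" where
  "noncommuting_at \<Gamma> x \<longleftrightarrow> (\<exists>X Y. kill_near \<Gamma> x X \<and> kill_near \<Gamma> x Y \<and> bracket X Y x \<noteq> 0)"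

lemma linked_noncommuting:
  assumes "linked \<Gamma> x \<Gamma>' x'" "noncommuting_at \<Gamma> x"
  shows "noncommuting_at \<Gamma>' x'"
  using assms affine_iso.noncommuting_transport unfolding linked_def noncommuting_at_def by blast

lemma linked_compatible:
  assumes "is_chart c" "is_chart d" "compatible c d" "p \<in> chart_dom c" "p \<in> chart_dom d"
  shows "linked (chart_sym c) (chart_map c p) (chart_sym d) (chart_map d p)"
proof -
  have h: "homeomorphism UNIV UNIV (\<lambda>p. p) (\<lambda>p::'a::topological_space. p)"
    by (simp add: homeomorphism_def continuous_on_id)
  note iso = affine_iso_of_charts[OF assms(1,2) open_UNIV open_UNIV h]
  have b: "affine_between UNIV (\<lambda>p. p) c d" "affine_between UNIV (\<lambda>p. p) d c"
    using assms(3) by (auto simp: compatible_def)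
  show ?thesis unfolding linked_def
    using iso(1)[OF b] iso(2)[OF b, of p] assms(4,5) by (metis (mono_tags, lifting) IntI UNIV_I imageI mem_Collect_eq)
qed

lemma linked_local_diffeo:
  assumes "is_chart c" "is_chart d" "local_affine_diffeo M W f" "c \<in> M" "d \<in> M"
    "p \<in> W" "p \<in> chart_dom c" "f p \<in> chart_dom d"
  shows "linked (chart_sym c) (chart_map c p) (chart_sym d) (chart_map d (f p))"
proof -
  have h: "open W" "open (f ` W)" "homeomorphism W (f ` W) f (inv_into W f)"
    and b: "affine_between W f c d" "affine_between (f ` W) (inv_into W f) d c"
    using assms(3-5) by (auto simp: local_affine_diffeo_def)
  note iso = affine_iso_of_charts[OF assms(1,2) h]
  show ?thesis unfolding linked_def
    using iso(1)[OF b] iso(2)[OF b, of p] assms(6-8) by (metis (mono_tags, lifting) IntI imageI mem_Collect_eq)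
qed

lemma compatible_sym: "compatible c d \<longleftrightarrow> compatible d c"
  by (auto simp: compatible_def)

lemma atlas_subset_local_coordinates: "affine_surface M \<Longrightarrow> M \<subseteq> local_coordinates M"
  by (auto simp: affine_surface_def local_coordinates_def)

text \<open>Local affine diffeomorphisms are tested in charts of the atlas only. The path from
  \<open>c\<close> to \<open>d\<close> therefore changes to an atlas chart at \<open>p\<close>,
  follows a symmetry to \<open>q\<close>, and changes chart again.\<close>

lemma homogeneous_invariant:
  assumes M: "affine_surface M" "locally_homogeneous M"
    and c: "c \<in> local_coordinates M" "p \<in> chart_dom c" and d: "d \<in> local_coordinates M" "q \<in> chart_dom d"
    and inv: "\<And>\<Gamma> x \<Gamma>' x'. linked \<Gamma> x \<Gamma>' x' \<Longrightarrow> Q \<Gamma> x \<Longrightarrow> Q \<Gamma>' x'"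
    and Q: "Q (chart_sym c) (chart_map c p)"
  shows "Q (chart_sym d) (chart_map d q)"
proof -
  have "p \<in> (\<Union>c\<in>M. chart_dom c)" "q \<in> (\<Union>c\<in>M. chart_dom c)" using M(1) by (auto simp: affine_surface_def)
  then obtain c1 d1 where 1: "c1 \<in> M" "p \<in> chart_dom c1" "d1 \<in> M" "q \<in> chart_dom d1" by blast
  have ch: "is_chart c" "is_chart d" "is_chart c1" "is_chart d1" "compatible c c1" "compatible d1 d"
    using c d 1 M(1) by (auto simp: local_coordinates_def affine_surface_def compatible_sym)
  obtain W f where W: "p \<in> W" "f p = q" "local_affine_diffeo M W f"
    using M(2) unfolding locally_homogeneous_def by blast
  have "Q (chart_sym c1) (chart_map c1 p)"
    by (rule inv[OF linked_compatible Q]) (use ch 1 c in auto)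
  then have "Q (chart_sym d1) (chart_map d1 q)"
    using inv[OF linked_local_diffeo[OF ch(3,4) W(3) 1(1,3) W(1) 1(2)]] W(2) 1(4) by simp
  then show ?thesis
    by (rule inv[OF linked_compatible, rotated -1]) (use ch 1 d in auto)
qed

text \<open>This admits coordinates with constant symbols to the maximal atlas. Compatibility with
  \<open>d\<close> is inherited from \<open>b\<close> by composing the coordinate changes with
  \<open>\<sigma>\<close> and \<open>\<tau>\<close>.\<close>

lemma chart_change:
  fixes b :: "'a::topological_space chart"
  assumes b: "is_chart b" and N: "N \<subseteq> chart_image b" and iso: "affine_iso (chart_sym b) N \<Gamma>' (\<tau> ` N) \<tau> \<sigma>"
    and sym: "\<And>x i j k. x \<in> \<tau> ` N \<Longrightarrow> \<Gamma>' i j k x = \<Gamma>' j i k x"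
  defines "c \<equiv> ({p \<in> chart_dom b. chart_map b p \<in> N}, \<lambda>p. \<tau> (chart_map b p), \<Gamma>')"
  shows "is_chart c" and "chart_image c = \<tau> ` N" and "\<And>d. is_chart d \<Longrightarrow> compatible b d \<Longrightarrow> compatible c d"
proof -
  interpret affine_iso "chart_sym b" N \<Gamma>' "\<tau> ` N" \<tau> \<sigma> by (rule iso)
  define D where "D = {p \<in> chart_dom b. chart_map b p \<in> N}"
  let ?f = "\<lambda>p. \<tau> (chart_map b p)"
  let ?g = "inv_into D ?f"
  define bi where "bi = inv_into (chart_dom b) (chart_map b)"
  have bi: "p \<in> chart_dom b \<Longrightarrow> bi (chart_map b p) = p" for p
    unfolding bi_def by (rule is_chartD(5)[OF b])
  have bi': "bi y \<in> D" "chart_map b (bi y) = y" if "y \<in> N" for y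
  proof -
    obtain p where "p \<in> chart_dom b" "y = chart_map b p" using N \<open>y \<in> N\<close> by (auto simp: chart_image_def)
    then show "bi y \<in> D" "chart_map b (bi y) = y" using bi that by (auto simp: D_def)
  qed
  have c: "chart_dom c = D" "chart_map c = ?f" "chart_sym c = \<Gamma>'"
    by (simp_all add: c_def D_def chart_dom_def chart_map_def chart_sym_def)
  have bD: "chart_map b ` D = N" using bi' by (auto simp: D_def image_iff) metis
  have img: "chart_image c = \<tau> ` N" unfolding chart_image_def c using bD by (simp add: image_image[symmetric])
  then show "chart_image c = \<tau> ` N" .
  have oD: "open D"
  proof -
    have "D = chart_dom b \<inter> chart_map b -` N" by (auto simp: D_def)
    then show ?thesis using continuous_open_preimage[OF is_chartD(6,1)[OF b] open_U] by simp
  qed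
  have inj: "inj_on ?f D"
  proof (rule inj_onI)
    fix p q assume "p \<in> D" "q \<in> D" "\<tau> (chart_map b p) = \<tau> (chart_map b q)"
    then have "chart_map b p = chart_map b q" using \<sigma>_\<tau> by (metis (mono_tags, lifting) D_def mem_Collect_eq)
    then show "p = q" using bi \<open>p \<in> D\<close> \<open>q \<in> D\<close> by (metis (mono_tags, lifting) D_def mem_Collect_eq)
  qed
  have ci: "?g y = bi (\<sigma> y)" if "y \<in> \<tau> ` N" for y
    by (rule inv_into_f_eq[OF inj]) (use bi' \<sigma>_in[OF that] \<tau>_\<sigma>[OF that] in auto)
  have cont\<tau>: "continuous_on N \<tau>" and cont\<sigma>: "continuous_on (\<tau> ` N) \<sigma>"
  proof -
    have "continuous_on N (\<lambda>y. \<chi> a. \<tau> y $ a)" "continuous_on (\<tau> ` N) (\<lambda>y. \<chi> a. \<sigma> y $ a)"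
      by (intro continuous_on_vec_lambda smooth_on_continuous smooth_\<tau> smooth_\<sigma>)+
    then show "continuous_on N \<tau>" "continuous_on (\<tau> ` N) \<sigma>" by simp_all
  qed
  have hom: "homeomorphism D (\<tau> ` N) ?f ?g"
    unfolding homeomorphism_def
  proof (intro conjI ballI)
    show "continuous_on D ?f"
      by (rule continuous_on_compose2[OF cont\<tau> continuous_on_subset[OF is_chartD(6)[OF b]]]) (auto simp: D_def)
    have "continuous_on (\<tau> ` N) (\<lambda>y. bi (\<sigma> y))"
      by (rule continuous_on_compose2[OF continuous_on_subset[OF is_chartD(7)[OF b] N] cont\<sigma>, folded bi_def])
        (use \<sigma>_in in auto)
    then show "continuous_on (\<tau> ` N) ?g"
      using ci by (simp cong: continuous_on_cong)
    show "?f ` D = \<tau> ` N" using bD by (simp add: image_image[symmetric])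
    show "?g (\<tau> (chart_map b p)) = p" if "p \<in> D" for p
      using inv_into_f_f[OF inj that] .
    show "\<tau> (chart_map b (?g y)) = y" if "y \<in> \<tau> ` N" for y
      using ci[OF that] bi'(2)[OF \<sigma>_in[OF that]] \<tau>_\<sigma>[OF that] by simp
    show "?g ` \<tau> ` N = D"
    proof (intro set_eqI iffI)
      show "p \<in> D" if "p \<in> ?g ` \<tau> ` N" for p
        using that ci bi'(1) \<sigma>_in by auto
      show "p \<in> ?g ` \<tau> ` N" if "p \<in> D" for p
        using that inv_into_f_f[OF inj that] by (rule_tac image_eqI[where x = "\<tau> (chart_map b p)"]) (auto simp: D_def)
    qed
  qed
  show cc: "is_chart c"
    unfolding is_chart_def img unfolding c
    using oD open_V hom smooth_\<Gamma>' sym by (auto simp: smooth_conn_on_def)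
  fix d :: "'a chart" assume d: "is_chart d" "compatible b d"
  let ?P = "chart_dom b \<inter> chart_dom d"
  have fwd: "affine_map_on (chart_map b ` ?P) (chart_sym b) (chart_sym d) (in_charts b d (\<lambda>p. p))"
    and bwd: "affine_map_on (chart_map d ` ?P) (chart_sym d) (chart_sym b) (in_charts d b (\<lambda>p. p))"
    using d(2) by (simp_all add: compatible_def affine_between_def Int_def conj_commute)
  let ?Q = "D \<inter> chart_dom d"
  have oP: "open (chart_map b ` ?P)" "open (chart_map d ` ?Q)" "open (chart_map c ` ?Q)"
    using chart_image_open[OF b, of ?P] chart_image_open[OF d(1), of ?Q] chart_image_open[OF cc, of ?Q]
      is_chartD(1)[OF b] is_chartD(1)[OF d(1)] oD by (auto simp: c)
  have Qsub: "chart_map c ` ?Q \<subseteq> \<tau> ` N" "chart_map d ` ?Q \<subseteq> chart_map d ` ?P"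
    by (auto simp: c D_def)
  have "affine_map_on (chart_map c ` ?Q) \<Gamma>' (chart_sym d) (\<lambda>y. in_charts b d (\<lambda>p. p) (\<sigma> y))"
  proof (rule affine_map_on_comp[OF oP(3,1) affine_map_on_subset[OF affine_\<sigma> Qsub(1)] fwd])
    show "\<sigma> ` chart_map c ` ?Q \<subseteq> chart_map b ` ?P" using \<sigma>_\<tau> by (auto simp: c D_def)
  qed
  then have 1: "affine_map_on (chart_map c ` ?Q) \<Gamma>' (chart_sym d) (in_charts c d (\<lambda>p. p))"
    by (rule affine_map_on_cong[OF oP(3), rotated]) (use Qsub(1) ci in \<open>auto simp: in_charts_def c bi_def subset_eq\<close>)
  have "affine_map_on (chart_map d ` ?Q) (chart_sym d) \<Gamma>' (\<lambda>y. \<tau> (in_charts d b (\<lambda>p. p) y))"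
  proof (rule affine_map_on_comp[OF oP(2) open_U affine_map_on_subset[OF bwd Qsub(2)] affine_\<tau>])
    show "in_charts d b (\<lambda>p. p) ` chart_map d ` ?Q \<subseteq> N"
      using is_chartD(5)[OF d(1)] by (auto simp: in_charts_def D_def)
  qed
  then have 2: "affine_map_on (chart_map d ` ?Q) (chart_sym d) \<Gamma>' (in_charts d c (\<lambda>p. p))"
    by (rule affine_map_on_cong[OF oP(2), rotated]) (simp add: in_charts_def c)
  show "compatible c d"
    using 1 2 by (simp add: compatible_def affine_between_def c Int_def conj_commute)
qed

section \<open>Condition (2) as a pointwise condition\<close>

lemma rank_one_iff:
  fixes A :: "real^2^2"
  shows "rank A = 1 \<longleftrightarrow> A \<noteq> 0 \<and> det A = 0"
proof -
  have "rank A \<le> 2" using rank_bound[of A] by simp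
  moreover have "rank A = 0 \<longleftrightarrow> A = 0" by (rule rank_eq_0)
  moreover have "det A = 0 \<longleftrightarrow> rank A < 2" using det_eq_0_rank[of A] by simp
  ultimately show ?thesis by linarith
qed

lemma recurrent_if_cubic:
  assumes M: "affine_surface M" and cub: "\<And>c x. c \<in> M \<Longrightarrow> x \<in> chart_image c \<Longrightarrow> cubic_at (chart_sym c) x"
  shows "recurrent M Ricci"
proof -
  \<comment> \<open>Pairing \<open>\<nabla>\<rho> = \<omega> \<otimes> \<rho>\<close> with
    \<open>\<rho>\<close> in the Euclidean inner product of the chart solves for
    \<open>\<omega>\<close> by a quotient that is visibly smooth.\<close>
  define \<omega> :: "'a chart \<Rightarrow> 2 \<Rightarrow> real^2 \<Rightarrow> real" where
    "\<omega> c k x = (\<Sum>i\<in>UNIV. \<Sum>j\<in>UNIV. nabla_ricci (chart_sym c) k i j x * ricci (chart_sym c) i j x)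
      * inverse (\<Sum>i\<in>UNIV. \<Sum>j\<in>UNIV. ricci (chart_sym c) i j x * ricci (chart_sym c) i j x)" for c k x
  have ch: "is_chart c" if "c \<in> M" for c using M that by (simp add: affine_surface_def)
  have nz: "(\<Sum>i\<in>UNIV. \<Sum>j\<in>UNIV. ricci (chart_sym c) i j x * ricci (chart_sym c) i j x) \<noteq> 0"
    and rec: "nabla_ricci (chart_sym c) k i j x = \<omega> c k x * ricci (chart_sym c) i j x"
    if c: "c \<in> M" "x \<in> chart_image c" for c x k i j
  proof -
    let ?r = "\<lambda>i j. ricci (chart_sym c) i j x"
    let ?T = "\<lambda>k i j. nabla_ricci (chart_sym c) k i j x"
    obtain w where w: "\<And>k i j. ?T k i j = w k * ?r i j" and ne: "\<exists>i j. ?r i j \<noteq> 0"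
      using cub[OF c] unfolding cubic_at_def cubic_type_iff by blast
    show nz: "(\<Sum>i\<in>UNIV. \<Sum>j\<in>UNIV. ?r i j * ?r i j) \<noteq> 0"
    proof
      assume "(\<Sum>i\<in>UNIV. \<Sum>j\<in>UNIV. ?r i j * ?r i j) = 0"
      then have "?r i j * ?r i j = 0" for i j
        by (simp add: sum_nonneg_eq_0_iff sum_nonneg)
      with ne show False by simp
    qed
    have "\<omega> c k x = w k * (\<Sum>i\<in>UNIV. \<Sum>j\<in>UNIV. ?r i j * ?r i j) * inverse (\<Sum>i\<in>UNIV. \<Sum>j\<in>UNIV. ?r i j * ?r i j)"
      unfolding \<omega>_def w by (simp add: sum_distrib_left mult.assoc)
    then have "\<omega> c k x = w k" using nz by (simp add: mult.assoc)
    then show "?T k i j = \<omega> c k x * ?r i j" by (simp add: w)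
  qed
  have "one_form M \<omega>"
    unfolding one_form_def
  proof (intro conjI ballI allI)
    fix c i assume c: "c \<in> M"
    have s: "smooth_on (chart_image c) (ricci (chart_sym c) i j)" for i j
      by (rule smooth_on_ricci[OF is_chartD(2,3)[OF ch[OF c]]])
    have t: "smooth_on (chart_image c) (nabla_ricci (chart_sym c) k i j)" for i j k
      by (rule smooth_on_nabla_tensor2[OF is_chartD(2,3)[OF ch[OF c]] s])
    show "smooth_on (chart_image c) (\<omega> c i)"
      unfolding \<omega>_def[abs_def]
      by (intro smooth_on_mult smooth_on_inverse smooth_on_sum is_chartD(2)[OF ch[OF c]] finite s t nz[OF c])
  next
    fix c d x i assume c: "c \<in> M" and d: "d \<in> M" and x: "x \<in> chart_map c ` (chart_dom c \<inter> chart_dom d)"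
    have h: "homeomorphism UNIV UNIV (\<lambda>p. p) (\<lambda>p::'a. p)"
      by (simp add: homeomorphism_def continuous_on_id)
    have b: "affine_between UNIV (\<lambda>p. p) c d" "affine_between UNIV (\<lambda>p. p) d c"
      using M c d by (auto simp: affine_surface_def compatible_def)
    let ?P = "{p \<in> UNIV \<inter> chart_dom c. p \<in> chart_dom d}"
    define \<tau> where "\<tau> = in_charts c d (\<lambda>p. p)"
    note iso = affine_iso_of_charts[OF ch[OF c] ch[OF d] open_UNIV open_UNIV h b, folded \<tau>_def]
    interpret affine_iso "chart_sym c" "chart_map c ` ?P" "chart_sym d"
      "chart_map d ` (\<lambda>p. p) ` ?P" \<tau> "in_charts d c (\<lambda>p. p)"
      by (rule iso(1))
    obtain p where p: "x = chart_map c p" "p \<in> chart_dom c" "p \<in> chart_dom d" using x by blast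
    have x': "x \<in> chart_map c ` ?P" and xi: "x \<in> chart_image c"
      using p by (auto simp: chart_image_def)
    have \<tau>x: "\<tau> x \<in> chart_image d" using iso(2)[of p] p by (simp add: chart_image_def)
    obtain a e where ne: "ricci (chart_sym c) a e x \<noteq> 0"
      using cub[OF c xi] unfolding cubic_at_def cubic_type_iff by blast
    \<comment> \<open>The formula for \<open>\<omega>\<close> is not covariant. Its transformation
      law follows from uniqueness: both sides, multiplied by one non-zero component of
      \<open>\<rho>\<close>, give the same component of \<nabla>\<rho>.\<close>
    have "\<omega> c i x * ricci (chart_sym c) a e x = (\<Sum>k\<in>UNIV. pdc i \<tau> k x * \<omega> d k (\<tau> x)) * ricci (chart_sym c) a e x"
      unfolding rec[OF c xi, symmetric] nabla_ricci_transform[OF x'] rec[OF d \<tau>x]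
      unfolding ricci_transform[OF x'] by (simp add: sum_2 algebra_simps)
    then show "\<omega> c i x = (\<Sum>a\<in>UNIV. pd i (\<lambda>y. in_charts c d (\<lambda>p. p) y $ a) x * \<omega> d a (in_charts c d (\<lambda>p. p) x))"
      using ne by (simp add: \<tau>_def)
  qed
  then show ?thesis
    unfolding recurrent_def Nabla2_def Ricci_def using rec by blast
qed

lemma symmetric_recurrent_iff_cubic:
  assumes M: "affine_surface M"
  shows "symmetric2 M Ricci \<and> recurrent M Ricci \<and> has_rank M Ricci 1 \<and> symmetric3 M (Nabla2 Ricci)
    \<longleftrightarrow> (\<forall>c\<in>M. \<forall>x\<in>chart_image c. cubic_at (chart_sym c) x)"
proof
  assume L: "symmetric2 M Ricci \<and> recurrent M Ricci \<and> has_rank M Ricci 1 \<and> symmetric3 M (Nabla2 Ricci)"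
  show "\<forall>c\<in>M. \<forall>x\<in>chart_image c. cubic_at (chart_sym c) x"
  proof (intro ballI)
    fix c x assume c: "c \<in> M" "x \<in> chart_image c"
    let ?r = "\<lambda>i j. ricci (chart_sym c) i j x"
    have "rank (\<chi> i j. ?r i j :: real^2^2) = 1" using L c by (simp add: has_rank_def Ricci_def)
    then have r: "(\<chi> i j. ?r i j :: real^2^2) \<noteq> 0" "?r 1 1 * ?r 2 2 = ?r 1 2 * ?r 2 1"
      unfolding rank_one_iff by (auto simp: det_2)
    from r(1) have ne: "\<exists>i j. ?r i j \<noteq> 0" by (auto simp: vec_eq_iff)
    obtain \<omega> where w: "\<forall>k i j. nabla_ricci (chart_sym c) k i j x = \<omega> c k x * ?r i j"
      using L c unfolding recurrent_def Nabla2_def Ricci_def by blast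
    have s: "\<forall>i j. ?r i j = ?r j i" using L c unfolding symmetric2_def Ricci_def by blast
    have t: "\<forall>i j k. nabla_ricci (chart_sym c) i j k x = nabla_ricci (chart_sym c) j i k x"
      using L c unfolding symmetric3_def Nabla2_def Ricci_def by blast
    show "cubic_at (chart_sym c) x"
      unfolding cubic_at_def cubic_type_iff
      by (intro conjI s r(2) ne t exI[of _ "\<lambda>k. \<omega> c k x"] w)
  qed
next
  assume R: "\<forall>c\<in>M. \<forall>x\<in>chart_image c. cubic_at (chart_sym c) x"
  have sym: "ricci (chart_sym c) i j x = ricci (chart_sym c) j i x"
    and rank: "rank (\<chi> i j. ricci (chart_sym c) i j x :: real^2^2) = 1" if "c \<in> M" "x \<in> chart_image c" for c x i j
  proof -
    have "cubic_at (chart_sym c) x" using R that by blast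
    then show "ricci (chart_sym c) i j x = ricci (chart_sym c) j i x" "rank (\<chi> i j. ricci (chart_sym c) i j x :: real^2^2) = 1"
      unfolding cubic_at_def cubic_type_iff rank_one_iff by (auto simp: det_2 vec_eq_iff)
  qed
  moreover have "symmetric3 M (Nabla2 Ricci)"
    unfolding symmetric3_def
  proof (intro ballI allI)
    fix c x i j k assume "c \<in> M" "x \<in> chart_image c"
    then obtain t and a :: "2 \<Rightarrow> real" where "\<And>k i j. nabla_ricci (chart_sym c) k i j x = t * a k * a i * a j"
      using R unfolding cubic_at_def cubic_type_def by blast
    then show "Nabla2 Ricci c i j k x = Nabla2 Ricci c i k j x \<and> Nabla2 Ricci c i j k x = Nabla2 Ricci c j i k x \<and>
      Nabla2 Ricci c i j k x = Nabla2 Ricci c j k i x \<and> Nabla2 Ricci c i j k x = Nabla2 Ricci c k i j x \<and>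
      Nabla2 Ricci c i j k x = Nabla2 Ricci c k j i x"
      by (simp add: Nabla2_def Ricci_def)
  qed
  moreover have "recurrent M Ricci" using recurrent_if_cubic[OF M] R by blast
  ultimately show "symmetric2 M Ricci \<and> recurrent M Ricci \<and> has_rank M Ricci 1 \<and> symmetric3 M (Nabla2 Ricci)"
    unfolding symmetric2_def has_rank_def Ricci_def by simp
qed

text \<open>In dimension two every curvature component is zero or, up to sign, a component of the
  Ricci tensor.\<close>

lemma riem_nonzero_imp_ricci_nonzero:
  assumes "riem \<Gamma> m i j k x \<noteq> 0"
  shows "\<exists>i j. ricci \<Gamma> i j x \<noteq> 0"
proof (rule ccontr)
  assume n: "\<not> ?thesis"
  have "ricci \<Gamma> 1 j x = - riem \<Gamma> 1 2 j 2 x" "ricci \<Gamma> 2 j x = riem \<Gamma> 1 2 j 1 x" for j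
    by (simp_all add: ricci_eq_riem sum_2 riem_alternating)
  then have "riem \<Gamma> 1 2 j 1 x = 0" "riem \<Gamma> 1 2 j 2 x = 0" for j using n by auto
  then have "riem \<Gamma> m i j k x = 0"
    using exhaust_2[of m] exhaust_2[of i] exhaust_2[of k] riem_alternating by auto
  with assms show False by simp
qed

theorem corollary3p19:
  fixes M :: "'a::{t2_space, second_countable_topology} chart set"
    and c :: "'a chart"
    and C :: "2 \<Rightarrow> 2 \<Rightarrow> 2 \<Rightarrow> real"
  assumes "affine_surface M"
    and "type_B M"
    and "\<not> flat_surface M"
    and "c \<in> local_coordinates M" and "chart_dom c \<noteq> {}"
    and "type_B_coordinates c C"
    and "\<And>i j k. C i j k = C j i k"
  shows "(type_A M \<longleftrightarrow>
            symmetric2 M Ricci \<and> recurrent M Ricci \<and> has_rank M Ricci 1 \<and> symmetric3 M (Nabla2 Ricci))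
       \<and> (symmetric2 M Ricci \<and> recurrent M Ricci \<and> has_rank M Ricci 1 \<and> symmetric3 M (Nabla2 Ricci)
            \<longleftrightarrow> dim_killing M 4)
       \<and> (dim_killing M 4 \<longleftrightarrow> C 1 2 1 = 0 \<and> C 2 2 1 = 0 \<and> C 2 2 2 = 0)"
proof -
  have hom: "locally_homogeneous M" using assms(2) by (simp add: type_B_def)
  note inv = homogeneous_invariant[OF assms(1) hom]
  have inv_cubic: "cubic_at (chart_sym d) (chart_map d q)"
    if "b \<in> local_coordinates M" "r \<in> chart_dom b" "d \<in> local_coordinates M" "q \<in> chart_dom d"
      "cubic_at (chart_sym b) (chart_map b r)" for b d r q
    by (rule inv[where Q = "\<lambda>\<Gamma> x. cubic_at \<Gamma> x", OF that(1-4) _ that(5)]) (erule (1) linked_cubic_at)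
  have inv_dim: "killing_dim_at (chart_sym d) (chart_map d q) 4"
    if "b \<in> local_coordinates M" "r \<in> chart_dom b" "d \<in> local_coordinates M" "q \<in> chart_dom d"
      "killing_dim_at (chart_sym b) (chart_map b r) 4" for b d r q
    by (rule inv[where Q = "\<lambda>\<Gamma> x. killing_dim_at \<Gamma> x 4", OF that(1-4) _ that(5)]) (erule (1) linked_killing_dim)
  have inv_noncommuting: "noncommuting_at (chart_sym d) (chart_map d q)"
    if "b \<in> local_coordinates M" "r \<in> chart_dom b" "d \<in> local_coordinates M" "q \<in> chart_dom d"
      "noncommuting_at (chart_sym b) (chart_map b r)" for b d r q
    by (rule inv[where Q = "\<lambda>\<Gamma> x. noncommuting_at \<Gamma> x", OF that(1-4) _ that(5)]) (erule (1) linked_noncommuting)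
  have MLC: "d \<in> M \<Longrightarrow> d \<in> local_coordinates M" for d
    using atlas_subset_local_coordinates[OF assms(1)] by blast
  obtain p where p: "p \<in> chart_dom c" using assms(5) by blast
  define x where "x = chart_map c p"
  have x: "x \<in> chart_image c" using p by (simp add: x_def chart_image_def)
  \<comment> \<open>Non-flatness gives a single point with \<rho> \<noteq> 0; homogeneity spreads
    this to every point and every chart.\<close>
  obtain d0 q0 i j k where d0: "d0 \<in> M" "q0 \<in> chart_dom d0"
    "curvature (chart_sym d0) (coord_field i) (coord_field j) (coord_field k) (chart_map d0 q0) \<noteq> 0"
    using assms(3) unfolding flat_surface_def chart_image_def by blast
  then obtain l where "riem (chart_sym d0) i j k l (chart_map d0 q0) \<noteq> 0"
    by (auto simp: vec_eq_iff curvature_coord_field)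
  from riem_nonzero_imp_ricci_nonzero[OF this] have nz0: "\<exists>i j. ricci (chart_sym d0) i j (chart_map d0 q0) \<noteq> 0" .
  have nz: "\<exists>i j. ricci (chart_sym d) i j (chart_map d q) \<noteq> 0" if "d \<in> local_coordinates M" "q \<in> chart_dom d" for d q
    using inv[where Q = "\<lambda>\<Gamma> x. \<exists>i j. ricci \<Gamma> i j x \<noteq> 0", OF MLC[OF d0(1)] d0(2) that linked_ricci_nonzero nz0] .
  \<comment> \<open>The symmetry of \<open>D\<close> is read off from the torsion-freeness built
    into charts, so that the argument also covers Type B charts other than \<open>c\<close>.\<close>
  have B_conn: "type_B_conn (chart_sym d) (chart_image d) D"
    if d: "d \<in> local_coordinates M" "type_B_coordinates d D" "chart_dom d \<noteq> {}" for d D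
  proof
    have ch: "is_chart d" using d(1) by (simp add: local_coordinates_def)
    show "open (chart_image d)" by (rule is_chartD(2)[OF ch])
    show "x \<in> chart_image d \<Longrightarrow> x $ 1 \<noteq> 0"
      "x \<in> chart_image d \<Longrightarrow> chart_sym d i j k x = inverse (x $ 1) * D i j k" for x i j k
      using d(2) by (auto simp: type_B_coordinates_def)
    obtain y where y: "y \<in> chart_image d" using d(3) by (auto simp: chart_image_def)
    fix i j k
    have "inverse (y $ 1) * D i j k = inverse (y $ 1) * D j i k" "y $ 1 \<noteq> 0"
      using is_chartD(4)[OF ch y, of i j k] d(2) y by (auto simp: type_B_coordinates_def)
    then show "D i j k = D j i k" by simp
  qed
  interpret B: type_B_conn "chart_sym c" "chart_image c" C by (rule B_conn[OF assms(4,6,5)])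
  have nzx: "\<exists>i j. ricci (chart_sym c) i j x \<noteq> 0" using nz[OF assms(4) p] by (simp add: x_def)
  have cubic_iff: "(\<forall>d\<in>M. \<forall>y\<in>chart_image d. cubic_at (chart_sym d) y) \<longleftrightarrow> cubic_at (chart_sym c) x"
  proof
    assume R: "\<forall>d\<in>M. \<forall>y\<in>chart_image d. cubic_at (chart_sym d) y"
    then have "cubic_at (chart_sym d0) (chart_map d0 q0)" using d0 by (auto simp: chart_image_def)
    from inv_cubic[OF MLC[OF d0(1)] d0(2) assms(4) p this]
    show "cubic_at (chart_sym c) x" by (simp add: x_def)
  next
    assume "cubic_at (chart_sym c) x"
    then show "\<forall>d\<in>M. \<forall>y\<in>chart_image d. cubic_at (chart_sym d) y"
      using inv_cubic[OF assms(4) p MLC] by (auto simp: x_def chart_image_def)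
  qed
  have dim_iff: "dim_killing M 4 \<longleftrightarrow> killing_dim_at (chart_sym c) x 4"
  proof -
    have loc: "killing_dim d q 4 \<longleftrightarrow> killing_dim_at (chart_sym d) (chart_map d q) 4" if "d \<in> M" "q \<in> chart_dom d" for d q
    proof -
      have ch: "is_chart d" using that(1) assms(1) by (simp add: affine_surface_def)
      show ?thesis
        by (rule killing_dim_iff[OF is_chartD(2,3)[OF ch]]) (use that(2) in \<open>simp add: chart_image_def\<close>)
    qed
    show ?thesis
    proof
      assume "dim_killing M 4"
      then have "killing_dim_at (chart_sym d0) (chart_map d0 q0) 4" using loc d0 by (auto simp: dim_killing_def)
      from inv_dim[OF MLC[OF d0(1)] d0(2) assms(4) p this]
      show "killing_dim_at (chart_sym c) x 4" by (simp add: x_def)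
    next
      assume "killing_dim_at (chart_sym c) x 4"
      then show "dim_killing M 4"
        using inv_dim[OF assms(4) p MLC] loc
        by (auto simp: x_def dim_killing_def)
    qed
  qed
  have dim_cubic: "killing_dim_at (chart_sym c) x 4 \<Longrightarrow> cubic_at (chart_sym c) x"
    by (rule B.killing_dim_imp_cubic[OF x _ nzx])
  have cubic_C: "cubic_at (chart_sym c) x \<Longrightarrow> C 1 2 1 = 0 \<and> C 2 2 1 = 0 \<and> C 2 2 2 = 0"
    by (rule B.cubic_type_imp[OF x])
  have C_dim: "killing_dim_at (chart_sym c) x 4" if C0: "C 1 2 1 = 0 \<and> C 2 2 1 = 0 \<and> C 2 2 2 = 0"
  proof -
    obtain N \<tau> \<sigma> where N: "x \<in> N"
      and iso: "affine_iso (chart_sym c) N (model_conn (1 + C 1 1 1) (C 1 2 2)) (\<tau> ` N) \<tau> \<sigma>"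
      using B.to_model[OF _ _ _ x] C0 by blast
    have link: "linked (chart_sym c) x (model_conn (1 + C 1 1 1) (C 1 2 2)) (\<tau> x)"
      using N iso unfolding linked_def by blast
    \<comment> \<open>Non-vanishing of \<rho>, carried over to the model, is precisely the
      hypothesis of \<open>killing_dim_model\<close>.\<close>
    have "C 1 2 2 * (1 + C 1 1 1 - C 1 2 2) \<noteq> 0"
      using linked_ricci_nonzero[OF link nzx] unfolding ricci_model by (auto split: if_splits)
    then show ?thesis using linked_killing_dim[OF linked_sym[OF link]] killing_dim_model by blast
  qed
  have A_cubic: "cubic_at (chart_sym c) x" if typeA: "type_A M"
  proof -
    obtain b A where b: "b \<in> local_coordinates M" "p \<in> chart_dom b" "\<forall>x\<in>chart_image b. \<forall>i j k. chart_sym b i j k x = A i j k"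
      using typeA unfolding type_A_def type_A_coordinates_def by blast
    have ch: "is_chart b" using b(1) by (simp add: local_coordinates_def)
    have y: "chart_map b p \<in> chart_image b" using b(2) by (simp add: chart_image_def)
    interpret A: type_A_conn "chart_sym b" "chart_image b" A
    proof
      show "A i j k = A j i k" for i j k using is_chartD(4)[OF ch y, of i j k] b(3) y by simp
    qed (use b(3) is_chartD(2)[OF ch] in auto)
    have "noncommuting_at (chart_sym c) (chart_map c p)"
      using B.noncommuting[OF x] unfolding noncommuting_at_def x_def .
    from inv_noncommuting[OF assms(4) p b(1,2) this]
    have "noncommuting_at (chart_sym b) (chart_map b p)" .
    then have "A.\<rho> 1 1 * A.\<rho> 2 2 = A.\<rho> 1 2 * A.\<rho> 2 1"
      using A.regular_commuting[OF y] unfolding noncommuting_at_def by blast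
    then have "cubic_at (chart_sym b) (chart_map b p)"
      by (rule A.singular_cubic[OF y _ nz[OF b(1,2)]])
    from inv_cubic[OF b(1,2) assms(4) p this] show ?thesis by (simp add: x_def)
  qed
  have cubic_A: "type_A M" if cub: "cubic_at (chart_sym c) x"
    unfolding type_A_def
  proof (intro conjI allI)
    fix q
    \<comment> \<open>A Type A chart is required near every point. The Type B chart at
      \<open>q\<close> has its own coefficients \<open>D\<close>, and the vanishing of three of them
      is derived anew from the invariant normal form.\<close>
    obtain b D where b: "b \<in> local_coordinates M" "q \<in> chart_dom b" "type_B_coordinates b D"
      using assms(2) unfolding type_B_def by blast
    have ch: "is_chart b" using b(1) by (simp add: local_coordinates_def)
    have y: "chart_map b q \<in> chart_image b" using b(2) by (simp add: chart_image_def)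
    interpret D: type_B_conn "chart_sym b" "chart_image b" D by (rule B_conn[OF b(1,3)]) (use b(2) in auto)
    have "cubic_at (chart_sym b) (chart_map b q)"
      using inv_cubic[OF assms(4) p b(1,2)] cub by (simp add: x_def)
    then have "D 1 2 1 = 0 \<and> D 2 2 1 = 0 \<and> D 2 2 2 = 0"
      by (rule D.cubic_type_imp[OF y])
    then obtain N \<tau> \<sigma> where N: "chart_map b q \<in> N" "N \<subseteq> chart_image b"
      and iso: "affine_iso (chart_sym b) N (model_conn (1 + D 1 1 1) (D 1 2 2)) (\<tau> ` N) \<tau> \<sigma>"
      using D.to_model[OF _ _ _ y] by blast
    define b' where "b' = ({p \<in> chart_dom b. chart_map b p \<in> N}, \<lambda>p. \<tau> (chart_map b p), model_conn (1 + D 1 1 1) (D 1 2 2))"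
    have sym: "model (1 + D 1 1 1) (D 1 2 2) i j k = model (1 + D 1 1 1) (D 1 2 2) j i k" for i j k
      by (auto simp: model_def)
    note change = chart_change[OF ch N(2) iso sym, folded b'_def]
    have "b' \<in> local_coordinates M"
      using change(1,3) b(1) assms(1) by (auto simp: local_coordinates_def affine_surface_def)
    moreover have "q \<in> chart_dom b'" using b(2) N(1) by (simp add: b'_def chart_dom_def)
    moreover have "type_A_coordinates b'"
      unfolding type_A_coordinates_def by (rule exI[of _ "model (1 + D 1 1 1) (D 1 2 2)"]) (simp add: b'_def chart_sym_def)
    ultimately show "\<exists>c\<in>local_coordinates M. q \<in> chart_dom c \<and> type_A_coordinates c" by blast
  qed (use assms(3) hom in auto)
  show ?thesis
    unfolding symmetric_recurrent_iff_cubic[OF assms(1)] cubic_iff dim_iff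
    using dim_cubic cubic_C C_dim A_cubic cubic_A by blast
qed

end
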